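(* Let $\mu$ be a probability measure on $\mathbb{R}$ with cumulative distribution function $F_\mu$, and let $N\geq 1$. For each integer $k\geq 1$, let $X_1,\ldots,X_N$ be independent real random variables with common cumulative distribution function $F_\mu^{1/k}$, let $U$ be a Haar-distributed $N\times N$ unitary random matrix independent of $(X_1,\ldots,X_N)$, set $M=U\,\mathrm{diag}(X_1,\ldots,X_N)\,U^*$, and let $M_1,\ldots,M_k$ be independent copies of $M$. Then, as $k\to\infty$, the distribution of $M_1\vee\cdots\vee M_k$ converges (weakly) to a probability measure $\Lambda_N^\vee(\mu)$ on the space of $N\times N$ Hermitian matrices. This measure is invariant under conjugation by any unitary matrix. If $\mu$ has no atom, then under $\Lambda_N^\vee(\mu)$ the joint distribution of the eigenvalues ranked in decreasing order is absolutely continuous with respect to $\mu^{\otimes N}$, with density $$(t_1,\ldots,t_N)\mapsto N^N\,1_{t_1\geq\cdots\geq t_N}\prod_{i=1}^N\frac{F_\mu(t_N)}{F_\mu(t_i)}$$ at every point $(t_1,\ldots,t_N)\in\mathbb{R}^N$ such that $F_\mu(t_i)\neq 0$ for all $i$ (and density $0$ elsewhere). Moreover, if $\nu$ is another probability measure on $\mathbb{R}$ and $A,B$ are independent random matrices with respective laws $\Lambda_N^\vee(\mu)$ and $\Lambda_N^\vee(\nu)$, then $A\vee B$ has law $\Lambda_N^\vee(\rho)$, where $\rho$ is the probability measure on $\mathbb{R}$ with $F_\rho=F_\mu F_\nu$.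
   Context: For a probability measure $\mu$ on $\mathbb{R}$, $F_\mu(x)=\mu((-\infty,x])$. For Hermitian $N\times N$ matrices $A,B$, the supremum $A\vee B$ (Olson's spectral order) is the unique Hermitian matrix $h$ such that for every $t\in\mathbb{R}$, the spectral projection $\chi_{(t,\infty)}(h)$ equals the orthogonal projection onto $\mathrm{Im}(\chi_{(t,\infty)}(A))+\mathrm{Im}(\chi_{(t,\infty)}(B))$; concretely, if $\lambda_1>\cdots>\lambda_p$ is the union of the spectra of $A$ and $B$ and $E_i=\sum_{j\le i}(\ker(A-\lambda_j I)+\ker(B-\lambda_j I))$, $E_0=\{0\}$, then $A\vee B=\sum_{j=1}^p\lambda_j P_{E_j\cap E_{j-1}^\perp}$, with $P_F$ the orthogonal projector onto $F$. Multiple suprema $M_1\vee\cdots\vee M_k$ are taken iteratively. *)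

theory Defs
  imports "HOL-Probability.Probability"
begin

type_synonym 'n cmat = "complex^'n^'n"

definition adj :: "'n::finite cmat \<Rightarrow> 'n cmat" where
  "adj A = (\<chi> i j. cnj (A $ j $ i))"

definition hermitian :: "'n::finite cmat \<Rightarrow> bool" where
  "hermitian A \<longleftrightarrow> adj A = A"

definition unitary :: "'n::finite cmat \<Rightarrow> bool" where
  "unitary U \<longleftrightarrow> adj U ** U = mat 1"

definition herm_set :: "'n::finite cmat set" where
  "herm_set = {A. hermitian A}"

definition diag_mat :: "('n::finite \<Rightarrow> real) \<Rightarrow> 'n cmat" where
  "diag_mat x = (\<chi> i j. if i = j then complex_of_real (x i) else 0)"

definition cinner :: "complex^'n::finite \<Rightarrow> complex^'n \<Rightarrow> complex" where
  "cinner x y = (\<Sum>i\<in>UNIV. x $ i * cnj (y $ i))"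

definition orth :: "(complex^'n::finite) set \<Rightarrow> (complex^'n) set" where
  "orth E = {x. \<forall>y\<in>E. cinner x y = 0}"

definition proj :: "(complex^'n::finite) set \<Rightarrow> 'n cmat" where
  "proj E = (THE P. hermitian P \<and> P ** P = P \<and> range (\<lambda>x. P *v x) = E)"

definition eigsp :: "'n::finite cmat \<Rightarrow> real \<Rightarrow> (complex^'n) set" where
  "eigsp A l = {x. A *v x = complex_of_real l *s x}"

definition spec :: "'n::finite cmat \<Rightarrow> real set" where
  "spec A = {l. \<exists>x. x \<noteq> 0 \<and> A *v x = complex_of_real l *s x}"

text \<open>Olson supremum in the spectral order (concrete formula of the paper):
  with S = spec A \<union> spec B, E(l) is the span of all eigenspaces of A and B for
  eigenvalues \<ge> l, E'(l) the span for eigenvalues > l (E' of the top eigenvalue is {0}).\<close>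
definition sup_upto :: "'n::finite cmat \<Rightarrow> 'n cmat \<Rightarrow> (real \<Rightarrow> bool) \<Rightarrow> (complex^'n) set" where
  "sup_upto A B P = vec.span (\<Union>m\<in>{m\<in>spec A \<union> spec B. P m}. eigsp A m \<union> eigsp B m)"

definition hsup :: "'n::finite cmat \<Rightarrow> 'n cmat \<Rightarrow> 'n cmat" where
  "hsup A B = (\<Sum>l\<in>spec A \<union> spec B.
      l *\<^sub>R proj (sup_upto A B (\<lambda>m. m \<ge> l) \<inter> orth (sup_upto A B (\<lambda>m. m > l))))"

fun hsup_iter :: "(nat \<Rightarrow> 'n::finite cmat) \<Rightarrow> nat \<Rightarrow> 'n cmat" where
  "hsup_iter Ms 0 = 0"
| "hsup_iter Ms (Suc 0) = Ms 0"
| "hsup_iter Ms (Suc (Suc n)) = hsup (hsup_iter Ms (Suc n)) (Ms (Suc n))"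

definition is_haar :: "'n::finite cmat measure \<Rightarrow> bool" where
  "is_haar H \<longleftrightarrow> prob_space H \<and> sets H = sets borel \<and> emeasure H {U. unitary U} = 1 \<and>
     (\<forall>V. unitary V \<longrightarrow> distr H borel (\<lambda>U. V ** U) = H)"

definition root_law :: "real measure \<Rightarrow> nat \<Rightarrow> real measure" where
  "root_law \<mu> k = interval_measure (\<lambda>x. cdf \<mu> x powr (1 / real k))"

definition law_M :: "'n::finite cmat measure \<Rightarrow> real measure \<Rightarrow> nat \<Rightarrow> 'n cmat measure" where
  "law_M H \<mu> k = distr (PiM (UNIV::'n set) (\<lambda>_. root_law \<mu> k) \<Otimes>\<^sub>M H) borel
      (\<lambda>(x, U). U ** diag_mat x ** adj U)"

definition law_sup :: "'n::finite cmat measure \<Rightarrow> real measure \<Rightarrow> nat \<Rightarrow> 'n cmat measure" where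
  "law_sup H \<mu> k = distr (PiM {..<k} (\<lambda>_. law_M H \<mu> k)) borel (\<lambda>Ms. hsup_iter Ms k)"

definition weak_conv_herm :: "(nat \<Rightarrow> 'n::finite cmat measure) \<Rightarrow> 'n cmat measure \<Rightarrow> bool" where
  "weak_conv_herm Ms M \<longleftrightarrow> (\<forall>f :: 'n cmat \<Rightarrow> real.
     continuous_on herm_set f \<and> bounded (f ` herm_set) \<longrightarrow>
     (\<lambda>k. set_lebesgue_integral (Ms k) herm_set f) \<longlonglongrightarrow> set_lebesgue_integral M herm_set f)"

text \<open>Eigenvalues ranked in decreasing order, with multiplicity, indexed by 1..N:
  t_i = max of the eigenvalues l such that the eigenspaces for eigenvalues \<ge> l span
  a space of dimension \<ge> i.\<close>
definition eig_desc :: "'n::finite cmat \<Rightarrow> nat \<Rightarrow> real" where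
  "eig_desc A = (\<lambda>i\<in>{1..CARD('n)}.
     Max {l\<in>spec A. vec.dim (vec.span (\<Union>m\<in>{m\<in>spec A. m \<ge> l}. eigsp A m)) \<ge> i})"

definition eig_density :: "nat \<Rightarrow> real measure \<Rightarrow> (nat \<Rightarrow> real) \<Rightarrow> ennreal" where
  "eig_density N \<mu> t =
     (if (\<forall>i\<in>{1..N}. cdf \<mu> (t i) \<noteq> 0) \<and> (\<forall>i\<in>{1..<N}. t i \<ge> t (Suc i))
      then ennreal (real N ^ N * (\<Prod>i\<in>{1..N}. cdf \<mu> (t N) / cdf \<mu> (t i)))
      else 0)"

end

theory Submission
  imports Defs
begin

text \<open>Averaging over a Haar unitary shows that a conjugation invariant law of Hermitian matrices is
  determined by the law of its ranked eigenvalues. If \<open>A\<close> and \<open>B\<close> are independent and one of them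
  is invariant, their spectral subspaces above a level \<open>t\<close> are in general position, so the number
  of eigenvalues of \<open>A \<or> B\<close> above \<open>t\<close> is the sum of the two numbers, truncated at \<open>N\<close>. Hence the
  eigenvalues of \<open>M\<^sub>1 \<or> \<dots> \<or> M\<^sub>k\<close> are the \<open>N\<close> largest among \<open>k N\<close> independent samples with
  distribution function \<open>F\<^bsup>1/k\<^esup>\<close>.

  Such a sample is the quantile function of \<open>\<mu>\<close> at a variable with density
  \<open>(1/k) q\<^bsup>1/k - 1\<^esup>\<close> on \<open>(0,1)\<close>. The \<open>N\<close> largest of these variables, ranked, have the density
  \<open>c\<^sub>k \<Prod>\<^sub>i (v\<^sub>N / v\<^sub>i)\<^bsup>1 - 1/k\<^esup>\<close>, which is bounded by \<open>N\<^sup>N\<close> and converges to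
  \<open>N\<^sup>N \<Prod>\<^sub>i v\<^sub>N / v\<^sub>i\<close>. Dominated convergence yields the limit law, and the quantile function
  transports the limit density to the stated one when \<open>\<mu>\<close> has no atom.

  For the last claim, the samples for \<open>\<rho>\<close> are maxima of independent samples for \<open>\<mu>\<close> and \<open>\<nu>\<close>. For
  finite \<open>k\<close>, counting maxima above a level differs from counting all samples above it only with
  probability \<open>O(1/k)\<close>, so both sides have the same limit.\<close>

section \<open>Complex inner products and orthogonal projections\<close>

text \<open>Laws are compared through the events \<open>\<forall>i\<in>I. cnt A (t i) < r i\<close>.
  With \<open>r i = i\<close> for all ranks they are the lower orthants of the ranked eigenvalues.
  Conditionally on the eigenvalues of \<open>B\<close>, such an event for the supremum of
  \<open>A\<close> and \<open>B\<close> is an event of the same shape for \<open>A\<close> with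
  lowered thresholds; hence \<open>r\<close> is kept arbitrary, and the truncation at
  \<open>N\<close> stays invisible as long as \<open>r i \<le> N\<close>. Independent samples obey
  the same recursion, which is why they can replace the eigenvalues.

  Passing to the unit interval before ranking removes ties, so that the ranked variables have a
  density even when \<mu> has atoms, and this density is the same for every \<mu>. Its convergence
  gives more than weak convergence: integrals of all bounded Borel functions converge. The last
  claim uses this, because counting events need not have null boundary and both arguments of the
  supremum vary with \<open>k\<close>.\<close>

lemma cinner_add_left: "cinner (x + y) z = cinner x z + cinner y z"
  by (simp add: cinner_def ring_distribs sum.distrib)

lemma cinner_diff_left: "cinner (x - y) z = cinner x z - cinner y z"
  by (simp add: cinner_def ring_distribs sum_subtractf)

lemma cinner_scale_left: "cinner (c *s x) z = c * cinner x z"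
  by (simp add: cinner_def sum_distrib_left mult_ac)

lemma cinner_commute: "cnj (cinner x y) = cinner y x"
  by (simp add: cinner_def mult_ac)

lemma cinner_scale_right: "cinner x (c *s z) = cnj c * cinner x z"
  by (simp add: cinner_def sum_distrib_left mult_ac)

lemma cinner_sum_left: "cinner (\<Sum>i\<in>S. f i) z = (\<Sum>i\<in>S. cinner (f i) z)"
  unfolding cinner_def sum_component sum_distrib_right by (rule sum.swap)

lemma cinner_zero [simp]: "cinner 0 x = 0" "cinner x 0 = 0"
  by (simp_all add: cinner_def)

lemma inner_eq_Re_cinner: "inner x y = Re (cinner x y)"
  by (simp add: inner_vec_def cinner_def inner_complex_def Re_sum)

lemma cinner_self: "cinner x x = complex_of_real ((norm x)\<^sup>2)"
proof -
  have "Im (cinner x x) = 0"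
    by (simp add: cinner_def Im_sum)
  then show ?thesis
    by (simp add: complex_eq_iff power2_norm_eq_inner inner_eq_Re_cinner)
qed

lemma cinner_self_eq_0 [simp]: "cinner x x = 0 \<longleftrightarrow> x = 0"
  by (simp add: cinner_self)

lemma cinner_right_eqI: "(\<And>y. cinner x y = cinner x' y) \<Longrightarrow> x = x'"
  by (metis cinner_diff_left cinner_self_eq_0 right_minus_eq)

lemma cinner_mult_vec: "cinner (A *v x) y = cinner x (adj A *v y)"
  unfolding cinner_def matrix_vector_mult_def adj_def
  by (simp add: sum_distrib_left sum_distrib_right mult_ac) (rule sum.swap)

lemma of_real_smult [simp]: "complex_of_real c *s x = c *\<^sub>R x"
  by (simp add: vec_eq_iff) (simp add: scaleR_conv_of_real)

lemma mult_vec_scaleR: "A *v (c *\<^sub>R x) = c *\<^sub>R (A *v (x :: complex^'n::finite))"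
  by (metis of_real_smult vec.scale)

lemma adj_adj [simp]: "adj (adj A) = A"
  by (simp add: adj_def)

lemma adj_mult: "adj (A ** B) = adj B ** adj A"
  by (simp add: adj_def matrix_matrix_mult_def vec_eq_iff mult_ac)

lemma adj_mat_1 [simp]: "adj (mat 1) = mat 1"
  by (simp add: adj_def mat_def vec_eq_iff)

lemma adj_diff: "adj (A - B) = adj A - adj B"
  by (simp add: adj_def vec_eq_iff)

lemma adj_sum: "adj (\<Sum>i\<in>S. f i) = (\<Sum>i\<in>S. adj (f i))"
  by (simp add: adj_def vec_eq_iff sum_component)

lemma adj_scaleR: "adj (c *\<^sub>R A) = c *\<^sub>R adj A"
  by (simp add: adj_def vec_eq_iff)

lemma adj_diag_mat [simp]: "adj (diag_mat x) = diag_mat x"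
  by (simp add: adj_def diag_mat_def vec_eq_iff)

lemma hermitian_cinner: "hermitian A \<Longrightarrow> cinner (A *v x) y = cinner x (A *v y)"
  by (simp add: cinner_mult_vec hermitian_def)

lemma hermitian_inner: "hermitian A \<Longrightarrow> inner (A *v x) y = inner x (A *v y)"
  by (simp add: inner_eq_Re_cinner hermitian_cinner)

lemma hermitian_diff: "hermitian A \<Longrightarrow> hermitian B \<Longrightarrow> hermitian (A - B)"
  by (simp add: hermitian_def adj_diff)

lemma matrix_eqI: "(\<And>x. A *v x = B *v x) \<Longrightarrow> A = (B :: 'n::finite cmat)"
  by (simp add: matrix_eq)

lemma unitary_left: "unitary U \<Longrightarrow> adj U ** U = mat 1"
  and unitary_right: "unitary U \<Longrightarrow> U ** adj U = mat 1"
  by (simp_all add: unitary_def matrix_left_right_inverse)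

lemma unitary_adj: "unitary U \<Longrightarrow> unitary (adj U)"
  by (simp add: unitary_def matrix_left_right_inverse)

lemma unitary_vec: "unitary U \<Longrightarrow> adj U *v (U *v x) = x" "unitary U \<Longrightarrow> U *v (adj U *v x) = x"
  by (simp_all add: matrix_vector_mul_assoc unitary_left unitary_right)

lemma unitary_cinner: "unitary U \<Longrightarrow> cinner (U *v x) (U *v y) = cinner x y"
  by (simp add: cinner_mult_vec unitary_vec)

lemma unitary_inj: "unitary U \<Longrightarrow> inj ((*v) U)"
  by (metis injI unitary_vec(1))

lemma hermitian_conj: "hermitian A \<Longrightarrow> hermitian (U ** A ** adj U)"
  by (simp add: hermitian_def adj_mult matrix_mul_assoc)

lemma hermitian_diag_mat: "hermitian (diag_mat x)"
  by (simp add: hermitian_def)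

lemma diag_mat_vec: "(diag_mat x *v y) $ i = complex_of_real (x i) * y $ i"
  by (simp add: diag_mat_def matrix_vector_mult_def mult_delta_left)

lemma subspace_vec_real: "vec.subspace (W :: (complex^'n::finite) set) \<Longrightarrow> subspace W"
  unfolding subspace_def vec.subspace_def by (metis of_real_smult)

lemma subspace_orth: "vec.subspace (orth E)"
  by (simp add: vec.subspace_def orth_def cinner_add_left cinner_scale_left)

lemma orth_span: "orth (vec.span E) = orth E"
proof
  show "orth (vec.span E) \<subseteq> orth E"
    by (auto simp: orth_def vec.span_base)
  have "cinner x y = 0" if "x \<in> orth E" "y \<in> vec.span E" for x y
  proof -
    have "cinner y x = 0"
      using that(2)
      by (induction rule: vec.span_induct_alt)
        (use that(1) in \<open>auto simp: cinner_add_left cinner_scale_left orth_def\<close>, metis cinner_commute complex_cnj_zero)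
    then show ?thesis by (metis cinner_commute complex_cnj_zero)
  qed
  then show "orth E \<subseteq> orth (vec.span E)" by (auto simp: orth_def)
qed

text \<open>A maximiser of the Rayleigh quotient over the unit sphere of \<open>W\<close> is an eigenvector: for
  \<open>z = l v - A v\<close> the form \<open>l |y|\<^sup>2 - (A y, y)\<close> is nonnegative on \<open>W\<close>, zero at \<open>v\<close>, and has
  derivative \<open>2 |z|\<^sup>2\<close> there in direction \<open>z\<close>.\<close>
lemma hermitian_eigenvector:
  assumes A: "hermitian (A :: 'n::finite cmat)" and W: "vec.subspace W"
    and inv: "\<And>x. x \<in> W \<Longrightarrow> A *v x \<in> W" and w: "w \<in> W" "w \<noteq> 0"
  obtains v l where "v \<in> W" "norm v = 1" "A *v v = complex_of_real l *s v"
proof -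
  have W': "subspace W" by (rule subspace_vec_real[OF W])
  define K where "K = W \<inter> sphere 0 1"
  have "compact K"
    unfolding K_def using closed_subspace[OF W'] by (intro closed_Int_compact) auto
  moreover have "(1 / norm w) *\<^sub>R w \<in> K"
    unfolding K_def using w W' by (auto simp: subspace_scale)
  moreover have "continuous_on K (\<lambda>x. inner (A *v x) x)"
    by (intro continuous_intros linear_continuous_on_compose matrix_vector_mul_bounded_linear
        bounded_linear.continuous_on[OF matrix_vector_mul_bounded_linear])
  ultimately obtain v where v: "v \<in> K" "\<And>y. y \<in> K \<Longrightarrow> inner (A *v y) y \<le> inner (A *v v) v"
    using continuous_attains_sup[of K "\<lambda>x. inner (A *v x) x"] by blast
  define l where "l = inner (A *v v) v"
  define q where "q = (\<lambda>y. l * inner y y - inner (A *v y) y)"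
  have q_nonneg: "0 \<le> q y" if "y \<in> W" for y
  proof (cases "y = 0")
    case False
    have "(1 / norm y) *\<^sub>R y \<in> K"
      unfolding K_def using False that W' by (auto simp: subspace_scale)
    then have "inner (A *v ((1 / norm y) *\<^sub>R y)) ((1 / norm y) *\<^sub>R y) \<le> l"
      unfolding l_def by (rule v)
    then have "inner (A *v y) y / (norm y * norm y) \<le> l"
      unfolding mult_vec_scaleR by simp
    then show ?thesis
      using False unfolding q_def by (simp add: divide_le_eq power2_norm_eq_inner[symmetric] power2_eq_square)
  qed (simp add: q_def)
  define z where "z = l *\<^sub>R v - A *v v"
  have vW: "v \<in> W" and nv: "norm v = 1" using v(1) by (auto simp: K_def)
  have zW: "z \<in> W"
    unfolding z_def using vW inv W' by (auto intro!: subspace_diff subspace_scale)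
  have qv: "q v = 0"
    using nv by (simp add: q_def l_def power2_norm_eq_inner[symmetric])
  have q_exp: "q (v - t *\<^sub>R z) = t\<^sup>2 * q z - 2 * t * inner z z" for t
  proof -
    have h: "inner (A *v z) v = inner (A *v v) z"
      using hermitian_inner[OF A, of z v] by (simp add: inner_commute)
    have "q (v - t *\<^sub>R z) = q v + t\<^sup>2 * q z - 2 * t * inner (l *\<^sub>R v - A *v v) z"
      unfolding q_def
      by (simp add: matrix_vector_mult_diff_distrib mult_vec_scaleR inner_diff_left
          inner_diff_right h inner_commute[of z v] power2_eq_square algebra_simps)
    then show ?thesis by (simp add: qv z_def)
  qed
  have "inner z z = 0"
  proof (rule ccontr)
    assume ne: "inner z z \<noteq> 0"
    define c where "c = inner z z"
    define d where "d = q z"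
    have c: "c > 0" using ne inner_ge_zero[of z] unfolding c_def by linarith
    have d: "d \<ge> 0" unfolding d_def by (rule q_nonneg[OF zW])
    \<comment> \<open>With this \<open>t\<close> one has \<open>t * d = c - t\<close>, so
      \<open>q (v - t z) = t * (t * d - 2 * c)\<close> equals \<open>- t * (c + t)\<close>, which is
      negative. The \<open>+ 1\<close> covers \<open>d = 0\<close>.\<close>
    define t where "t = c / (d + 1)"
    have t: "t > 0" "t * (d + 1) = c" using c d by (auto simp: t_def)
    have "0 \<le> q (v - t *\<^sub>R z)"
      using vW zW W' by (intro q_nonneg) (auto intro!: subspace_diff subspace_scale)
    then have "0 \<le> t * (t * d - 2 * c)"
      unfolding q_exp c_def[symmetric] d_def[symmetric] by (simp add: power2_eq_square algebra_simps)
    then have "0 \<le> t * d - 2 * c" using t(1) by (simp add: zero_le_mult_iff)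
    moreover have "t * d = c - t" using t(2) by (simp add: algebra_simps)
    ultimately show False using c t(1) by linarith
  qed
  then have "A *v v = complex_of_real l *s v" by (simp add: z_def)
  with vW nv show thesis by (rule that)
qed

section \<open>Orthonormal eigenbases and orthogonal projections\<close>

definition orthonormal :: "(complex^'n::finite) set \<Rightarrow> bool" where
  "orthonormal S \<longleftrightarrow> (\<forall>b\<in>S. \<forall>c\<in>S. cinner b c = (if b = c then 1 else 0))"

lemma orthonormal_independent:
  assumes "orthonormal S" "finite S" shows "vec.independent S"
proof (rule vec.independent_if_scalars_zero[OF assms(2)])
  fix f x assume eq: "(\<Sum>x\<in>S. f x *s x) = 0" and x: "x \<in> S"
  have "0 = cinner (\<Sum>x\<in>S. f x *s x) x" by (simp add: eq)
  also have "\<dots> = (\<Sum>y\<in>S. if y = x then f y else 0)"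
    unfolding cinner_sum_left using assms(1) x
    by (intro sum.cong) (auto simp: cinner_scale_left orthonormal_def)
  also have "\<dots> = f x" using x assms(2) by simp
  finally show "f x = 0" by simp
qed

lemma orthonormal_card: "orthonormal (S :: (complex^'n::finite) set) \<Longrightarrow> finite S \<Longrightarrow> card S \<le> CARD('n)"
  using vec.independent_card_le_dim[OF subset_UNIV orthonormal_independent, of S] by (metis vec_dim_card)

text \<open>A largest orthonormal set of eigenvectors in \<open>W\<close> spans \<open>W\<close>:
  otherwise the part of \<open>W\<close> orthogonal to it is nonzero and again invariant, so it
  contains one more unit eigenvector. Cardinalities are bounded by the dimension, so a largest set
  exists.\<close>

lemma orthonormal_eigenbasis:
  assumes A: "hermitian (A :: 'n::finite cmat)" and W: "vec.subspace W"
    and inv: "\<And>x. x \<in> W \<Longrightarrow> A *v x \<in> W"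
  obtains S where "finite S" "orthonormal S" "vec.span S = W"
    "\<And>b. b \<in> S \<Longrightarrow> \<exists>l::real. A *v b = complex_of_real l *s b"
proof -
  define P where "P S \<longleftrightarrow> finite S \<and> orthonormal S \<and> S \<subseteq> W \<and>
    (\<forall>b\<in>S. \<exists>l::real. A *v b = complex_of_real l *s b)" for S
  have "P {}" by (simp add: P_def orthonormal_def)
  then obtain S where S: "P S" and max: "\<And>T. P T \<Longrightarrow> card T \<le> card S"
  proof -
    have "\<forall>T. P T \<longrightarrow> card T < Suc CARD('n)"
      using orthonormal_card by (auto simp: P_def less_Suc_eq_le)
    from ex_has_greatest_nat[of P "{}" card, OF \<open>P {}\<close> this] show thesis
      using that by metis
  qed
  have fin: "finite S" and on: "orthonormal S" and SW: "S \<subseteq> W" using S by (auto simp: P_def)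
  have "vec.span S = W"
  proof (rule ccontr)
    assume ne: "vec.span S \<noteq> W"
    have "vec.span S \<subseteq> W" using SW W by (rule vec.span_minimal)
    then obtain w where w: "w \<in> W" "w \<notin> vec.span S" using ne by auto
    define w' where "w' = w - (\<Sum>b\<in>S. cinner w b *s b)"
    have sum_in: "(\<Sum>b\<in>S. cinner w b *s b) \<in> vec.span S"
      by (intro vec.span_sum vec.span_scale vec.span_base)
    have "w' \<noteq> 0" using w(2) sum_in by (auto simp: w'_def)
    have "cinner w' c = 0" if "c \<in> S" for c
    proof -
      have "cinner (\<Sum>b\<in>S. cinner w b *s b) c = (\<Sum>b\<in>S. if b = c then cinner w c else 0)"
        unfolding cinner_sum_left using that on
        by (intro sum.cong) (auto simp: cinner_scale_left orthonormal_def)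
      then show ?thesis using that fin by (simp add: w'_def cinner_diff_left)
    qed
    moreover have "w' \<in> W"
      unfolding w'_def using w(1) sum_in \<open>vec.span S \<subseteq> W\<close> W by (auto intro: vec.subspace_diff)
    ultimately have w': "w' \<in> W \<inter> orth S" by (simp add: orth_def)
    have "A *v x \<in> W \<inter> orth S" if "x \<in> W \<inter> orth S" for x
    proof -
      have "cinner (A *v x) b = 0" if b: "b \<in> S" for b
      proof -
        obtain l :: real where "A *v b = complex_of_real l *s b" using S b by (auto simp: P_def)
        then have "cinner (A *v x) b = cnj (complex_of_real l) * cinner x b"
          by (simp only: hermitian_cinner[OF A] cinner_scale_right)
        then show ?thesis using b \<open>x \<in> W \<inter> orth S\<close> by (simp add: orth_def)
      qed
      then show ?thesis using that inv by (simp add: orth_def)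
    qed
    then obtain v l where v: "v \<in> W \<inter> orth S" "norm v = 1" "A *v v = complex_of_real l *s v"
      using hermitian_eigenvector[OF A vec.subspace_inter[OF W subspace_orth] _ w' \<open>w' \<noteq> 0\<close>] by metis
    have vS: "v \<notin> S" using v(1,2) by (auto simp: orth_def)
    have "cinner b v = 0" "cinner v b = 0" if "b \<in> S" for b
      using v(1) that cinner_commute[of v b] by (auto simp: orth_def)
    then have "P (insert v S)"
      using S v vS by (auto simp: P_def orthonormal_def cinner_self)
    from max[OF this] show False using fin vS by simp
  qed
  then show thesis using that S by (auto simp: P_def)
qed

lemma sum_mult_vec: "(\<Sum>i\<in>S. f i) *v x = (\<Sum>i\<in>S. f i *v (x :: complex^'n::finite))"
  by (induction S rule: infinite_finite_induct) (auto simp: matrix_vector_mult_add_rdistrib)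

lemma scaleR_mult_vec: "(c *\<^sub>R A) *v x = c *\<^sub>R (A *v (x :: complex^'n::finite))"
  by (simp add: matrix_vector_mult_def vec_eq_iff scaleR_sum_right)

lemma orthonormal_expand:
  assumes "finite S" "orthonormal S" "x \<in> vec.span S"
  shows "x = (\<Sum>b\<in>S. cinner x b *s b)"
proof -
  define w where "w = x - (\<Sum>b\<in>S. cinner x b *s b)"
  have "cinner w c = 0" if "c \<in> S" for c
  proof -
    have "cinner (\<Sum>b\<in>S. cinner x b *s b) c = (\<Sum>b\<in>S. if b = c then cinner x c else 0)"
      unfolding cinner_sum_left using that assms(2)
      by (intro sum.cong) (auto simp: cinner_scale_left orthonormal_def)
    then show ?thesis using that assms(1) by (simp add: w_def cinner_diff_left)
  qed
  then have "w \<in> orth (vec.span S)" unfolding orth_span by (simp add: orth_def)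
  moreover have "w \<in> vec.span S"
    unfolding w_def
    by (intro vec.span_diff[OF assms(3)] vec.span_sum vec.span_scale) (rule vec.span_base)
  ultimately have "cinner w w = 0" by (simp add: orth_def)
  then show ?thesis by (simp add: w_def)
qed

text \<open>Every vector is an eigenvector of the zero matrix, so
  \<open>orthonormal_eigenbasis\<close> supplies an orthonormal basis of \<open>E\<close>, and
  \<open>P\<close> is the sum of the rank one projections of its members. The trace is recorded
  because it later makes dimensions measurable.\<close>

lemma ex_proj:
  fixes E :: "(complex^'n::finite) set"
  assumes "vec.subspace E"
  obtains P where "hermitian P" "P ** P = P" "range ((*v) P) = E" "trace P = of_nat (vec.dim E)"
proof -
  have "hermitian (0 :: 'n cmat)" by (simp add: hermitian_def adj_def vec_eq_iff)
  then obtain S :: "(complex^'n) set" where S: "finite S" "orthonormal S" "vec.span S = E"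
    by (rule orthonormal_eigenbasis[OF _ assms]) (auto simp: vec.subspace_0[OF assms])
  define P :: "'n cmat" where "P = (\<chi> i j. \<Sum>b\<in>S. b $ i * cnj (b $ j))"
  have "(P *v x) $ i = (\<Sum>b\<in>S. cinner x b *s b) $ i" for x i
  proof -
    have "(P *v x) $ i = (\<Sum>j\<in>UNIV. \<Sum>b\<in>S. b $ i * cnj (b $ j) * x $ j)"
      by (simp add: P_def matrix_vector_mult_def sum_distrib_right)
    also have "\<dots> = (\<Sum>b\<in>S. \<Sum>j\<in>UNIV. b $ i * cnj (b $ j) * x $ j)"
      by (rule sum.swap)
    finally show ?thesis
      by (simp add: cinner_def sum_component sum_distrib_left sum_distrib_right mult_ac)
  qed
  then have Pv: "P *v x = (\<Sum>b\<in>S. cinner x b *s b)" for x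
    by (simp add: vec_eq_iff)
  have fix': "P *v x = x" if "x \<in> E" for x
    using orthonormal_expand[OF S(1,2), of x] that S(3) by (simp add: Pv)
  have ran: "P *v x \<in> E" for x
    unfolding Pv S(3)[symmetric] by (intro vec.span_sum vec.span_scale vec.span_base)
  show thesis
  proof
    show "hermitian P" by (simp add: hermitian_def adj_def P_def vec_eq_iff mult_ac)
    show "P ** P = P"
      by (rule matrix_eqI) (simp add: matrix_vector_mul_assoc[symmetric] fix' ran)
    show "range ((*v) P) = E" using fix' ran by (metis image_subset_iff rangeI subsetI subset_antisym)
    have "trace P = (\<Sum>b\<in>S. cinner b b)"
      unfolding trace_def P_def cinner_def by simp (rule sum.swap)
    also have "\<dots> = of_nat (card S)" using S(2) by (simp add: orthonormal_def)
    also have "card S = vec.dim E"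
      using S orthonormal_independent[OF S(2,1)] vec.dim_eq_card_independent vec.dim_span by metis
    finally show "trace P = of_nat (vec.dim E)" .
  qed
qed

text \<open>Equal ranges give \<open>P ** Q = Q\<close> and \<open>Q ** P = P\<close>; these two
  products are adjoint to each other and \<open>Q\<close> is self-adjoint.\<close>

lemma proj_unique:
  assumes "hermitian P" "P ** P = P" "hermitian Q" "Q ** Q = Q" "range ((*v) P) = range ((*v) Q)"
  shows "P = Q"
proof -
  have absorb: "P ** Q = Q" if PP: "P ** P = P" and QP: "range ((*v) Q) \<subseteq> range ((*v) P)" for P Q :: "'a cmat"
  proof (rule matrix_eqI)
    fix x
    obtain z where z: "Q *v x = P *v z" using QP by auto
    show "(P ** Q) *v x = Q *v x"
      by (simp only: matrix_vector_mul_assoc[symmetric] z) (simp only: matrix_vector_mul_assoc PP)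
  qed
  have "P ** Q = Q" "Q ** P = P" using assms by (auto intro!: absorb)
  then show ?thesis using assms(1,3) adj_mult[of P Q] by (simp add: hermitian_def)
qed

lemma proj_eqI:
  assumes "hermitian P" "P ** P = P" "range ((*v) P) = E"
  shows "proj E = P"
  unfolding proj_def using assms by (intro the_equality) (auto intro: proj_unique)

context
  fixes E :: "(complex^'n::finite) set"
  assumes E: "vec.subspace E"
begin

lemma hermitian_proj: "hermitian (proj E)"
  and proj_idem: "proj E ** proj E = proj E"
  and range_proj: "range ((*v) (proj E)) = E"
  and trace_proj: "trace (proj E) = of_nat (vec.dim E)"
  using ex_proj[OF E] proj_eqI by metis+

lemma proj_in: "proj E *v x \<in> E"
  using range_proj by auto

lemma proj_fix: "x \<in> E \<Longrightarrow> proj E *v x = x"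
  using range_proj proj_idem by (metis imageE matrix_vector_mul_assoc)

lemma proj_orth_eq_0: "x \<in> orth E \<Longrightarrow> proj E *v x = 0"
  using proj_in[of x] proj_fix[of "proj E *v x"] hermitian_cinner[OF hermitian_proj, of x "proj E *v x"]
  by (simp add: orth_def)

lemma proj_residual: "x - proj E *v x \<in> orth E"
  by (simp add: orth_def cinner_diff_left hermitian_cinner[OF hermitian_proj] proj_fix)

end

text \<open>Turns each summand of \<open>hsup\<close> into a difference of projections onto nested
  subspaces, so that sums over levels telescope.\<close>

lemma proj_diff:
  assumes G: "vec.subspace G" and H: "vec.subspace H" and HG: "H \<subseteq> G"
  shows "proj (G \<inter> orth H) = proj G - proj H"
proof (rule proj_eqI)
  have in1: "proj G *v x - proj H *v x \<in> G \<inter> orth H" for x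
  proof -
    have "proj G *v x - proj H *v x \<in> G"
      using proj_in[OF G] proj_in[OF H] HG by (blast intro: vec.subspace_diff[OF G])
    moreover have "cinner (proj G *v x - proj H *v x) y = 0" if "y \<in> H" for y
    proof -
      have "proj G *v y = y" "proj H *v y = y" using that HG proj_fix G H by auto
      then show ?thesis
        by (simp add: cinner_diff_left hermitian_cinner[OF hermitian_proj] G H)
    qed
    ultimately show ?thesis by (simp add: orth_def)
  qed
  have fix1: "proj G *v x - proj H *v x = x" if "x \<in> G \<inter> orth H" for x
    using that G H by (simp add: proj_fix proj_orth_eq_0)
  show "hermitian (proj G - proj H)" using G H by (intro hermitian_diff hermitian_proj)
  show "(proj G - proj H) ** (proj G - proj H) = proj G - proj H"
    by (rule matrix_eqI)
      (simp only: matrix_vector_mul_assoc[symmetric] matrix_vector_mult_diff_rdistrib fix1[OF in1])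
  show "range ((*v) (proj G - proj H)) = G \<inter> orth H"
  proof
    show "range ((*v) (proj G - proj H)) \<subseteq> G \<inter> orth H"
      using in1 by (auto simp: matrix_vector_mult_diff_rdistrib)
    show "G \<inter> orth H \<subseteq> range ((*v) (proj G - proj H))"
      using fix1 by (metis matrix_vector_mult_diff_rdistrib rangeI subsetI)
  qed
qed

lemma conj_vec: "(V ** A ** adj V) *v x = V *v (A *v (adj V *v x))"
  by (simp only: matrix_vector_mul_assoc[symmetric])

lemma subspace_image: "vec.subspace E \<Longrightarrow> vec.subspace ((*v) V ` E)"
  by (rule vec.subspace_image)

lemma proj_conj:
  assumes V: "unitary V" and E: "vec.subspace E"
  shows "proj ((*v) V ` E) = V ** proj E ** adj V"
proof (rule proj_eqI)
  show "hermitian (V ** proj E ** adj V)" by (intro hermitian_conj hermitian_proj E)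
  have idem: "proj E *v (proj E *v x) = proj E *v x" for x
    using proj_fix[OF E] proj_in[OF E] by blast
  show "V ** proj E ** adj V ** (V ** proj E ** adj V) = V ** proj E ** adj V"
    by (rule matrix_eqI)
      (simp only: matrix_vector_mul_assoc[symmetric] unitary_vec(1)[OF V] idem)
  show "range ((*v) (V ** proj E ** adj V)) = (*v) V ` E"
  proof
    show "range ((*v) (V ** proj E ** adj V)) \<subseteq> (*v) V ` E"
      using proj_in[OF E] by (auto simp only: conj_vec)
    have "V *v y = (V ** proj E ** adj V) *v (V *v y)" if "y \<in> E" for y
      using that by (simp only: conj_vec unitary_vec(1)[OF V] proj_fix[OF E])
    then show "(*v) V ` E \<subseteq> range ((*v) (V ** proj E ** adj V))" by (metis image_subsetI rangeI)
  qed
qed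

lemma orth_conj: "unitary V \<Longrightarrow> orth ((*v) V ` E) = (*v) V ` orth E"
proof -
  assume V: "unitary V"
  have "x \<in> (*v) V ` orth E" if "x \<in> orth ((*v) V ` E)" for x
  proof
    show "x = V *v (adj V *v x)" by (simp only: unitary_vec(2)[OF V])
    show "adj V *v x \<in> orth E"
      using that by (auto simp: orth_def cinner_mult_vec)
  qed
  then show ?thesis by (auto simp: orth_def unitary_cinner[OF V])
qed

section \<open>Eigenspaces and real spectrum of a general matrix\<close>

lemma subspace_eigsp: "vec.subspace (eigsp A l)"
  by (simp add: vec.subspace_def eigsp_def matrix_vector_right_distrib scaleR_right_distrib
      vec.scale del: of_real_smult)

lemma in_spec_iff: "l \<in> spec A \<longleftrightarrow> (\<exists>x\<in>eigsp A l. x \<noteq> 0)"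
  by (auto simp: spec_def eigsp_def)

text \<open>\<open>A - k\<close> annihilates the component at \<open>k\<close> and multiplies every
  other one by the nonzero number \<open>l - k\<close>, which leaves a shorter relation for the
  induction.\<close>

lemma eigsp_sum_eq_0:
  assumes "finite S" "\<And>l. l \<in> S \<Longrightarrow> x l \<in> eigsp A l" "(\<Sum>l\<in>S. x l) = 0" "l \<in> S"
  shows "x l = 0"
  using assms
proof (induction S arbitrary: x l rule: finite_induct)
  case (insert k S)
  have ev: "A *v x l = l *\<^sub>R x l" if "l \<in> insert k S" for l
    using insert.prems(1)[OF that] by (simp add: eigsp_def)
  have s0: "x k + (\<Sum>l\<in>S. x l) = 0" using insert by simp
  have "0 = A *v (x k + (\<Sum>l\<in>S. x l)) - k *\<^sub>R (x k + (\<Sum>l\<in>S. x l))" by (simp add: s0)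
  also have "\<dots> = (\<Sum>l\<in>S. (l - k) *\<^sub>R x l)"
    using ev by (simp add: matrix_vector_right_distrib vec.sum scaleR_add_right scaleR_sum_right
        scaleR_diff_left sum_subtractf)
  finally have z: "(\<Sum>l\<in>S. (l - k) *\<^sub>R x l) = 0" by simp
  have xS: "x l = 0" if "l \<in> S" for l
  proof -
    have "(l - k) *\<^sub>R x l = 0"
    proof (rule insert.IH[OF _ z that])
      show "(l - k) *\<^sub>R x l \<in> eigsp A l" if "l \<in> S" for l
        using insert.prems(1)[of l] that vec.subspace_scale[OF subspace_eigsp[of A l], of "x l" "complex_of_real (l - k)"]
        by (simp del: of_real_diff)
    qed
    then show ?thesis using that insert.hyps by auto
  qed
  then show ?case using s0 insert.prems(3) by auto
qed simp

text \<open>One eigenvector per eigenvalue yields an independent set, so its size is bounded by the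
  dimension. General matrices are covered because \<open>hsup\<close> has to be measurable on the
  whole matrix space.\<close>

lemma finite_spec: "finite (spec (A :: 'n::finite cmat))"
proof -
  define x where "x l = (SOME v. v \<in> eigsp A l \<and> v \<noteq> 0)" for l
  have x: "x l \<in> eigsp A l" "x l \<noteq> 0" if "l \<in> spec A" for l
    using someI_ex[of "\<lambda>v. v \<in> eigsp A l \<and> v \<noteq> 0"] that unfolding x_def in_spec_iff by auto
  have "card S \<le> CARD('n)" if S: "S \<subseteq> spec A" "finite S" for S
  proof -
    have inj: "inj_on x S"
    proof (rule inj_onI, rule ccontr)
      fix l m assume lm: "l \<in> S" "m \<in> S" "x l = x m" "l \<noteq> m"
      then have "A *v x l = l *\<^sub>R x l" "A *v x l = m *\<^sub>R x l" "x l \<noteq> 0"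
        using x(1)[of l] x(1)[of m] x(2)[of l] S(1) by (auto simp: eigsp_def)
      then show False using lm(4) by simp
    qed
    have "vec.independent (x ` S)"
    proof (rule vec.independent_if_scalars_zero)
      show "finite (x ` S)" using S(2) by simp
      fix f v assume eq: "(\<Sum>y\<in>x ` S. f y *s y) = 0" and v: "v \<in> x ` S"
      have "(\<Sum>l\<in>S. f (x l) *s x l) = 0" using eq by (simp add: sum.reindex[OF inj])
      moreover have "f (x l) *s x l \<in> eigsp A l" if "l \<in> S" for l
        using x(1)[of l] that S(1) by (auto intro: vec.subspace_scale[OF subspace_eigsp])
      ultimately have "f (x l) *s x l = 0" if "l \<in> S" for l
        using eigsp_sum_eq_0[OF S(2), of "\<lambda>l. f (x l) *s x l"] that by blast
      then show "f v = 0" using v x(2) S(1) by auto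
    qed
    then have "card (x ` S) \<le> CARD('n)"
      using vec.independent_card_le_dim[OF subset_UNIV] by (metis vec_dim_card)
    then show ?thesis using card_image[OF inj] by simp
  qed
  then show ?thesis by (metis finite_if_finite_subsets_card_bdd)
qed

section \<open>Eigenvalue counts and the spectral supremum\<close>

abbreviation up :: "'n::finite cmat \<Rightarrow> real \<Rightarrow> (complex^'n) set" where
  "up A t \<equiv> sup_upto A A (\<lambda>m. m > t)"

text \<open>For Hermitian \<open>A\<close>, the number of eigenvalues above \<open>t\<close> with
  multiplicity. As a function of \<open>t\<close> it encodes the ranked eigenvalues, and in general
  position it is additive under suprema up to truncation, unlike the eigenvalues themselves.\<close>

definition cnt :: "'n::finite cmat \<Rightarrow> real \<Rightarrow> nat" where
  "cnt A t = vec.dim (up A t)"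

lemma subspace_sup_upto: "vec.subspace (sup_upto A B P)"
  by (simp add: sup_upto_def)

text \<open>A level that is not an eigenvalue contributes only the zero vector, so the level may run
  over all reals. This removes the spectra from the formula and makes monotonicity and conjugation
  immediate.\<close>

lemma sup_upto_alt: "sup_upto A B P = vec.span {x. \<exists>m. P m \<and> (x \<in> eigsp A m \<or> x \<in> eigsp B m)}"
  (is "_ = vec.span ?T")
proof -
  let ?S = "\<Union>m\<in>{m\<in>spec A \<union> spec B. P m}. eigsp A m \<union> eigsp B m"
  have "x \<in> vec.span ?S" if "x \<in> ?T" for x
  proof (cases "x = 0")
    case False
    then show ?thesis using that by (intro vec.span_base) (auto simp: in_spec_iff)
  qed (simp add: vec.span_zero)
  then have "vec.span ?T \<subseteq> vec.span ?S" by (intro vec.span_minimal) auto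
  moreover have "vec.span ?S \<subseteq> vec.span ?T" by (intro vec.span_mono) auto
  ultimately show ?thesis unfolding sup_upto_def by blast
qed

lemma sup_upto_mono: "(\<And>m. P m \<Longrightarrow> Q m) \<Longrightarrow> sup_upto A B P \<subseteq> sup_upto A B Q"
  unfolding sup_upto_alt by (intro vec.span_mono) auto

lemma eigsp_sup_upto: "P m \<Longrightarrow> eigsp A m \<subseteq> sup_upto A B P" "P m \<Longrightarrow> eigsp B m \<subseteq> sup_upto A B P"
  unfolding sup_upto_alt by (auto intro!: vec.span_base)

lemma sup_upto_span: "sup_upto A B P = vec.span (sup_upto A A P \<union> sup_upto B B P)"
proof
  show "sup_upto A B P \<subseteq> vec.span (sup_upto A A P \<union> sup_upto B B P)"
    unfolding sup_upto_alt[of A B]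
    using eigsp_sup_upto(1)[of P _ A A] eigsp_sup_upto(1)[of P _ B B]
    by (intro vec.span_minimal subsetI vec.subspace_span vec.span_base) auto
  have "sup_upto A A P \<subseteq> sup_upto A B P" "sup_upto B B P \<subseteq> sup_upto A B P"
    unfolding sup_upto_alt by (auto intro!: vec.span_mono)
  then show "vec.span (sup_upto A A P \<union> sup_upto B B P) \<subseteq> sup_upto A B P"
    by (intro vec.span_minimal subspace_sup_upto) auto
qed

lemma eigsp_conj:
  assumes V: "unitary V"
  shows "eigsp (V ** A ** adj V) m = (*v) V ` eigsp A m"
proof
  show "(*v) V ` eigsp A m \<subseteq> eigsp (V ** A ** adj V) m"
    by (auto simp: eigsp_def conj_vec unitary_vec[OF V] mult_vec_scaleR simp del: matrix_vector_mul_assoc)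
  show "eigsp (V ** A ** adj V) m \<subseteq> (*v) V ` eigsp A m"
  proof
    fix x assume "x \<in> eigsp (V ** A ** adj V) m"
    then have "V *v (A *v (adj V *v x)) = m *\<^sub>R x" by (simp add: eigsp_def conj_vec del: matrix_vector_mul_assoc)
    then have "A *v (adj V *v x) = m *\<^sub>R (adj V *v x)"
      by (metis unitary_vec(1)[OF V] mult_vec_scaleR)
    then have "adj V *v x \<in> eigsp A m" by (simp add: eigsp_def)
    moreover have "x = V *v (adj V *v x)" by (simp only: unitary_vec(2)[OF V])
    ultimately show "x \<in> (*v) V ` eigsp A m" by blast
  qed
qed

lemma sup_upto_conj:
  assumes V: "unitary V"
  shows "sup_upto (V ** A ** adj V) (V ** B ** adj V) P = (*v) V ` sup_upto A B P"
proof -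
  have "{x. \<exists>m. P m \<and> (x \<in> (*v) V ` eigsp A m \<or> x \<in> (*v) V ` eigsp B m)}
      = (*v) V ` {x. \<exists>m. P m \<and> (x \<in> eigsp A m \<or> x \<in> eigsp B m)}" by auto
  then show ?thesis unfolding sup_upto_alt eigsp_conj[OF V] by (simp only: vec.span_image)
qed

lemma spec_conj:
  assumes V: "unitary V"
  shows "spec (V ** A ** adj V) = spec A"
proof -
  have "V *v x \<noteq> 0 \<longleftrightarrow> x \<noteq> 0" for x
    by (metis unitary_vec(1)[OF V] matrix_vector_mult_0_right)
  then show ?thesis by (auto simp: set_eq_iff in_spec_iff eigsp_conj[OF V])
qed

lemma cnt_conj: "unitary V \<Longrightarrow> cnt (V ** A ** adj V) t = cnt A t"
  unfolding cnt_def sup_upto_conj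
  by (intro vec.dim_image_eq) (auto intro: inj_on_subset[OF unitary_inj])

lemma up_diag: "up (diag_mat x) t = {y. \<forall>i. i \<notin> {i. t < x i} \<longrightarrow> y $ i = 0}" (is "_ = ?R")
proof
  have "y \<in> ?R" if "t < m" "y \<in> eigsp (diag_mat x) m" for y m
  proof -
    have "(diag_mat x *v y) $ i = (complex_of_real m *s y) $ i" for i
      using that(2) by (simp add: eigsp_def)
    then have "complex_of_real (x i) * y $ i = complex_of_real m * y $ i" for i
      unfolding diag_mat_vec vector_smult_component by blast
    then have "y $ i = 0 \<or> x i = m" for i by (metis mult_right_cancel of_real_eq_iff)
    then show ?thesis using that(1) by auto
  qed
  then show "up (diag_mat x) t \<subseteq> ?R"
    unfolding sup_upto_alt by (intro vec.span_minimal) (auto simp: vec.subspace_def)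
  show "?R \<subseteq> up (diag_mat x) t"
  proof
    fix y assume y: "y \<in> ?R"
    have "y $ i *s axis i 1 \<in> up (diag_mat x) t" for i
    proof (cases "t < x i")
      case True
      have "axis i 1 \<in> eigsp (diag_mat x) (x i)"
        by (auto simp: eigsp_def vec_eq_iff diag_mat_vec axis_def) (auto simp: scaleR_conv_of_real)
      then show ?thesis
        using True eigsp_sup_upto(1)[of "\<lambda>m. m > t" "x i"] by (intro vec.subspace_scale subspace_sup_upto) auto
    next
      case False
      then show ?thesis using y by (simp add: vec.subspace_0 subspace_sup_upto)
    qed
    then have "(\<Sum>i\<in>UNIV. y $ i *s axis i 1) \<in> up (diag_mat x) t"
      by (intro vec.subspace_sum subspace_sup_upto) auto
    then show "y \<in> up (diag_mat x) t" by (simp add: basis_expansion)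
  qed
qed

lemma cnt_conj_diag: "unitary V \<Longrightarrow> cnt (V ** diag_mat x ** adj V) t = card {i. t < x i}"
  by (simp only: cnt_conj) (simp only: cnt_def up_diag dim_substandard_cart)

lemma spectral:
  assumes "hermitian (A :: 'n::finite cmat)"
  obtains V x where "unitary V" "A = V ** diag_mat x ** adj V"
proof -
  obtain S :: "(complex^'n) set" where S: "finite S" "orthonormal S" "vec.span S = UNIV"
    and ev: "\<And>b. b \<in> S \<Longrightarrow> \<exists>l::real. A *v b = complex_of_real l *s b"
    using orthonormal_eigenbasis[OF assms vec.subspace_UNIV] by blast
  have "card S = CARD('n)"
    using S orthonormal_independent[OF S(2,1)] vec.dim_eq_card_independent vec.dim_span vec_dim_card by metis
  then obtain h :: "'n \<Rightarrow> complex^'n" where h: "bij_betw h UNIV S"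
    using finite_same_card_bij[of "UNIV :: 'n set" S] S(1) by auto
  then have hS: "h j \<in> S" for j by (auto simp: bij_betw_def)
  obtain l :: "complex^'n \<Rightarrow> real" where l: "\<And>b. b \<in> S \<Longrightarrow> A *v b = complex_of_real (l b) *s b"
    using ev by metis
  define V :: "'n cmat" where "V = (\<chi> i j. h j $ i)"
  have "adj V ** V = mat 1"
  proof -
    have "(adj V ** V) $ i $ j = cinner (h j) (h i)" for i j
      by (simp add: matrix_matrix_mult_def adj_def V_def cinner_def mult_ac)
    moreover have "cinner (h j) (h i) = (if i = j then 1 else 0)" for i j
      using S(2) hS h by (auto simp: orthonormal_def bij_betw_def inj_eq)
    ultimately show ?thesis by (simp add: mat_def vec_eq_iff)
  qed
  then have V: "unitary V" by (simp add: unitary_def)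
  have "A ** V = V ** diag_mat (\<lambda>j. l (h j))"
  proof -
    have "(A ** V) $ i $ j = (A *v h j) $ i" for i j
      by (simp add: matrix_matrix_mult_def matrix_vector_mult_def V_def)
    moreover have "(V ** diag_mat (\<lambda>j. l (h j))) $ i $ j = complex_of_real (l (h j)) * h j $ i" for i j
      by (simp add: matrix_matrix_mult_def diag_mat_def V_def mult_delta_right mult_ac)
    ultimately show ?thesis using l[OF hS] by (simp add: vec_eq_iff) (simp add: scaleR_conv_of_real)
  qed
  then have "A ** (V ** adj V) = V ** diag_mat (\<lambda>j. l (h j)) ** adj V"
    by (simp add: matrix_mul_assoc)
  then show thesis using V that by (simp add: unitary_right)
qed

text \<open>The span of eigenspaces above \<open>u\<close> does not change when \<open>u\<close> is
  raised to just below the least eigenvalue exceeding it, so counts at arbitrary levels reduce to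
  counts at eigenvalues. The level \<open>s\<close> witnesses that the set under \<open>Max\<close>
  is nonempty, which can fail for a matrix that is not Hermitian.\<close>

lemma eig_desc_gt_iff:
  fixes A :: "'n::finite cmat"
  assumes i: "i \<in> {1..CARD('n)}" and ex: "i \<le> cnt A s"
  shows "t < eig_desc A i \<longleftrightarrow> i \<le> cnt A t"
proof -
  let ?L = "{l\<in>spec A. i \<le> vec.dim (sup_upto A A (\<lambda>m. m \<ge> l))}"
  have eq: "eig_desc A i = Max ?L"
    using i by (simp add: eig_desc_def sup_upto_def)
  have claim: "(\<exists>l\<in>?L. u < l) \<longleftrightarrow> i \<le> cnt A u" for u
  proof
    assume "\<exists>l\<in>?L. u < l"
    then obtain l where l: "u < l" "i \<le> vec.dim (sup_upto A A (\<lambda>m. m \<ge> l))" by auto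
    have "sup_upto A A (\<lambda>m. m \<ge> l) \<subseteq> up A u" using l(1) by (intro sup_upto_mono) auto
    then show "i \<le> cnt A u" unfolding cnt_def using l(2) vec.dim_subset order_trans by blast
  next
    assume le: "i \<le> cnt A u"
    let ?M = "{m\<in>spec A. u < m}"
    have "?M \<noteq> {}"
    proof
      assume "?M = {}"
      then have "{m \<in> spec A \<union> spec A. m > u} = {}" by auto
      then have "up A u = vec.span {}" unfolding sup_upto_def by (simp only: UN_empty)
      then have "cnt A u = 0" unfolding cnt_def by (simp only: vec.dim_span vec.dim_empty)
      then show False using le i by simp
    qed
    moreover have fin: "finite ?M" using finite_spec[of A] by simp
    ultimately have m: "Min ?M \<in> ?M" by (rule Min_in[rotated])
    have "{m \<in> spec A \<union> spec A. u < m} = {m \<in> spec A \<union> spec A. Min ?M \<le> m}"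
      using m fin by auto
    then have "up A u = sup_upto A A (\<lambda>m. m \<ge> Min ?M)" unfolding sup_upto_def by simp
    then show "\<exists>l\<in>?L. u < l" using m le unfolding cnt_def by auto
  qed
  have "finite ?L" using finite_spec[of A] by simp
  moreover have "?L \<noteq> {}" using claim[of s] ex by auto
  ultimately show ?thesis unfolding eq claim[symmetric] by (rule Max_gr_iff)
qed

text \<open>Matrices are indexed by the type \<open>'n\<close>, ranked eigenvalues by
  \<open>1..N\<close>; this fixes one numbering that translates between the two.\<close>

definition idx :: "'n::finite \<Rightarrow> nat" where
  "idx = (SOME f. bij_betw f UNIV {1..CARD('n)})"

lemma bij_idx: "bij_betw (idx :: 'n::finite \<Rightarrow> nat) UNIV {1..CARD('n)}"
proof -
  have "\<exists>f :: 'n \<Rightarrow> nat. bij_betw f UNIV {1..CARD('n)}" by (rule finite_same_card_bij) auto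
  then show ?thesis unfolding idx_def by (rule someI_ex)
qed

lemma idx_in: "idx (i :: 'n::finite) \<in> {1..CARD('n)}"
  using bij_idx by (auto simp: bij_betw_def)

lemma card_idx: "card {i :: 'n::finite. P (idx i)} = card {i \<in> {1..CARD('n)}. P i}"
proof -
  have "idx ` {i :: 'n. P (idx i)} = {i \<in> {1..CARD('n)}. P i}"
  proof -
    have "idx ` {i :: 'n. P (idx i)} = {k \<in> range (idx :: 'n \<Rightarrow> nat). P k}" by auto
    then show ?thesis using bij_idx[where 'n='n] by (simp add: bij_betw_def)
  qed
  moreover have "inj_on idx {i :: 'n. P (idx i)}"
    using bij_idx[where 'n='n] inj_on_subset by (auto simp: bij_betw_def)
  ultimately show ?thesis by (metis card_image)
qed

lemma card_sorted_gt_iff: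
  fixes x :: "nat \<Rightarrow> real"
  assumes "\<And>i j. i \<in> {1..N} \<Longrightarrow> j \<in> {1..N} \<Longrightarrow> i \<le> j \<Longrightarrow> x j \<le> x i" and j: "j \<in> {1..N}"
  shows "j \<le> card {i\<in>{1..N}. t < x i} \<longleftrightarrow> t < x j"
proof
  assume t: "t < x j"
  have "{1..j} \<subseteq> {i\<in>{1..N}. t < x i}"
    using assms(1)[of _ j] j t by (auto intro: less_le_trans)
  then have "card {1..j} \<le> card {i\<in>{1..N}. t < x i}" by (intro card_mono) auto
  then show "j \<le> card {i\<in>{1..N}. t < x i}" by simp
next
  assume le: "j \<le> card {i\<in>{1..N}. t < x i}"
  show "t < x j"
  proof (rule ccontr)
    assume t: "\<not> t < x j"
    have "{i\<in>{1..N}. t < x i} \<subseteq> {1..<j}"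
      using assms(1)[of j] j t by (force simp: not_less)
    then have "card {i\<in>{1..N}. t < x i} \<le> card {1..<j}" by (intro card_mono) auto
    then show False using le j by auto
  qed
qed

lemma eig_desc_conj_sorted:
  fixes V :: "'n::finite cmat"
  assumes V: "unitary V" and sorted: "\<And>i j. i \<in> {1..CARD('n)} \<Longrightarrow> j \<in> {1..CARD('n)} \<Longrightarrow> i \<le> j \<Longrightarrow> x j \<le> x i"
    and j: "j \<in> {1..CARD('n)}"
  shows "eig_desc (V ** diag_mat (\<lambda>i. x (idx i)) ** adj V) j = x j"
proof -
  let ?A = "V ** diag_mat (\<lambda>i. x (idx i)) ** adj V"
  have c: "j \<le> cnt ?A t \<longleftrightarrow> t < x j" for t
    unfolding cnt_conj_diag[OF V] card_idx[of "\<lambda>i. t < x i"]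
    by (rule card_sorted_gt_iff[OF sorted j])
  have "j \<le> cnt ?A (x j - 1)" by (simp add: c)
  from eig_desc_gt_iff[OF j this] c have "t < eig_desc ?A j \<longleftrightarrow> t < x j" for t by simp
  then show ?thesis by (meson linorder_neqE not_less_iff_gr_or_eq)
qed

lemma ex_sorting:
  fixes x :: "'n::finite \<Rightarrow> real"
  obtains s where "bij_betw s {1..CARD('n)} (UNIV :: 'n set)"
    "\<And>i j. i \<in> {1..CARD('n)} \<Longrightarrow> j \<in> {1..CARD('n)} \<Longrightarrow> i \<le> j \<Longrightarrow> x (s j) \<le> x (s i)"
proof -
  obtain xs0 :: "'n list" where xs0: "set xs0 = UNIV" "distinct xs0"
    using finite_distinct_list[of "UNIV :: 'n set"] by auto
  define xs where "xs = sort_key (\<lambda>i. - x i) xs0"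
  have xs: "set xs = UNIV" "distinct xs" "sorted (map (\<lambda>i. - x i) xs)"
    using xs0 by (simp_all add: xs_def)
  have len: "length xs = CARD('n)" using distinct_card[OF xs(2)] xs(1) by simp
  have "bij_betw (\<lambda>i. i - 1) {1..CARD('n)} {..<CARD('n)}"
    by (rule bij_betwI[where g = Suc]) auto
  from bij_betw_trans[OF this bij_betw_nth[OF xs(2), of "{..<CARD('n)}" UNIV]]
  have "bij_betw (\<lambda>i. xs ! (i - 1)) {1..CARD('n)} UNIV" using xs(1) len by (simp add: comp_def)
  moreover have "x (xs ! (j - 1)) \<le> x (xs ! (i - 1))"
    if "i \<in> {1..CARD('n)}" "j \<in> {1..CARD('n)}" "i \<le> j" for i j
    using sorted_nth_mono[OF xs(3), of "i - 1" "j - 1"] that len by simp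
  ultimately show thesis by (rule that)
qed

text \<open>Permuting the columns of a diagonalising unitary matrix permutes the diagonal, which can
  thus be sorted; \<open>eig_desc_conj_sorted\<close> then recognises the sorted diagonal as the
  ranked eigenvalues.\<close>

lemma spectral_sorted:
  assumes "hermitian (C :: 'n::finite cmat)"
  obtains V where "unitary V" "C = V ** diag_mat (\<lambda>j. eig_desc C (idx j)) ** adj V"
proof -
  obtain V x where V: "unitary V" and C: "C = V ** diag_mat x ** adj V"
    using spectral[OF assms] by blast
  obtain s where s: "bij_betw s {1..CARD('n)} (UNIV :: 'n set)"
    and sorted: "\<And>i j. i \<in> {1..CARD('n)} \<Longrightarrow> j \<in> {1..CARD('n)} \<Longrightarrow> i \<le> j \<Longrightarrow> x (s j) \<le> x (s i)"
    using ex_sorting[of x] by blast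
  define p :: "'n \<Rightarrow> 'n" where "p = s \<circ> idx"
  have p: "bij p" unfolding p_def using bij_betw_trans[OF bij_idx s] .
  define W :: "'n cmat" where "W = (\<chi> i j. V $ i $ p j)"
  have ent: "(V ** diag_mat x ** adj V) $ i $ j = (\<Sum>k\<in>UNIV. V $ i $ k * complex_of_real (x k) * cnj (V $ j $ k))"
    for V :: "'n cmat" and x i j
    by (simp add: matrix_matrix_mult_def diag_mat_def adj_def mult_delta_right)
  have CW: "C = W ** diag_mat (\<lambda>j. x (s (idx j))) ** adj W"
  proof -
    have "(\<Sum>k\<in>UNIV. V $ i $ k * complex_of_real (x k) * cnj (V $ j $ k)) =
        (\<Sum>k\<in>UNIV. V $ i $ p k * complex_of_real (x (p k)) * cnj (V $ j $ p k))" for i j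
      by (rule sum.reindex_bij_betw[OF p, symmetric])
    then show ?thesis unfolding C by (simp add: vec_eq_iff ent W_def) (simp add: p_def)
  qed
  have W: "unitary W"
  proof -
    have "(adj W ** W) $ i $ j = (adj V ** V) $ p i $ p j" for i j
      by (simp add: matrix_matrix_mult_def adj_def W_def)
    then show ?thesis using V p by (simp add: unitary_def vec_eq_iff mat_def bij_def inj_eq)
  qed
  have "eig_desc C (idx j) = x (s (idx j))" for j :: 'n
    unfolding CW
  proof (rule eig_desc_conj_sorted[OF W, of "\<lambda>i. x (s i)"])
    show "idx j \<in> {1..CARD('n)}" by (rule idx_in)
  qed (rule sorted)
  then show thesis using that[OF W] CW by simp
qed

lemma vec_sum_scaleR_conj:
  fixes V W :: "'n::finite cmat"
  shows "V ** (\<Sum>l\<in>L. c l *\<^sub>R P l) ** W = (\<Sum>l\<in>L. c l *\<^sub>R (V ** P l ** W))"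
  by (rule matrix_eqI)
    (simp only: matrix_vector_mul_assoc[symmetric] sum_mult_vec scaleR_mult_vec vec.sum mult_vec_scaleR)

lemma hsup_conj:
  assumes V: "unitary V"
  shows "hsup (V ** A ** adj V) (V ** B ** adj V) = V ** hsup A B ** adj V"
proof -
  have "proj (sup_upto (V ** A ** adj V) (V ** B ** adj V) (\<lambda>m. m \<ge> l)
        \<inter> orth (sup_upto (V ** A ** adj V) (V ** B ** adj V) (\<lambda>m. m > l)))
      = V ** proj (sup_upto A B (\<lambda>m. m \<ge> l) \<inter> orth (sup_upto A B (\<lambda>m. m > l))) ** adj V" for l
    unfolding sup_upto_conj[OF V] orth_conj[OF V] image_Int[OF unitary_inj[OF V], symmetric]
    by (intro proj_conj V vec.subspace_inter subspace_sup_upto subspace_orth)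
  then show ?thesis
    unfolding hsup_def spec_conj[OF V] vec_sum_scaleR_conj by simp
qed

lemma hermitian_hsup: "hermitian (hsup A B)"
  unfolding hermitian_def hsup_def adj_sum adj_scaleR
  by (intro sum.cong refl arg_cong[where f = "\<lambda>x. _ *\<^sub>R x"])
    (metis hermitian_def hermitian_proj vec.subspace_inter subspace_sup_upto subspace_orth)

section \<open>Spectral resolution of the supremum\<close>

context
  fixes A B :: "'n::finite cmat"
begin

private definition "L = spec A \<union> spec B"
private definition "G l = sup_upto A B (\<lambda>m. m \<ge> l)"
private definition "K l = sup_upto A B (\<lambda>m. m > l)"
text \<open>The candidate for the spectral projection of \<open>hsup A B\<close> at
  \<open>l\<close>. The lemmas below show that these projections are mutually orthogonal and that
  \<open>hsup A B\<close> acts as \<open>l\<close> on the range of \<open>Q l\<close>.\<close>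

private definition "Q l = proj (G l \<inter> orth (K l))"

private lemma fin_L: "finite L"
  by (simp add: L_def finite_spec)

private lemma sub_G: "vec.subspace (G l)" and sub_K: "vec.subspace (K l)"
  and sub_Q: "vec.subspace (G l \<inter> orth (K l))"
  by (auto simp: G_def K_def intro!: subspace_sup_upto vec.subspace_inter subspace_orth)

private lemma Q_diff: "Q l = proj (G l) - proj (K l)"
  unfolding Q_def by (rule proj_diff[OF sub_G sub_K]) (auto simp: G_def K_def intro!: sup_upto_mono)

private lemma G_eq_K: "\<forall>m\<in>L. t < m \<longleftrightarrow> l \<le> m \<Longrightarrow> G l = K t"
  unfolding G_def K_def sup_upto_def L_def by (intro arg_cong[where f = vec.span]) auto

text \<open>If \<open>m\<close> is the lowest spectral point above \<open>t\<close>, then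
  \<open>G m = K t\<close>, so \<open>Q m\<close> is what has to be added to the projection onto
  \<open>K m\<close> to reach the one onto \<open>K t\<close>. The sum telescopes from the top of
  the spectrum downwards.\<close>

private lemma sum_Q: "(\<Sum>l\<in>{l\<in>L. t < l}. Q l) = proj (K t)"
proof (induction "card {l\<in>L. t < l}" arbitrary: t rule: less_induct)
  case less
  show ?case
  proof (cases "{l\<in>L. t < l} = {}")
    case True
    then have "K t = vec.span {}"
      unfolding K_def sup_upto_def L_def by (intro arg_cong[where f = vec.span]) auto
    then have "proj (K t) = 0"
      by (intro proj_eqI) (auto simp: hermitian_def adj_def vec_eq_iff)
    then show ?thesis unfolding True by simp
  next
    case False
    define m where "m = Min {l\<in>L. t < l}"
    have fin: "finite {l\<in>L. t < l}" using fin_L by simp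
    have m: "m \<in> L" "t < m" using Min_in[OF fin False] by (auto simp: m_def)
    have m_le: "m \<le> l" if "l \<in> L" "t < l" for l using that fin by (auto simp: m_def)
    have eq: "{l\<in>L. t < l} = insert m {l\<in>L. m < l}" using m m_le by force
    have "(\<Sum>l\<in>{l\<in>L. m < l}. Q l) = proj (K m)"
    proof (rule less)
      show "card {l\<in>L. m < l} < card {l\<in>L. t < l}" unfolding eq using fin_L by simp
    qed
    moreover have "G m = K t" using m m_le by (intro G_eq_K) force
    ultimately show ?thesis unfolding eq using fin_L by (simp add: Q_diff)
  qed
qed

lemma hsup_eq_sum: "hsup A B = (\<Sum>l\<in>spec A \<union> spec B.
    l *\<^sub>R (proj (sup_upto A B (\<lambda>m. m \<ge> l)) - proj (sup_upto A B (\<lambda>m. m > l))))"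
  unfolding hsup_def Q_def[symmetric] G_def[symmetric] K_def[symmetric] Q_diff ..

lemma proj_sup_upto_eq_sum: "proj (sup_upto A B (\<lambda>m. m > t)) = (\<Sum>l\<in>{l\<in>spec A \<union> spec B. t < l}.
    proj (sup_upto A B (\<lambda>m. m \<ge> l)) - proj (sup_upto A B (\<lambda>m. m > l)))"
  using sum_Q[of t] unfolding Q_diff unfolding G_def K_def L_def by simp

private lemma Q_fix: "Q l *v (Q l *v x) = Q l *v x"
  unfolding Q_def by (intro proj_fix[OF sub_Q] proj_in[OF sub_Q])

private lemma Q_cinner: "cinner (Q l *v x) y = cinner x (Q l *v y)"
  unfolding Q_def by (intro hermitian_cinner hermitian_proj sub_Q)

private lemma Q_orth_less:
  assumes "l < l'" shows "Q l *v (Q l' *v x) = 0"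
proof -
  have "Q l' *v x \<in> G l'" unfolding Q_def using proj_in[OF sub_Q] by blast
  also have "G l' \<subseteq> K l" unfolding G_def K_def using assms by (intro sup_upto_mono) auto
  finally have in_K: "Q l' *v x \<in> K l" .
  show ?thesis
  proof (rule cinner_right_eqI)
    fix y
    have "Q l *v y \<in> orth (K l)" unfolding Q_def using proj_in[OF sub_Q] by blast
    then have "cinner (Q l *v y) (Q l' *v x) = 0" using in_K by (simp add: orth_def)
    then have "cinner (Q l' *v x) (Q l *v y) = 0" by (metis cinner_commute complex_cnj_zero)
    then show "cinner (Q l *v (Q l' *v x)) y = cinner 0 y"
      using Q_cinner[of l "Q l' *v x" y] by simp
  qed
qed

private lemma Q_orth:
  assumes "l \<noteq> l'" shows "Q l *v (Q l' *v x) = 0"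
proof (cases "l < l'")
  case False
  then have "l' < l" using assms by simp
  show ?thesis
    by (rule cinner_right_eqI) (simp only: Q_cinner Q_orth_less[OF \<open>l' < l\<close>] cinner_zero)
qed (rule Q_orth_less)

private lemma hsup_vec: "hsup A B *v x = (\<Sum>l\<in>L. l *\<^sub>R (Q l *v x))"
  unfolding hsup_def Q_def[symmetric] G_def[symmetric] K_def[symmetric] L_def[symmetric]
  by (simp add: sum_mult_vec scaleR_mult_vec)

private lemma Q_hsup:
  assumes "l \<in> L"
  shows "Q l *v (hsup A B *v x) = l *\<^sub>R (Q l *v x)"
proof -
  have "Q l *v (hsup A B *v x) = (\<Sum>m\<in>L. if m = l then l *\<^sub>R (Q l *v x) else 0)"
    unfolding hsup_vec vec.sum mult_vec_scaleR
    by (intro sum.cong) (auto simp: Q_fix Q_orth simp del: matrix_vector_mul_assoc)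
  then show ?thesis using assms fin_L by simp
qed

private lemma hsup_Q:
  assumes "l \<in> L"
  shows "hsup A B *v (Q l *v x) = l *\<^sub>R (Q l *v x)"
proof -
  have "hsup A B *v (Q l *v x) = (\<Sum>m\<in>L. if m = l then l *\<^sub>R (Q l *v x) else 0)"
    unfolding hsup_vec
    by (intro sum.cong) (auto simp: Q_fix Q_orth simp del: matrix_vector_mul_assoc)
  then show ?thesis using assms fin_L by simp
qed

text \<open>The hypothesis that \<open>A\<close> is Hermitian makes the projections \<open>Q l\<close> sum to the identity;
  otherwise \<open>hsup\<close> acquires a spurious kernel.\<close>
lemma up_hsup:
  assumes "hermitian A"
  shows "up (hsup A B) t = sup_upto A B (\<lambda>m. m > t)"
proof -
  obtain V x where V: "unitary V" and A: "A = V ** diag_mat x ** adj V"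
    using spectral[OF assms] by blast
  \<comment> \<open>A level below all eigenvalues: there the eigenvectors of \<open>A\<close> alone
    already span the whole space, so \<open>K s\<close> is everything.\<close>
  define s where "s = Min (L \<union> range x) - 1"
  have s: "s < l" if "l \<in> L \<union> range x" for l
  proof -
    have "Min (L \<union> range x) \<le> l" using that fin_L by (intro Min_le) auto
    then show ?thesis by (simp add: s_def)
  qed
  have "up (diag_mat x) s = UNIV" unfolding up_diag using s by auto
  then have "up A s = (*v) V ` UNIV" unfolding A sup_upto_conj[OF V] by simp
  also have "\<dots> = UNIV" using unitary_vec(2)[OF V] by (metis surjI)
  finally have "K s = UNIV" using sup_upto_span[of A B] unfolding K_def
    by (metis Un_UNIV_left vec.span_UNIV)
  then have "proj (K s) *v y = y" for y by (intro proj_fix[OF sub_K]) simp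
  moreover have "{l\<in>L. s < l} = L" using s by auto
  ultimately have sum_id: "(\<Sum>l\<in>L. Q l *v y) = y" for y
    using sum_Q[of s] by (simp flip: sum_mult_vec)
  have sum_K: "(\<Sum>l\<in>{l\<in>L. t < l}. Q l *v y) = proj (K t) *v y" for y
    using sum_Q[of t] by (simp flip: sum_mult_vec)
  have "y \<in> K t" if "t < m" "y \<in> eigsp (hsup A B) m" for y m
  proof -
    \<comment> \<open>\<open>Q l\<close> applied to \<open>hsup A B *v y\<close> gives both
      \<open>l\<close> and \<open>m\<close> times \<open>Q l *v y\<close>. So only a component at
      level \<open>m\<close> can survive, and \<open>m\<close> lies above \<open>t\<close>.\<close>
    have z: "Q l *v y = 0" if "l \<in> L" "l \<noteq> m" for l
    proof -
      have "l *\<^sub>R (Q l *v y) = Q l *v (m *\<^sub>R y)"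
        using Q_hsup[OF \<open>l \<in> L\<close>, of y] \<open>y \<in> eigsp (hsup A B) m\<close> by (simp add: eigsp_def del: matrix_vector_mul_assoc)
      then show ?thesis using that(2) by (simp add: mult_vec_scaleR)
    qed
    have "(\<Sum>l\<in>L. Q l *v y) = (\<Sum>l\<in>{l\<in>L. t < l}. Q l *v y)"
      using z \<open>t < m\<close> fin_L by (intro sum.mono_neutral_right) auto
    then have "y = (\<Sum>l\<in>{l\<in>L. t < l}. Q l *v y)" by (simp only: sum_id)
    then show ?thesis unfolding sum_K using proj_in[OF sub_K] by metis
  qed
  then have "up (hsup A B) t \<subseteq> K t"
    unfolding sup_upto_alt[of "hsup A B"] by (intro vec.span_minimal sub_K) auto
  moreover have "y \<in> up (hsup A B) t" if "y \<in> K t" for y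
  proof -
    have "y = (\<Sum>l\<in>{l\<in>L. t < l}. Q l *v y)" unfolding sum_K using proj_fix[OF sub_K that] by simp
    also have "\<dots> \<in> up (hsup A B) t"
    proof (intro vec.subspace_sum subspace_sup_upto)
      fix l assume l: "l \<in> {l\<in>L. t < l}"
      then have "Q l *v y \<in> eigsp (hsup A B) l" using hsup_Q[of l y] by (simp add: eigsp_def del: matrix_vector_mul_assoc)
      then show "Q l *v y \<in> up (hsup A B) t"
        using l eigsp_sup_upto(1)[of "\<lambda>m. m > t" l] by auto
    qed
    finally show ?thesis .
  qed
  ultimately show ?thesis unfolding K_def by blast
qed

end

lemma cnt_hsup:
  assumes "hermitian A"
  shows "cnt (hsup A B) t = vec.dim (up A t \<union> up B t)"
  unfolding cnt_def up_hsup[OF assms] sup_upto_span[of A B] by simp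

section \<open>Borel measurability\<close>

text \<open>Projecting a closed set along a noncompact factor need not give a closed set, but each
  part over a compact ball does, and countably many balls exhaust the factor.\<close>

lemma borel_ex_closed:
  fixes R :: "'a::euclidean_space \<Rightarrow> 'b::euclidean_space \<Rightarrow> bool"
  assumes "closed {p. R (fst p) (snd p)}"
  shows "{x. \<exists>y. R x y} \<in> sets borel"
proof -
  have "closed {x. \<exists>y. y \<in> cball 0 (real n) \<and> R x y}" for n
  proof -
    have "closed {p. R (snd p) (fst p)}"
      using closed_vimage[OF assms, of "\<lambda>p. (snd p, fst p)"]
      by (simp add: vimage_def continuous_on_Pair continuous_on_fst continuous_on_snd continuous_on_id)
    from closed_compact_projection[OF compact_cball this, of 0 "real n"] show ?thesis by simp
  qed
  then have C: "{x. \<exists>y. y \<in> cball 0 (real n) \<and> R x y} \<in> sets borel" for n by (rule borel_closed)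
  have eq: "{x. \<exists>y. R x y} = (\<Union>n. {x. \<exists>y. y \<in> cball 0 (real n) \<and> R x y})"
  proof (intro set_eqI iffI)
    fix x assume "x \<in> {x. \<exists>y. R x y}"
    then obtain y where "R x y" by blast
    moreover obtain n where "norm y \<le> real n" using real_arch_simple by blast
    ultimately show "x \<in> (\<Union>n. {x. \<exists>y. y \<in> cball 0 (real n) \<and> R x y})" by auto
  qed blast
  show ?thesis unfolding eq using C by (intro sets.countable_UN) blast
qed

lemma continuous_mult_vec [continuous_intros]:
  fixes f :: "_ \<Rightarrow> 'n::finite cmat"
  assumes "continuous_on S f" "continuous_on S g"
  shows "continuous_on S (\<lambda>x. f x *v g x)"
  unfolding matrix_vector_mult_def
  by (intro continuous_on_vec_lambda continuous_intros assms)

lemma continuous_mult_matrix [continuous_intros]: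
  fixes f :: "_ \<Rightarrow> 'n::finite cmat"
  assumes "continuous_on S f" "continuous_on S g"
  shows "continuous_on S (\<lambda>x. f x ** g x)"
  unfolding matrix_matrix_mult_def
  by (intro continuous_on_vec_lambda continuous_intros assms)

lemma continuous_adj [continuous_intros]:
  fixes f :: "_ \<Rightarrow> 'n::finite cmat"
  assumes "continuous_on S f"
  shows "continuous_on S (\<lambda>x. adj (f x))"
  unfolding adj_def
  by (intro continuous_on_vec_lambda continuous_intros assms)

lemma measurable_mult_vec [measurable]:
  fixes f :: "_ \<Rightarrow> 'n::finite cmat"
  assumes [measurable]: "f \<in> borel_measurable M" "g \<in> borel_measurable M"
  shows "(\<lambda>x. f x *v g x) \<in> borel_measurable M"
proof -
  have "(\<lambda>p :: 'n cmat \<times> (complex^'n). fst p *v snd p) \<in> borel_measurable borel"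
    by (intro borel_measurable_continuous_onI continuous_intros)
  from measurable_compose[OF borel_measurable_Pair[OF assms] this] show ?thesis by simp
qed

lemma measurable_mult_matrix [measurable]:
  fixes f g :: "_ \<Rightarrow> 'n::finite cmat"
  assumes "f \<in> borel_measurable M" "g \<in> borel_measurable M"
  shows "(\<lambda>x. f x ** g x) \<in> borel_measurable M"
proof -
  have "(\<lambda>p :: 'n cmat \<times> 'n cmat. fst p ** snd p) \<in> borel_measurable borel"
    by (intro borel_measurable_continuous_onI continuous_intros)
  from measurable_compose[OF borel_measurable_Pair[OF assms] this] show ?thesis by simp
qed

lemma measurable_adj [measurable]:
  fixes f :: "_ \<Rightarrow> 'n::finite cmat"
  assumes "f \<in> borel_measurable M"
  shows "(\<lambda>x. adj (f x)) \<in> borel_measurable M"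
proof -
  have "(\<lambda>p :: 'n cmat. adj p) \<in> borel_measurable borel"
    by (intro borel_measurable_continuous_onI continuous_intros)
  from measurable_compose[OF assms this] show ?thesis by simp
qed

lemma measurable_vec_nth [measurable]:
  fixes f :: "_ \<Rightarrow> 'a::euclidean_space^'n::finite"
  assumes "f \<in> borel_measurable M"
  shows "(\<lambda>x. f x $ i) \<in> borel_measurable M"
proof -
  have "(\<lambda>v :: 'a^'n. v $ i) \<in> borel_measurable borel"
    by (intro borel_measurable_continuous_onI continuous_intros)
  from measurable_compose[OF assms this] show ?thesis .
qed

lemma borel_measurable_vec_componentI:
  fixes f :: "_ \<Rightarrow> 'a::euclidean_space^'n::finite"
  assumes [measurable]: "\<And>i. (\<lambda>x. f x $ i) \<in> borel_measurable M"
  shows "f \<in> borel_measurable M"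
  unfolding borel_measurable_euclidean_space[where f=f]
  by (auto simp: Basis_vec_def inner_axis)

lemma measurable_diag_mat:
  fixes f :: "_ \<Rightarrow> 'n::finite \<Rightarrow> real"
  assumes "\<And>i. (\<lambda>x. f x i) \<in> borel_measurable M"
  shows "(\<lambda>x. diag_mat (f x)) \<in> borel_measurable M"
proof (intro borel_measurable_vec_componentI)
  fix i j
  note assms[measurable]
  show "(\<lambda>x. diag_mat (f x) $ i $ j) \<in> borel_measurable M"
    by (cases "i = j") (auto simp: diag_mat_def)
qed

text \<open>Puts membership into the form required by \<open>borel_ex_closed\<close>. A basis chosen
  among the eigenvectors has at most \<open>CARD('n)\<close> members, so a fixed number of summands
  suffices, and the open condition that levels exceed \<open>t\<close> becomes a countable union of
  closed ones with gap \<open>1 / Suc n\<close>.\<close>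

lemma sup_upto_param:
  fixes A B :: "'n::finite cmat"
  shows "y \<in> sup_upto A B (\<lambda>m. m > t) \<longleftrightarrow>
    (\<exists>n. \<exists>p :: ((complex^'n)^'n) \<times> (real^'n). (\<forall>i. t + 1 / real (Suc n) \<le> snd p $ i \<and>
      (A *v (fst p $ i) = snd p $ i *\<^sub>R (fst p $ i) \<or> B *v (fst p $ i) = snd p $ i *\<^sub>R (fst p $ i))) \<and>
      y = (\<Sum>i\<in>UNIV. fst p $ i))" (is "_ \<longleftrightarrow> ?R")
proof
  assume ?R
  then obtain n and p :: "((complex^'n)^'n) \<times> (real^'n)" where
    np: "(\<forall>i. t + 1 / real (Suc n) \<le> snd p $ i \<and>
      (A *v (fst p $ i) = snd p $ i *\<^sub>R (fst p $ i) \<or> B *v (fst p $ i) = snd p $ i *\<^sub>R (fst p $ i))) \<and>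
      y = (\<Sum>i\<in>UNIV. fst p $ i)" by blast
  have p: "t + 1 / real (Suc n) \<le> snd p $ i"
      "fst p $ i \<in> eigsp A (snd p $ i) \<or> fst p $ i \<in> eigsp B (snd p $ i)" for i
    using np unfolding eigsp_def mem_Collect_eq of_real_smult by blast+
  have y: "y = (\<Sum>i\<in>UNIV. fst p $ i)" using np by blast
  have "t < snd p $ i" for i
  proof -
    have "0 < 1 / real (Suc n)" by simp
    then show ?thesis using p(1)[of i] by linarith
  qed
  then show "y \<in> sup_upto A B (\<lambda>m. m > t)"
    unfolding y sup_upto_alt using p(2) by (intro vec.span_sum vec.span_base) blast
next
  assume "y \<in> sup_upto A B (\<lambda>m. m > t)"
  moreover have "sup_upto A B (\<lambda>m. m > t) = vec.span {x. \<exists>m>t. x \<in> eigsp A m \<or> x \<in> eigsp B m}"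
    unfolding sup_upto_alt by simp
  ultimately have y: "y \<in> vec.span {x. \<exists>m>t. x \<in> eigsp A m \<or> x \<in> eigsp B m}" (is "y \<in> vec.span ?T") by simp
  obtain S where S: "S \<subseteq> ?T" "vec.independent S" "?T \<subseteq> vec.span S"
    using vec.maximal_independent_subset by blast
  have fin: "finite S" using S(2) by (rule vec.finiteI_independent)
  have "card S \<le> CARD('n)"
    using vec.independent_card_le_dim[OF subset_UNIV S(2)] by (metis vec_dim_card)
  then obtain f :: "complex^'n \<Rightarrow> 'n" where f: "inj_on f S"
    using inj_on_iff_card_le[OF fin, of "UNIV :: 'n set"] by auto
  have "vec.span ?T \<subseteq> vec.span S" using S(3) by (rule vec.span_minimal) simp
  with y have "y \<in> vec.span S" by blast
  then obtain c where c: "y = (\<Sum>b\<in>S. c b *s b)" by (auto simp: vec.span_finite[OF fin])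
  have "\<exists>m. t < m \<and> (b \<in> eigsp A m \<or> b \<in> eigsp B m)" if "b \<in> S" for b using S(1) that by auto
  then obtain M where M: "\<And>b. b \<in> S \<Longrightarrow> t < M b \<and> (b \<in> eigsp A (M b) \<or> b \<in> eigsp B (M b))" by metis
  define g where "g = the_inv_into S f"
  have g: "g (f b) = b" if "b \<in> S" for b using f that by (simp add: g_def the_inv_into_f_f)
  define X :: "(complex^'n)^'n" where "X = (\<chi> i. if i \<in> f ` S then c (g i) *s g i else 0)"
  define m :: "real^'n" where "m = (\<chi> i. if i \<in> f ` S then M (g i) else t + 1)"
  have m_gt: "t < m $ i" for i using M g by (auto simp: m_def)
  have X: "X $ i \<in> eigsp A (m $ i) \<or> X $ i \<in> eigsp B (m $ i)" for i
  proof (cases "i \<in> f ` S")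
    case True
    then obtain b where b: "b \<in> S" "i = f b" by blast
    then have "X $ i = c b *s b" "m $ i = M b" using True g[of b] by (simp_all add: X_def m_def)
    then show ?thesis using M[OF b(1)] vec.subspace_scale[OF subspace_eigsp] by metis
  qed (simp add: X_def vec.subspace_0 subspace_eigsp)
  have sum: "y = (\<Sum>i\<in>UNIV. X $ i)"
  proof -
    have "(\<Sum>i\<in>UNIV. X $ i) = (\<Sum>i\<in>f ` S. c (g i) *s g i)"
      by (simp add: X_def sum.If_cases)
    then show ?thesis unfolding c by (simp add: sum.reindex[OF f] g)
  qed
  define d where "d = Min (range (\<lambda>i. m $ i - t))"
  have "d > 0" unfolding d_def using m_gt by (subst Min_gr_iff) auto
  then obtain n where n: "1 / real (Suc n) < d" using nat_approx_posE by metis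
  have "t + 1 / real (Suc n) \<le> m $ i" for i
  proof -
    have "d \<le> m $ i - t" unfolding d_def by (intro Min_le) auto
    then show ?thesis using n by linarith
  qed
  then show ?R using X sum by (intro exI[of _ n] exI[of _ "(X, m)"]) (auto simp: eigsp_def)
qed

text \<open>The laws in question are pushed forward from the space of all matrices, so measurability is needed
  for arguments that are not Hermitian as well. The set below is the projection of a countable union of
  closed sets along a Euclidean space, hence Borel.\<close>
lemma measurable_near_sup_upto:
  fixes x :: "complex^'n::finite"
  shows "{p. \<exists>y\<in>sup_upto (fst p) (snd p) (\<lambda>m. m > t). norm (x - y) \<le> r} \<in> sets borel"
proof -
  let ?R = "\<lambda>n (p :: 'n cmat \<times> 'n cmat) (q :: ((complex^'n)^'n) \<times> (real^'n)).
     (\<forall>i. t + 1 / real (Suc n) \<le> snd q $ i \<and>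
      (fst p *v (fst q $ i) = snd q $ i *\<^sub>R (fst q $ i) \<or> snd p *v (fst q $ i) = snd q $ i *\<^sub>R (fst q $ i))) \<and>
      norm (x - (\<Sum>i\<in>UNIV. fst q $ i)) \<le> r"
  have R: "{p. \<exists>q. ?R n p q} \<in> sets borel" for n
  proof (rule borel_ex_closed)
    show "closed {p. ?R n (fst p) (snd p)}"
      by (intro closed_Collect_conj closed_Collect_all closed_Collect_disj closed_Collect_le closed_Collect_eq
          continuous_intros)
  qed
  have eq: "{p. \<exists>y\<in>sup_upto (fst p) (snd p) (\<lambda>m. m > t). norm (x - y) \<le> r} = (\<Union>n. {p. \<exists>q. ?R n p q})"
    unfolding Bex_def sup_upto_param by blast
  show ?thesis unfolding eq using R by (intro sets.countable_UN) blast
qed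

text \<open>By Pythagoras the projection is the nearest point of \<open>E\<close>. The Borel sets of
  \<open>measurable_near_sup_upto\<close> thereby become sublevel sets of the distance to the
  projected vector.\<close>

lemma near_subspace_iff:
  assumes E: "vec.subspace E"
  shows "(\<exists>y\<in>E. norm (x - y) \<le> r) \<longleftrightarrow> norm (x - proj E *v x) \<le> r"
proof
  assume "\<exists>y\<in>E. norm (x - y) \<le> r"
  then obtain y where y: "y \<in> E" "norm (x - y) \<le> r" by auto
  have "proj E *v x - y \<in> E" using y(1) proj_in[OF E] E by (intro vec.subspace_diff)
  then have "inner (x - proj E *v x) (proj E *v x - y) = 0"
    using proj_residual[OF E, of x] by (simp add: orth_def inner_eq_Re_cinner)
  then have "(norm ((x - proj E *v x) + (proj E *v x - y)))\<^sup>2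
      = (norm (x - proj E *v x))\<^sup>2 + (norm (proj E *v x - y))\<^sup>2"
    by (intro norm_add_Pythagorean) (simp add: orthogonal_def)
  then have "(norm (x - proj E *v x))\<^sup>2 \<le> (norm (x - y))\<^sup>2" by simp
  then have "norm (x - proj E *v x) \<le> norm (x - y)" by (simp add: abs_le_square_iff[symmetric])
  then show "norm (x - proj E *v x) \<le> r" using y(2) by simp
qed (use proj_in[OF E] in blast)

text \<open>The distances from \<open>x\<close> to the projected vector determine the quadratic form
  of the projection, and polarisation recovers all matrix entries from the form.\<close>

lemma measurable_proj_sup_upto:
  "(\<lambda>p. proj (sup_upto (fst p) (snd p) (\<lambda>m. m > t)) :: 'n::finite cmat) \<in> borel_measurable borel"
proof -
  define P where "P = (\<lambda>p :: 'n cmat \<times> 'n cmat. proj (sup_upto (fst p) (snd p) (\<lambda>m. m > t)))"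
  have herm: "hermitian (P p)" for p unfolding P_def by (intro hermitian_proj subspace_sup_upto)
  have dist[measurable]: "(\<lambda>p. norm (x - P p *v x)) \<in> borel_measurable borel" for x
    unfolding borel_measurable_iff_le P_def
    using measurable_near_sup_upto[of t x] by (simp add: near_subspace_iff[OF subspace_sup_upto])
  have q: "inner (P p *v x) x = (norm x)\<^sup>2 - (norm (x - P p *v x))\<^sup>2" for p x
  proof -
    have "inner (x - proj E *v x) (proj E *v x) = 0" if "vec.subspace E" for E
      using proj_residual[OF that, of x] proj_in[OF that, of x] by (simp add: orth_def inner_eq_Re_cinner)
    then have "inner (x - P p *v x) (P p *v x) = 0" unfolding P_def using subspace_sup_upto by blast
    then show ?thesis
      by (simp add: power2_norm_eq_inner inner_diff_left inner_diff_right inner_commute)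
  qed
  have polar: "inner (P p *v x) y = (inner (P p *v (x + y)) (x + y) - inner (P p *v (x - y)) (x - y)) / 4" for p x y
    using hermitian_inner[OF herm, of p y x]
    by (simp add: matrix_vector_right_distrib matrix_vector_mult_diff_distrib inner_add_left inner_add_right
        inner_diff_left inner_diff_right inner_commute)
  have [measurable]: "(\<lambda>p. P p *v x) \<in> borel_measurable borel" for x
    unfolding borel_measurable_euclidean_space[where f = "\<lambda>p. P p *v x"] polar[of _ x] q by measurable
  have ent: "P p $ i $ j = (P p *v axis j 1) $ i" for p i j
    by (simp add: matrix_vector_mult_def axis_def mult_delta_right)
  have "P \<in> borel_measurable borel"
    by (intro borel_measurable_vec_componentI) (simp add: ent)
  then show ?thesis unfolding P_def .
qed

text \<open>The grid of mesh \<open>1 / n\<close> on the interval from \<open>- n\<close> to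
  \<open>n\<close> has \<open>n * n\<close> points on either side of zero. Divided by
  \<open>n\<close> and lowered by \<open>n\<close>, this count is the ceiling of
  \<open>l * n\<close> over \<open>n\<close>, which tends to \<open>l\<close>.\<close>

lemma card_layers:
  fixes l :: real
  assumes "l \<le> real n" "- real n < l"
  shows "card {j \<in> {- (int n * int n) ..< int n * int n}. real_of_int j / real n < l} = nat (\<lceil>l * real n\<rceil> + int n * int n)"
proof -
  have n: "n > 0" using assms by (cases n) auto
  have le: "\<lceil>l * real n\<rceil> \<le> int n * int n"
    using mult_right_mono[OF assms(1), of "real n"] by (simp add: ceiling_le_iff)
  have "real_of_int j / real n < l \<longleftrightarrow> j < \<lceil>l * real n\<rceil>" for j
    using n by (simp add: less_ceiling_iff divide_less_eq)
  then have "{j \<in> {- (int n * int n) ..< int n * int n}. real_of_int j / real n < l} = {- (int n * int n) ..< \<lceil>l * real n\<rceil>}"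
  proof -
    assume iff: "\<And>j. real_of_int j / real n < l \<longleftrightarrow> j < \<lceil>l * real n\<rceil>"
    have "{j \<in> {-a ..< a}. j < c} = {-a ..< c}" if "c \<le> a" for a c :: int using that by auto
    from this[OF le] show ?thesis unfolding iff .
  qed
  then show ?thesis by simp
qed

text \<open>Summation by parts turns \<open>hsup\<close> into a limit of Riemann sums of the projections onto
  \<open>sup_upto A B (\<lambda>m. m > t)\<close>.\<close>
lemma measurable_hsup': "(\<lambda>p. hsup (fst p) (snd p) :: 'n::finite cmat) \<in> borel_measurable borel"
proof -
  define P where "P = (\<lambda>t. \<lambda>p :: 'n cmat \<times> 'n cmat. proj (sup_upto (fst p) (snd p) (\<lambda>m. m > t)))"
  have [measurable]: "P t \<in> borel_measurable borel" for t
    unfolding P_def by (rule measurable_proj_sup_upto)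
  \<comment> \<open>The subtracted term offsets the start of the grid at \<open>- n\<close>, so that
    a spectral point \<open>l\<close> receives a coefficient close to \<open>l\<close> instead of
    \<open>l + n\<close>.\<close>
  define T where "T n p = (1 / real n) *\<^sub>R (\<Sum>j\<in>{- (int n * int n) ..< int n * int n}. P (real_of_int j / real n) p)
    - real n *\<^sub>R P (- real n) p" for n p
  show ?thesis
  proof (rule borel_measurable_LIMSEQ_metric)
    show "T n \<in> borel_measurable borel" for n unfolding T_def by measurable
    fix p :: "'n cmat \<times> 'n cmat"
    define L where "L = spec (fst p) \<union> spec (snd p)"
    define Q where "Q l = proj (sup_upto (fst p) (snd p) (\<lambda>m. m \<ge> l)) - proj (sup_upto (fst p) (snd p) (\<lambda>m. m > l))" for l
    have fin: "finite L" by (simp add: L_def finite_spec)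
    have PQ: "P t p = (\<Sum>l\<in>L. of_bool (t < l) *\<^sub>R Q l)" for t
    proof -
      have "P t p = (\<Sum>l\<in>{l\<in>L. t < l}. Q l)"
        unfolding P_def L_def Q_def by (rule proj_sup_upto_eq_sum)
      also have "\<dots> = (\<Sum>l\<in>L. if t < l then Q l else 0)"
        using fin by (rule sum.inter_filter)
      finally show ?thesis by (simp add: of_bool_def if_distrib[of "\<lambda>c. c *\<^sub>R _"] cong: if_cong)
    qed
    have T_eq: "T n p = (\<Sum>l\<in>L. (real_of_int \<lceil>l * real n\<rceil> / real n) *\<^sub>R Q l)"
      if n: "\<And>l. l \<in> L \<Longrightarrow> l \<le> real n \<and> - real n < l" "n > 0" for n
    proof -
      have "T n p = (\<Sum>l\<in>L. ((1 / real n) * (\<Sum>j\<in>{- (int n * int n) ..< int n * int n}. of_bool (real_of_int j / real n < l))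
         - real n * of_bool (- real n < l)) *\<^sub>R Q l)"
      proof -
        have "(\<Sum>j\<in>{- (int n * int n) ..< int n * int n}. \<Sum>l\<in>L. of_bool (real_of_int j / real n < l) *\<^sub>R Q l)
          = (\<Sum>l\<in>L. (\<Sum>j\<in>{- (int n * int n) ..< int n * int n}. of_bool (real_of_int j / real n < l)) *\<^sub>R Q l)"
          by (subst sum.swap) (simp only: scaleR_sum_left)
        then show ?thesis
          unfolding T_def PQ by (simp only: scaleR_sum_right scaleR_scaleR scaleR_diff_left sum_subtractf)
      qed
      also have "\<dots> = (\<Sum>l\<in>L. (real_of_int \<lceil>l * real n\<rceil> / real n) *\<^sub>R Q l)"
      proof (intro sum.cong refl arg_cong2[where f = scaleR])
        fix l assume l: "l \<in> L"
        have ge: "\<lceil>l * real n\<rceil> + int n * int n \<ge> 0"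
        proof -
          have "(- real n) * real n \<le> l * real n" using n(1)[OF l] by (intro mult_right_mono) auto
          then have "- (int n * int n) \<le> \<lceil>l * real n\<rceil>" by (simp add: le_ceiling_iff)
          then show ?thesis by simp
        qed
        have "(\<Sum>j\<in>{- (int n * int n) ..< int n * int n}. of_bool (real_of_int j / real n < l))
            = real (card {j \<in> {- (int n * int n) ..< int n * int n}. real_of_int j / real n < l})"
          by (simp add: of_bool_def sum.If_cases Int_def)
        also have "\<dots> = real_of_int \<lceil>l * real n\<rceil> + real n * real n"
          using card_layers[of l n] n(1)[OF l] ge by simp
        finally show "(1 / real n) * (\<Sum>j\<in>{- (int n * int n) ..< int n * int n}. of_bool (real_of_int j / real n < l))
         - real n * of_bool (- real n < l) = real_of_int \<lceil>l * real n\<rceil> / real n"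
          using n by (simp add: n(1)[OF l] add_divide_distrib)
      qed
      finally show ?thesis .
    qed
    have "\<forall>\<^sub>F n in sequentially. l \<le> real n \<and> - real n < l" for l :: real
    proof -
      obtain N where "\<bar>l\<bar> < real N" using reals_Archimedean2 by blast
      then show ?thesis by (intro eventually_sequentiallyI[of N]) auto
    qed
    then have "\<forall>\<^sub>F n in sequentially. \<forall>l\<in>L. l \<le> real n \<and> - real n < l"
      using fin by (simp add: eventually_ball_finite_distrib)
    then have ev: "\<forall>\<^sub>F n in sequentially. (\<Sum>l\<in>L. (real_of_int \<lceil>l * real n\<rceil> / real n) *\<^sub>R Q l) = T n p"
      using eventually_gt_at_top[of 0] by eventually_elim (simp add: T_eq)
    have "(\<lambda>n. real_of_int \<lceil>l * real n\<rceil> / real n) \<longlonglongrightarrow> l" for l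
    proof (rule tendsto_sandwich)
      show "\<forall>\<^sub>F n in sequentially. l \<le> real_of_int \<lceil>l * real n\<rceil> / real n"
        using eventually_gt_at_top[of 0] by eventually_elim (simp add: le_divide_eq)
      show "\<forall>\<^sub>F n in sequentially. real_of_int \<lceil>l * real n\<rceil> / real n \<le> l + 1 / real n"
        using eventually_gt_at_top[of 0]
      proof eventually_elim
        case (elim n)
        have "real_of_int \<lceil>l * real n\<rceil> \<le> l * real n + 1" by linarith
        then show ?case using elim by (simp add: divide_le_eq add_divide_distrib algebra_simps)
      qed
      show "(\<lambda>n. l + 1 / real n) \<longlonglongrightarrow> l"
        using tendsto_add[OF tendsto_const lim_1_over_n, of l] by simp
    qed simp
    then have "(\<lambda>n. \<Sum>l\<in>L. (real_of_int \<lceil>l * real n\<rceil> / real n) *\<^sub>R Q l) \<longlonglongrightarrow> (\<Sum>l\<in>L. l *\<^sub>R Q l)"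
      by (intro tendsto_intros)
    also have "(\<Sum>l\<in>L. l *\<^sub>R Q l) = hsup (fst p) (snd p)"
      unfolding hsup_eq_sum L_def Q_def ..
    finally show "(\<lambda>n. T n p) \<longlonglongrightarrow> hsup (fst p) (snd p)"
      using ev by (rule Lim_transform_eventually)
  qed
qed

lemma measurable_hsup [measurable]:
  fixes f :: "_ \<Rightarrow> 'n::finite cmat"
  assumes "f \<in> borel_measurable M" "g \<in> borel_measurable M"
  shows "(\<lambda>x. hsup (f x) (g x)) \<in> borel_measurable M"
  using measurable_compose[OF borel_measurable_Pair[OF assms] measurable_hsup'] by simp

text \<open>The dimension of a subspace is the trace of its projection, a continuous function of a
  measurable one.\<close>

lemma measurable_cnt [measurable]: "(\<lambda>A :: 'n::finite cmat. cnt A t) \<in> measurable borel (count_space UNIV)"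
proof -
  have "(\<lambda>A :: 'n cmat. (A, A)) \<in> borel_measurable borel" by measurable
  from measurable_compose[OF this measurable_proj_sup_upto[of t]]
  have [measurable]: "(\<lambda>A :: 'n cmat. proj (up A t)) \<in> borel_measurable borel" by simp
  have "real (cnt A t) = Re (\<Sum>i\<in>UNIV. proj (up A t) $ i $ i)" for A :: "'n cmat"
    using trace_proj[OF subspace_sup_upto, of A A "\<lambda>m. m > t"] by (simp add: cnt_def trace_def)
  moreover have "(\<lambda>A :: 'n cmat. Re (\<Sum>i\<in>UNIV. proj (up A t) $ i $ i)) \<in> borel_measurable borel"
  proof -
    have "continuous_on UNIV (\<lambda>P :: 'n cmat. Re (\<Sum>i\<in>UNIV. P $ i $ i))" by (intro continuous_intros)
    from measurable_compose[OF _ borel_measurable_continuous_onI[OF this]]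
    show ?thesis by measurable
  qed
  ultimately have real[measurable]: "(\<lambda>A :: 'n cmat. real (cnt A t)) \<in> borel_measurable borel" by simp
  have "{A :: 'n cmat. cnt A t = k} \<in> sets borel" for k
  proof -
    have "{A \<in> space borel. real (cnt (A :: 'n cmat) t) = real k} \<in> sets borel" by measurable
    then show ?thesis by simp
  qed
  then show ?thesis
    by (auto simp: measurable_count_space_eq2_countable vimage_def)
qed

text \<open>On matrices with too few independent eigenvectors the set under \<open>Max\<close> is
  empty and the component takes the unspecified but constant value \<open>c\<close>. On all others
  \<open>eig_desc_gt_iff\<close> describes it by counts, and the levels \<open>- real k\<close>
  detect which case holds.\<close>

lemma measurable_eig_desc_component:
  assumes i: "i \<in> {1..CARD('n::finite)}"
  shows "(\<lambda>A :: 'n cmat. eig_desc A i) \<in> borel_measurable borel"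
  unfolding borel_measurable_iff_greater
proof
  fix t :: real
  define c where "c = Max ({} :: real set)"
  have none: "eig_desc A i = c" if "\<And>k. \<not> i \<le> cnt A (- real k)" for A :: "'n cmat"
  proof -
    have "{l\<in>spec A. i \<le> vec.dim (sup_upto A A (\<lambda>m. m \<ge> l))} = {}"
    proof (intro equals0I)
      fix l assume "l \<in> {l\<in>spec A. i \<le> vec.dim (sup_upto A A (\<lambda>m. m \<ge> l))}"
      then have l: "i \<le> vec.dim (sup_upto A A (\<lambda>m. m \<ge> l))" by simp
      obtain k where "\<bar>l\<bar> < real k" using reals_Archimedean2 by blast
      then have "sup_upto A A (\<lambda>m. m \<ge> l) \<subseteq> up A (- real k)" by (intro sup_upto_mono) auto
      then have "i \<le> cnt A (- real k)" unfolding cnt_def using l vec.dim_subset order_trans by blast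
      then show False using that by blast
    qed
    moreover have "eig_desc A i = Max {l\<in>spec A. i \<le> vec.dim (sup_upto A A (\<lambda>m. m \<ge> l))}"
      using i by (simp add: eig_desc_def sup_upto_def)
    ultimately show ?thesis by (simp only: c_def)
  qed
  have "{A \<in> space borel. t < eig_desc (A :: 'n cmat) i}
      = {A \<in> space borel. (\<exists>k. i \<le> cnt A (- real k)) \<and> i \<le> cnt A t \<or> (\<forall>k. \<not> i \<le> cnt A (- real k)) \<and> t < c}"
    using eig_desc_gt_iff[OF i] none by (intro Collect_cong) (metis (no_types))
  also have "\<dots> \<in> sets borel" by measurable
  finally show "{A \<in> space borel. t < eig_desc (A :: 'n cmat) i} \<in> sets borel" .
qed

lemma measurable_eig_desc [measurable]:
  "eig_desc \<in> measurable (borel :: 'n::finite cmat measure) (PiM {1..CARD('n)} (\<lambda>_. borel))"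
proof (rule measurable_PiM_single')
  show "(\<lambda>A :: 'n cmat. eig_desc A i) \<in> borel_measurable borel" if "i \<in> {1..CARD('n)}" for i
    using that by (rule measurable_eig_desc_component)
qed (auto simp: eig_desc_def)

section \<open>Haar measure and general position\<close>

text \<open>Coordinate subspaces; by \<open>up_diag\<close> they are the upper spectral subspaces of
  diagonal matrices.\<close>

definition csp :: "'n set \<Rightarrow> (complex^'n::finite) set" where
  "csp S = {x. \<forall>i. i \<notin> S \<longrightarrow> x $ i = 0}"

lemma subspace_csp: "vec.subspace (csp S)"
  by (auto simp: csp_def vec.subspace_def)

lemma dim_csp: "vec.dim (csp S :: (complex^'n::finite) set) = card S"
  unfolding csp_def by (rule dim_substandard_cart)

lemma csp_mono: "S \<subseteq> T \<Longrightarrow> csp S \<subseteq> csp T"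
  by (auto simp: csp_def)

lemma csp_insert: "x \<in> csp (insert v S) \<Longrightarrow> x - x $ v *s axis v 1 \<in> csp S"
  by (auto simp: csp_def axis_def)

lemma axis_csp: "i \<in> S \<Longrightarrow> axis i c \<in> csp S"
  by (auto simp: csp_def axis_def)

lemma cinner_axis: "cinner (axis i c) y = c * cnj (y $ i)"
  by (simp add: cinner_def axis_def mult_delta_left)

lemma cinner_axis_right: "cinner x (axis i 1) = x $ i"
  by (metis cinner_axis cinner_commute complex_cnj_cnj mult_1)

text \<open>The reflection along \<open>z = w - e_v\<close> exchanges \<open>e_v\<close> and
  \<open>w\<close> because their sum is orthogonal to \<open>z\<close>; for unit vectors this
  orthogonality amounts to \<open>w $ v\<close> being real. Vectors of \<open>csp S\<close> are
  fixed since \<open>z\<close> vanishes on \<open>S\<close>.\<close>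

lemma ex_householder:
  fixes w :: "complex^'n::finite"
  assumes w: "norm w = 1" and re: "cnj (w $ v) = w $ v" and S: "\<And>i. i \<in> S \<Longrightarrow> w $ i = 0" and v: "v \<notin> S"
  obtains R where "unitary R" "R *v axis v 1 = w" "\<And>x. x \<in> csp S \<Longrightarrow> R *v x = x"
proof -
  define z where "z = w - axis v 1"
  define E where "E = vec.span {z}"
  have E: "vec.subspace E" by (simp add: E_def)
  define R where "R = mat 1 - 2 *\<^sub>R proj E"
  have Rx: "R *v x = x - 2 *\<^sub>R (proj E *v x)" for x
    by (simp add: R_def matrix_vector_mult_diff_rdistrib scaleR_mult_vec)
  have "R *v (R *v x) = x" for x
  proof -
    have "proj E *v (x - 2 *\<^sub>R (proj E *v x)) = - (proj E *v x)"
      by (simp only: matrix_vector_mult_diff_distrib mult_vec_scaleR proj_fix[OF E proj_in[OF E]]) (simp only: scaleR_2, simp)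
    then have "(x - 2 *\<^sub>R (proj E *v x)) - 2 *\<^sub>R (proj E *v (x - 2 *\<^sub>R (proj E *v x)))
        = (x - 2 *\<^sub>R (proj E *v x)) + 2 *\<^sub>R (proj E *v x)"
      by (simp only: scaleR_minus_right diff_minus_eq_add)
    then show ?thesis unfolding Rx by (simp only: diff_add_cancel)
  qed
  then have "R ** R = mat 1" by (intro matrix_eqI) (simp add: matrix_vector_mul_assoc[symmetric] del: matrix_vector_mul_assoc)
  moreover have "adj R = R"
    using hermitian_proj[OF E] by (simp add: R_def adj_diff adj_scaleR hermitian_def)
  ultimately have "unitary R" by (simp add: unitary_def)
  moreover have "R *v axis v 1 = w"
  proof -
    define a where "a = axis v 1 + w"
    have "cinner a z = 0"
    proof -
      have "cinner a z = cnj (cinner z a)" by (simp add: cinner_commute)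
      also have "cinner z a = 0"
      proof -
        have "cinner a w - cinner a (axis v 1) = cinner (axis v 1) w + cinner w w - (cinner (axis v 1) (axis v 1) + cinner w (axis v 1))"
          by (simp add: a_def cinner_add_left)
        also have "\<dots> = 0"
        proof -
          have "cinner w w = 1" using w by (simp add: cinner_self)
          then show ?thesis using re by (simp add: cinner_axis cinner_axis_right)
        qed
        finally have "cnj (cinner w a) - cnj (cinner (axis v 1) a) = 0" by (simp add: cinner_commute)
        then have "cnj (cinner z a) = 0" by (simp add: z_def cinner_diff_left)
        then show ?thesis by simp
      qed
      finally show ?thesis by simp
    qed
    then have "a \<in> orth E" unfolding E_def orth_span by (simp add: orth_def)
    then have "proj E *v a = 0" by (rule proj_orth_eq_0[OF E])
    moreover have "proj E *v z = z" by (intro proj_fix[OF E]) (simp add: E_def vec.span_base)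
    moreover have "2 *\<^sub>R axis v 1 = a - z" by (simp add: a_def z_def scaleR_2)
    ultimately have "2 *\<^sub>R (proj E *v axis v 1) = - z"
      by (metis mult_vec_scaleR matrix_vector_mult_diff_distrib diff_0)
    then show ?thesis unfolding Rx by (simp add: z_def)
  qed
  moreover have "R *v x = x" if x: "x \<in> csp S" for x
  proof -
    have "x $ i * cnj (z $ i) = 0" for i
      using x S[of i] v by (cases "i \<in> S") (auto simp: csp_def z_def axis_def)
    then have "cinner x z = 0" unfolding cinner_def by (intro sum.neutral) blast
    then have "x \<in> orth E" unfolding E_def orth_span by (simp add: orth_def)
    then show ?thesis unfolding Rx by (simp add: proj_orth_eq_0[OF E])
  qed
  ultimately show thesis by (rule that)
qed

text \<open>A point of the moment curve with the coordinates in \<open>S\<close> erased, so that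
  after normalisation it is a legitimate target for \<open>ex_householder\<close>. The exponents
  \<open>idx i\<close> are distinct, which turns a linear functional into a polynomial in
  \<open>j\<close> without cancellation.\<close>

definition vdm :: "'n set \<Rightarrow> nat \<Rightarrow> complex^'n::finite" where
  "vdm S j = (\<chi> i. if i \<in> S then 0 else of_nat j ^ idx i)"

text \<open>A vector of the moment curve lies in a proper subspace only if its parameter is a root of a
  nonzero polynomial of degree at most the dimension.\<close>
lemma card_vdm:
  fixes U :: "'n::finite cmat"
  assumes U: "unitary U" and G: "vec.subspace G" "G \<noteq> UNIV" and S: "(*v) U ` csp S \<subseteq> G"
  shows "finite {j. U *v vdm S j \<in> G}" "card {j. U *v vdm S j \<in> G} \<le> CARD('n)"
proof -
  obtain x where x: "x \<notin> G" using G(2) by auto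
  define y where "y = x - proj G *v x"
  have y: "y \<in> orth G" "y \<noteq> 0" using x proj_in[OF G(1), of x] proj_residual[OF G(1)] by (auto simp: y_def)
  define z where "z = adj U *v y"
  have cz: "cinner a z = 0" if "U *v a \<in> G" for a
    using y(1) that cinner_commute[of y "U *v a"] by (auto simp: z_def orth_def cinner_mult_vec[symmetric])
  have zS: "z $ i = 0" if "i \<in> S" for i
  proof -
    have "U *v axis i 1 \<in> G" using S axis_csp[OF that] by blast
    from cz[OF this] show ?thesis by (simp add: cinner_axis)
  qed
  have "z \<noteq> 0" using y(2) unitary_vec(2)[OF U, of y] by (auto simp: z_def simp del: matrix_vector_mul_assoc)
  then obtain i0 where i0: "z $ i0 \<noteq> 0" by (auto simp: vec_eq_iff)
  \<comment> \<open>At \<open>j\<close> this polynomial equals \<open>cinner (vdm S j) z\<close>: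
    the coordinates erased in \<open>vdm\<close> do not matter because \<open>z\<close> vanishes
    there.\<close>
  define p where "p = (\<Sum>i\<in>UNIV. monom (cnj (z $ i)) (idx i))"
  have "coeff p (idx i0) = (\<Sum>i\<in>UNIV. if i = i0 then cnj (z $ i) else 0)"
    unfolding p_def coeff_sum
    using bij_idx[where 'n='n] by (intro sum.cong) (auto simp: bij_betw_def inj_eq)
  then have p: "p \<noteq> 0" using i0 by auto
  have deg: "degree p \<le> CARD('n)"
    unfolding p_def
  proof (rule degree_sum_le)
    fix i :: 'n
    have "degree (monom (cnj (z $ i)) (idx i)) \<le> idx i" by (rule degree_monom_le)
    then show "degree (monom (cnj (z $ i)) (idx i)) \<le> CARD('n)" using idx_in[of i] by simp
  qed simp
  have poly: "poly p (of_nat j) = 0" if "U *v vdm S j \<in> G" for j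
  proof -
    have "poly p (of_nat j) = cinner (vdm S j) z"
      using zS by (auto simp: p_def poly_sum poly_monom cinner_def vdm_def mult_ac intro!: sum.cong)
    then show ?thesis using cz[OF that] by simp
  qed
  have inj: "inj_on (of_nat :: nat \<Rightarrow> complex) A" for A by (simp add: inj_on_def)
  have sub: "of_nat ` {j. U *v vdm S j \<in> G} \<subseteq> {x. poly p x = 0}" using poly by auto
  have fin: "finite {x. poly p x = 0}" using p by (rule poly_roots_finite)
  show "finite {j. U *v vdm S j \<in> G}"
    using finite_subset[OF sub fin] finite_imageD[OF _ inj] by blast
  have "card {j. U *v vdm S j \<in> G} \<le> card {x. poly p x = 0}"
    using card_mono[OF fin sub] by (simp add: card_image[OF inj])
  also have "\<dots> \<le> degree p" using p by (rule card_poly_roots_bound)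
  finally show "card {j. U *v vdm S j \<in> G} \<le> CARD('n)" using deg by simp
qed

lemma dim_span_Un_le: "vec.dim (E \<union> F) \<le> vec.dim E + vec.dim (F :: (complex^'n::finite) set)"
proof -
  have "vec.dim (E \<union> F) = vec.dim {x + y | x y. x \<in> vec.span E \<and> y \<in> vec.span F}"
    unfolding vec.span_Un[symmetric] by simp
  then show ?thesis using vec.dim_sums_Int[of "vec.span E" "vec.span F"] by simp
qed

lemma (in sigma_finite_measure) nn_integral_pair:
  assumes "(\<lambda>p. g (fst p) (snd p)) \<in> borel_measurable (N \<Otimes>\<^sub>M M)"
  shows "(\<integral>\<^sup>+p. g (fst p) (snd p) \<partial>(N \<Otimes>\<^sub>M M)) = (\<integral>\<^sup>+x. (\<integral>\<^sup>+y. g x y \<partial>M) \<partial>N)"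
  using nn_integral_fst[OF assms] by simp

locale haar =
  fixes H :: "'n::finite cmat measure"
  assumes is_haar: "is_haar H"
begin

sublocale prob_space H
  using is_haar by (simp add: is_haar_def)

lemma sets_H [measurable_cong, simp]: "sets H = sets borel"
  using is_haar by (simp add: is_haar_def)

lemma space_H [simp]: "space H = UNIV"
  using sets_eq_imp_space_eq[OF sets_H] by simp

lemma emeasure_H_UNIV [simp]: "emeasure H UNIV = 1"
  using emeasure_space_1 by simp

lemma AE_unitary: "AE U in H. unitary U"
proof -
  have "closed {U :: 'n cmat. adj U ** U = mat 1}" by (intro closed_Collect_eq continuous_intros)
  then have "{U :: 'n cmat. unitary U} \<in> sets borel" by (simp add: unitary_def)
  have "prob {U. unitary U} = 1" using is_haar by (simp add: is_haar_def measure_def)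
  from AE_prob_1[OF this] show ?thesis by simp
qed

lemma left_inv:
  assumes "unitary V" and f[measurable]: "f \<in> borel_measurable borel"
  shows "(\<integral>\<^sup>+U. f (V ** U) \<partial>H) = (\<integral>\<^sup>+U. f U \<partial>H)"
proof -
  have "(\<integral>\<^sup>+U. f U \<partial>H) = (\<integral>\<^sup>+U. f U \<partial>distr H borel (\<lambda>U. V ** U))"
    using is_haar assms(1) by (simp add: is_haar_def)
  also have "\<dots> = (\<integral>\<^sup>+U. f (V ** U) \<partial>H)" by (rule nn_integral_distr) measurable
  finally show ?thesis ..
qed

text \<open>Integrate \<open>f (x\<^sup>* y)\<close> over \<open>x\<close> and \<open>y\<close> in both orders.\<close>
lemma adj_inv:
  assumes f[measurable]: "f \<in> borel_measurable borel"
  shows "(\<integral>\<^sup>+U. f (adj U) \<partial>H) = (\<integral>\<^sup>+U. f U \<partial>H)"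
proof -
  interpret pair_prob_space H H ..
  have "(\<integral>\<^sup>+U. f U \<partial>H) = (\<integral>\<^sup>+x. (\<integral>\<^sup>+y. f (adj x ** y) \<partial>H) \<partial>H)"
  proof -
    have "(\<integral>\<^sup>+x. (\<integral>\<^sup>+y. f (adj x ** y) \<partial>H) \<partial>H) = (\<integral>\<^sup>+x. (\<integral>\<^sup>+y. f y \<partial>H) \<partial>H)"
      using AE_unitary by (intro nn_integral_cong_AE, elim eventually_mono) (simp add: left_inv unitary_adj)
    then show ?thesis by (simp add: emeasure_space_1)
  qed
  also have "\<dots> = (\<integral>\<^sup>+y. (\<integral>\<^sup>+x. f (adj x ** y) \<partial>H) \<partial>H)"
    by (rule Fubini'[symmetric]) measurable
  also have "\<dots> = (\<integral>\<^sup>+y. (\<integral>\<^sup>+x. f (adj x) \<partial>H) \<partial>H)"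
    using AE_unitary
  proof (intro nn_integral_cong_AE, elim eventually_mono)
    fix y :: "'n cmat" assume "unitary y"
    then show "(\<integral>\<^sup>+x. f (adj x ** y) \<partial>H) = (\<integral>\<^sup>+x. f (adj x) \<partial>H)"
      using left_inv[of "adj y" "\<lambda>x. f (adj x)"] by (simp add: unitary_adj adj_mult)
  qed
  finally show ?thesis by (simp add: emeasure_space_1)
qed

text \<open>Inversion preserves Haar measure and exchanges right translation with the left
  translation whose invariance is assumed.\<close>

lemma right_inv:
  assumes V: "unitary V" and f[measurable]: "f \<in> borel_measurable borel"
  shows "(\<integral>\<^sup>+U. f (U ** V) \<partial>H) = (\<integral>\<^sup>+U. f U \<partial>H)"
proof -
  have "(\<integral>\<^sup>+U. f (U ** V) \<partial>H) = (\<integral>\<^sup>+U. f (adj (adj V ** U)) \<partial>H)"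
    using adj_inv[of "\<lambda>U. f (U ** V)"] by (simp add: adj_mult)
  also have "\<dots> = (\<integral>\<^sup>+U. f (adj U) \<partial>H)"
    using V by (intro left_inv[of "adj V" "\<lambda>U. f (adj U)"]) (auto simp: unitary_adj)
  also have "\<dots> = (\<integral>\<^sup>+U. f U \<partial>H)" by (rule adj_inv) simp
  finally show ?thesis .
qed

text \<open>Replace \<open>U\<close> by \<open>U R\<^sub>j\<close>, where \<open>R\<^sub>j\<close> fixes \<open>csp S\<close> and sends \<open>e\<^sub>v\<close> to the \<open>j\<close>-th point of the
  moment curve of the complement. Each \<open>U\<close> is bad for at most \<open>CARD('n)\<close> of the \<open>j\<close>, while all the
  bad events have the same probability.\<close>
lemma AE_axis_notin:
  assumes E: "vec.subspace E" and v: "v \<notin> S" and dim: "vec.dim E + card S < CARD('n)"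
  shows "AE U in H. U *v axis v 1 \<notin> vec.span (E \<union> (*v) U ` csp S)"
proof -
  define G where "G U = vec.span (E \<union> (*v) U ` csp S)" for U
  define Bad where "Bad = {U :: 'n cmat. U *v axis v 1 \<in> G U}"
  have G_iff: "x \<in> G U \<longleftrightarrow> (\<exists>q. fst q \<in> E \<and> snd q \<in> csp S \<and> x = fst q + U *v snd q)" for x U
  proof -
    have eqs: "vec.span E = E" "vec.span ((*v) U ` csp S) = (*v) U ` csp S"
      using E subspace_image[OF subspace_csp, of U S] by (simp_all add: vec.span_eq_iff)
    show ?thesis unfolding G_def vec.span_Un eqs by auto
  qed
  have "closed E" "closed (csp S :: (complex^'n) set)"
    using E subspace_csp by (auto intro!: closed_subspace subspace_vec_real)
  have Bad[measurable]: "Bad \<in> sets borel"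
    unfolding Bad_def G_iff
  proof (rule borel_ex_closed)
    have "closed {p :: 'n cmat \<times> (complex^'n) \<times> (complex^'n). fst (snd p) \<in> E}"
      using closed_vimage[OF \<open>closed E\<close>, of "\<lambda>p :: 'n cmat \<times> (complex^'n) \<times> (complex^'n). fst (snd p)"]
      by (simp add: vimage_def continuous_on_fst continuous_on_snd)
    moreover have "closed {p :: 'n cmat \<times> (complex^'n) \<times> (complex^'n). snd (snd p) \<in> csp S}"
      using closed_vimage[OF \<open>closed (csp S)\<close>, of "\<lambda>p :: 'n cmat \<times> (complex^'n) \<times> (complex^'n). snd (snd p)"]
      by (simp add: vimage_def continuous_on_snd)
    moreover have "closed {p :: 'n cmat \<times> (complex^'n) \<times> (complex^'n).
        fst p *v axis v 1 = fst (snd p) + fst p *v snd (snd p)}"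
      by (intro closed_Collect_eq continuous_intros)
    ultimately show "closed {p :: 'n cmat \<times> (complex^'n) \<times> (complex^'n). fst (snd p) \<in> E \<and> snd (snd p) \<in> csp S \<and>
        fst p *v axis v 1 = fst (snd p) + fst p *v snd (snd p)}"
      by (intro closed_Collect_conj)
  qed
  have vdm_v: "vdm S j $ v = of_nat j ^ idx v" for j using v by (simp add: vdm_def)
  \<comment> \<open>For \<open>j \<ge> 1\<close> the coordinate at \<open>v\<close> is the positive
    real \<open>j ^ idx v\<close>: the curve point can be normalised, and the reality condition of
    the reflection holds.\<close>
  have "\<exists>R. unitary R \<and> (\<forall>x\<in>csp S. R *v x = x) \<and> (\<exists>c. R *v axis v 1 = c *\<^sub>R vdm S j \<and> c > 0)" if "j \<ge> 1" for j :: nat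
  proof -
    have ne: "vdm S j \<noteq> 0" using vdm_v[of j] that by (metis not_one_le_zero of_nat_eq_0_iff power_not_zero zero_index)
    define c where "c = 1 / norm (vdm S j :: complex^'n)"
    have c: "c > 0" using ne by (simp add: c_def)
    define w :: "complex^'n" where "w = c *\<^sub>R vdm S j"
    have "norm w = 1" using ne by (simp add: w_def c_def)
    moreover have "cnj (w $ v) = w $ v" by (simp add: w_def vdm_v)
    moreover have "w $ i = 0" if "i \<in> S" for i using that by (simp add: w_def vdm_def)
    ultimately obtain R where "unitary R" "R *v axis v 1 = w" "\<And>x. x \<in> csp S \<Longrightarrow> R *v x = x"
      using ex_householder[of w v S] v by blast
    then show ?thesis using c unfolding w_def by blast
  qed
  then obtain R where R: "\<And>j. j \<ge> 1 \<Longrightarrow> unitary (R j)" "\<And>j x. j \<ge> 1 \<Longrightarrow> x \<in> csp S \<Longrightarrow> R j *v x = x"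
    "\<And>j. j \<ge> (1::nat) \<Longrightarrow> \<exists>c. R j *v axis v 1 = c *\<^sub>R vdm S j \<and> c > 0" by metis
  have Bad_R: "U *v vdm S j \<in> G U" if UR: "U ** R j \<in> Bad" and j: "j \<ge> 1" for U j
  proof -
    obtain c where c: "R j *v axis v 1 = c *\<^sub>R vdm S j" "c > 0" using R(3) j by blast
    have "(*v) (U ** R j) ` csp S = (*v) U ` csp S"
      using R(2)[OF j] by (intro image_cong) (auto simp: matrix_vector_mul_assoc[symmetric] simp del: matrix_vector_mul_assoc)
    then have "G (U ** R j) = G U" by (simp add: G_def)
    then have "c *\<^sub>R (U *v vdm S j) \<in> G U"
      using UR c(1) by (simp add: Bad_def matrix_vector_mul_assoc[symmetric] mult_vec_scaleR del: matrix_vector_mul_assoc)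
    moreover have "subspace (G U)" unfolding G_def by (intro subspace_vec_real) simp
    ultimately have "(1 / c) *\<^sub>R (c *\<^sub>R (U *v vdm S j)) \<in> G U" by (metis subspace_scale)
    moreover have "(1 / c) *\<^sub>R (c *\<^sub>R (U *v vdm S j)) = U *v vdm S j" using c(2) by simp
    ultimately show ?thesis by (simp only:)
  qed
  have count: "(\<Sum>j\<in>{1..n}. indicator Bad (U ** R j)) \<le> (of_nat CARD('n) :: ennreal)" if U: "unitary U" for U n
  proof -
    have dG: "vec.dim (G U) < CARD('n)"
    proof -
      have "vec.dim ((*v) U ` csp S) \<le> card S"
        using vec.dim_image_le[of "(*v) U" "csp S"] by (simp add: dim_csp)
      then show ?thesis using dim_span_Un_le[of E "(*v) U ` csp S"] dim by (simp add: G_def)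
    qed
    then have "G U \<noteq> UNIV" by (metis less_irrefl vec_dim_card)
    moreover have "(*v) U ` csp S \<subseteq> G U" unfolding G_def by (auto intro: vec.span_base)
    ultimately have fin: "finite {j. U *v vdm S j \<in> G U}" and card: "card {j. U *v vdm S j \<in> G U} \<le> CARD('n)"
      using card_vdm[OF U, of "G U" S] by (simp_all add: G_def)
    have "(\<Sum>j\<in>{1..n}. indicator Bad (U ** R j)) = (of_nat (card {j\<in>{1..n}. U ** R j \<in> Bad}) :: ennreal)"
      by (simp add: indicator_def sum.If_cases Int_def of_bool_def)
    also have "card {j\<in>{1..n}. U ** R j \<in> Bad} \<le> card {j. U *v vdm S j \<in> G U}"
      using Bad_R by (intro card_mono fin) auto
    finally show ?thesis using card by (metis (no_types, lifting) of_nat_mono order_trans)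
  qed
  have bound: "real n * prob Bad \<le> real CARD('n)" for n
  proof -
    have "of_nat n * emeasure H Bad = (\<Sum>j\<in>{1..n}. \<integral>\<^sup>+U. indicator Bad (U ** R j) \<partial>H)"
      using R(1) by (simp add: right_inv)
    also have "\<dots> = (\<integral>\<^sup>+U. (\<Sum>j\<in>{1..n}. indicator Bad (U ** R j)) \<partial>H)"
      by (rule nn_integral_sum[symmetric]) measurable
    also have "\<dots> \<le> (\<integral>\<^sup>+U. of_nat CARD('n) \<partial>H)"
      using AE_unitary by (intro nn_integral_mono_AE, elim eventually_mono) (rule count)
    also have "\<dots> = of_nat CARD('n)" by (simp add: emeasure_space_1)
    finally show ?thesis
      by (simp add: emeasure_eq_measure ennreal_of_nat_eq_real_of_nat flip: ennreal_mult)
  qed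
  have "prob Bad = 0"
  proof (rule ccontr)
    assume "prob Bad \<noteq> 0"
    then have pos: "prob Bad > 0" using measure_nonneg[of H Bad] by linarith
    obtain n where "real CARD('n) / prob Bad < real n" using reals_Archimedean2 by blast
    then show False using bound[of n] pos by (simp add: divide_less_eq)
  qed
  then show ?thesis
    using Bad by (intro AE_I[of _ _ Bad]) (auto simp: Bad_def G_def emeasure_eq_measure)
qed

text \<open>Adding the coordinate vectors of \<open>S\<close> one by one, each raises the dimension
  almost surely as long as there is room. If \<open>S\<close> is too large, a subset of exactly the
  missing size already fills the space.\<close>

lemma AE_dim_Un:
  assumes E: "vec.subspace E"
  shows "AE U in H. vec.dim (E \<union> (*v) U ` csp S) = min CARD('n) (vec.dim E + card S)"
proof -
  have small: "AE U in H. vec.dim (E \<union> (*v) U ` csp S) = vec.dim E + card S"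
    if "vec.dim E + card S \<le> CARD('n)" for S
    using finite[of S] that
  proof (induction S rule: finite_induct)
    case empty
    have "E \<union> (*v) U ` csp {} = insert 0 E" for U :: "'n cmat"
    proof -
      have "csp {} = {0 :: complex^'n}" by (auto simp: csp_def vec_eq_iff)
      then show ?thesis by simp
    qed
    then show ?case by (simp add: vec.dim_insert vec.span_zero)
  next
    case (insert v S)
    have "AE U in H. vec.dim (E \<union> (*v) U ` csp S) = vec.dim E + card S"
      using insert by simp
    moreover have "AE U in H. U *v axis v 1 \<notin> vec.span (E \<union> (*v) U ` csp S)"
      using insert by (intro AE_axis_notin E) auto
    ultimately show ?case
    proof eventually_elim
      case (elim U)
      let ?F = "E \<union> (*v) U ` csp S"
      have "vec.span (E \<union> (*v) U ` csp (insert v S)) = vec.span (insert (U *v axis v 1) ?F)"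
      proof (intro antisym vec.span_minimal vec.subspace_span Un_least subsetI)
        fix y assume "y \<in> (*v) U ` csp (insert v S)"
        then obtain x where x: "x \<in> csp (insert v S)" "y = U *v x" by auto
        have "y = x $ v *s (U *v axis v 1) + U *v (x - x $ v *s axis v 1)"
          by (simp add: x(2) matrix_vector_mult_diff_distrib vec.scale)
        also have "\<dots> \<in> vec.span (insert (U *v axis v 1) ?F)"
          using csp_insert[OF x(1)] by (intro vec.span_add vec.span_scale vec.span_base) auto
        finally show "y \<in> vec.span (insert (U *v axis v 1) ?F)" .
      next
        fix y assume "y \<in> insert (U *v axis v 1) ?F"
        then show "y \<in> vec.span (E \<union> (*v) U ` csp (insert v S))"
          using csp_mono[of S "insert v S"] axis_csp[of v "insert v S"]
          by (intro vec.span_base) blast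
      qed (auto intro: vec.span_base)
      then have "vec.dim (E \<union> (*v) U ` csp (insert v S)) = vec.dim (insert (U *v axis v 1) ?F)"
        by (metis vec.dim_span)
      then show ?case using elim insert.hyps by (simp add: vec.dim_insert)
    qed
  qed
  show ?thesis
  proof (cases "vec.dim E + card S \<le> CARD('n)")
    case True
    then show ?thesis using small[of S] by simp
  next
    case False
    have dE: "vec.dim E \<le> CARD('n)" by (rule dim_subset_UNIV_cart_gen)
    have "CARD('n) - vec.dim E \<le> card S" using False by simp
    then obtain T where T: "T \<subseteq> S" "card T = CARD('n) - vec.dim E" by (metis obtain_subset_with_card_n)
    have "AE U in H. vec.dim (E \<union> (*v) U ` csp T) = CARD('n)"
      using small[of T] dE T(2) by simp
    then show ?thesis
    proof eventually_elim
      case (elim U)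
      have "vec.dim (E \<union> (*v) U ` csp T) \<le> vec.dim (E \<union> (*v) U ` csp S)"
        using csp_mono[OF T(1)] by (intro vec.dim_subset) auto
      then show ?case using elim dim_subset_UNIV_cart_gen[of "E \<union> (*v) U ` csp S"] False by simp
    qed
  qed
qed

lemma AE_cnt_hsup:
  assumes "hermitian A"
  shows "AE U in H. cnt (hsup A (U ** diag_mat x ** adj U)) t = min CARD('n) (cnt A t + card {i. t < x i})"
  using AE_dim_Un[OF subspace_sup_upto[of A A "\<lambda>m. m > t"], of "{i. t < x i}"] AE_unitary
proof eventually_elim
  case (elim U)
  then show ?case
    unfolding cnt_hsup[OF assms] sup_upto_conj[OF elim(2)] up_diag by (simp add: cnt_def csp_def)
qed

end

section \<open>Conjugation invariant laws\<close>

definition conj_inv :: "'n::finite cmat measure \<Rightarrow> bool" where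
  "conj_inv P \<longleftrightarrow> (\<forall>V. unitary V \<longrightarrow> distr P borel (\<lambda>A. V ** A ** adj V) = P)"

lemma nn_integral_conj_inv:
  assumes P: "conj_inv P" "sets P = sets borel" and V: "unitary V"
    and f[measurable]: "f \<in> borel_measurable borel"
  shows "(\<integral>\<^sup>+A. f (V ** A ** adj V) \<partial>P) = (\<integral>\<^sup>+A. f A \<partial>P)"
proof -
  note P(2)[measurable_cong]
  have "(\<integral>\<^sup>+A. f A \<partial>P) = (\<integral>\<^sup>+A. f A \<partial>distr P borel (\<lambda>A. V ** A ** adj V))"
    using P(1) V by (simp add: conj_inv_def)
  also have "\<dots> = (\<integral>\<^sup>+A. f (V ** A ** adj V) \<partial>P)" by (rule nn_integral_distr) measurable
  finally show ?thesis ..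
qed

lemma conj_invI:
  assumes s: "sets P = sets borel"
    and inv: "\<And>V f. unitary V \<Longrightarrow> f \<in> borel_measurable borel \<Longrightarrow>
      (\<integral>\<^sup>+A. f (V ** A ** adj V) \<partial>P) = (\<integral>\<^sup>+A. f A \<partial>P)"
  shows "conj_inv P"
  unfolding conj_inv_def
proof (intro allI impI measure_eqI)
  note s[measurable_cong]
  fix V X assume V: "unitary V" and X: "X \<in> sets (distr P borel (\<lambda>A. V ** A ** adj V))"
  then have [measurable]: "X \<in> sets borel" by simp
  have "emeasure (distr P borel (\<lambda>A. V ** A ** adj V)) X = (\<integral>\<^sup>+A. indicator X A \<partial>distr P borel (\<lambda>A. V ** A ** adj V))"
    by simp
  also have "\<dots> = (\<integral>\<^sup>+A. indicator X (V ** A ** adj V) \<partial>P)" by (rule nn_integral_distr) measurable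
  also have "\<dots> = (\<integral>\<^sup>+A. indicator X A \<partial>P)" using V by (rule inv) simp
  also have "\<dots> = emeasure P X" using s by simp
  finally show "emeasure (distr P borel (\<lambda>A. V ** A ** adj V)) X = emeasure P X" .
qed (simp add: s)

definition diag_idx :: "(nat \<Rightarrow> real) \<Rightarrow> 'n::finite cmat" where
  "diag_idx x = diag_mat (\<lambda>i. x (idx i))"

text \<open>The normal form of invariant laws: by \<open>conj_inv_eq_mat_law\<close> every invariant
  law of Hermitian matrices arises in this way from the law of its ranked eigenvalues.
  \<open>R\<close> may also charge unsorted sequences, as it does for independent samples.\<close>

definition mat_law :: "'n::finite cmat measure \<Rightarrow> (nat \<Rightarrow> real) measure \<Rightarrow> 'n cmat measure" where
  "mat_law H R = distr (R \<Otimes>\<^sub>M H) borel (\<lambda>(x, U). U ** diag_idx x ** adj U)"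

lemma measurable_diag_idx [measurable]:
  "diag_idx \<in> measurable (PiM {1..CARD('n::finite)} (\<lambda>_. borel)) (borel :: 'n cmat measure)"
  unfolding diag_idx_def
  by (intro measurable_diag_mat measurable_component_singleton idx_in)

lemma hermitian_diag_idx: "hermitian (diag_idx x)"
  unfolding diag_idx_def by (rule hermitian_diag_mat)

lemma measurable_hermitian [measurable]: "Measurable.pred borel (hermitian :: 'n::finite cmat \<Rightarrow> bool)"
proof -
  have "closed {A :: 'n cmat. hermitian A}"
    unfolding hermitian_def by (intro closed_Collect_eq continuous_intros)
  then have "{A :: 'n cmat. hermitian A} \<in> sets borel" by (rule borel_closed)
  then show ?thesis by (simp add: pred_def)
qed

locale haar_eig = haar H for H :: "'n::finite cmat measure" +
  fixes R :: "(nat \<Rightarrow> real) measure"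
  assumes prob_R: "prob_space R" and sets_R [measurable_cong]: "sets R = sets (PiM {1..CARD('n)} (\<lambda>_. borel))"
begin

sublocale R: prob_space R by (rule prob_R)
sublocale RH: pair_prob_space R H ..

lemma sets_mat_law [measurable_cong, simp]: "sets (mat_law H R) = sets borel"
  by (simp add: mat_law_def)

lemma nn_integral_mat_law:
  assumes [measurable]: "f \<in> borel_measurable borel"
  shows "(\<integral>\<^sup>+A. f A \<partial>mat_law H R) = (\<integral>\<^sup>+x. (\<integral>\<^sup>+U. f (U ** diag_idx x ** adj U) \<partial>H) \<partial>R)"
proof -
  have "(\<integral>\<^sup>+A. f A \<partial>mat_law H R) = (\<integral>\<^sup>+p. f (snd p ** diag_idx (fst p) ** adj (snd p)) \<partial>(R \<Otimes>\<^sub>M H))"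
    unfolding mat_law_def case_prod_beta by (rule nn_integral_distr) measurable
  also have "\<dots> = (\<integral>\<^sup>+x. (\<integral>\<^sup>+U. f (U ** diag_idx x ** adj U) \<partial>H) \<partial>R)"
    by (rule nn_integral_pair) measurable
  finally show ?thesis .
qed

lemma prob_mat_law: "prob_space (mat_law H R)"
  unfolding mat_law_def case_prod_beta by (rule RH.prob_space_distr) measurable

sublocale law: prob_space "mat_law H R" by (rule prob_mat_law)

lemma AE_mat_law_hermitian: "AE A in mat_law H R. hermitian A"
  unfolding mat_law_def case_prod_beta
  by (subst AE_distr_iff) (measurable, auto intro!: hermitian_conj hermitian_diag_idx)

lemma conj_inv_mat_law: "conj_inv (mat_law H R)"
proof (rule conj_invI)
  fix V :: "'n cmat" and f :: "'n cmat \<Rightarrow> ennreal"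
  assume V: "unitary V" and [measurable]: "f \<in> borel_measurable borel"
  have "(\<integral>\<^sup>+A. f (V ** A ** adj V) \<partial>mat_law H R)
     = (\<integral>\<^sup>+x. (\<integral>\<^sup>+U. f ((V ** U) ** diag_idx x ** adj (V ** U)) \<partial>H) \<partial>R)"
    by (subst nn_integral_mat_law) (measurable, simp add: adj_mult matrix_mul_assoc)
  also have "\<dots> = (\<integral>\<^sup>+x. (\<integral>\<^sup>+U. f (U ** diag_idx x ** adj U) \<partial>H) \<partial>R)"
    by (intro nn_integral_cong left_inv[OF V, where f = "\<lambda>U. f (U ** diag_idx _ ** adj U)"]) measurable
  finally show "(\<integral>\<^sup>+A. f (V ** A ** adj V) \<partial>mat_law H R) = (\<integral>\<^sup>+A. f A \<partial>mat_law H R)"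
    by (simp add: nn_integral_mat_law)
qed simp

end

context haar
begin

text \<open>Averaging over \<open>U C U\<^sup>*\<close> replaces any diagonalisation of \<open>C\<close> by a Haar distributed one.\<close>
lemma conj_inv_eq_mat_law:
  assumes P: "prob_space P" "sets P = sets borel" "AE A in P. hermitian A" "conj_inv P"
  shows "P = mat_law H (distr P (PiM {1..CARD('n)} (\<lambda>_. borel)) eig_desc)" (is "P = mat_law H ?R")
proof -
  interpret P: prob_space P by (rule P)
  note P(2)[measurable_cong]
  have [measurable]: "eig_desc \<in> measurable P (PiM {1..CARD('n)} (\<lambda>_. borel))"
    using measurable_eig_desc P(2) by (simp cong: measurable_cong_sets)
  interpret R: haar_eig H ?R
    by (intro haar_eig.intro haar_axioms haar_eig_axioms.intro P.prob_space_distr) measurable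
  interpret HP: pair_prob_space P H ..
  have "emeasure P X = emeasure (mat_law H ?R) X" if "X \<in> sets P" for X
  proof -
    have X[measurable]: "X \<in> sets borel" using that P(2) by simp
    let ?f = "indicator X :: 'n cmat \<Rightarrow> ennreal"
    have "emeasure P X = (\<integral>\<^sup>+A. ?f A \<partial>P)" using that by simp
    also have "\<dots> = (\<integral>\<^sup>+U. (\<integral>\<^sup>+A. ?f (U ** A ** adj U) \<partial>P) \<partial>H)"
    proof -
      have "(\<integral>\<^sup>+U. (\<integral>\<^sup>+A. ?f (U ** A ** adj U) \<partial>P) \<partial>H) = (\<integral>\<^sup>+U. (\<integral>\<^sup>+A. ?f A \<partial>P) \<partial>H)"
        using AE_unitary
        by (intro nn_integral_cong_AE, elim eventually_mono) (rule nn_integral_conj_inv[OF P(4,2)], auto)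
      then show ?thesis by simp
    qed
    also have "\<dots> = (\<integral>\<^sup>+A. (\<integral>\<^sup>+U. ?f (U ** A ** adj U) \<partial>H) \<partial>P)"
      by (rule HP.Fubini') measurable
    also have "\<dots> = (\<integral>\<^sup>+A. (\<integral>\<^sup>+U. ?f (U ** diag_idx (eig_desc A) ** adj U) \<partial>H) \<partial>P)"
      using P(3)
    proof (intro nn_integral_cong_AE, elim eventually_mono)
      fix A :: "'n cmat" assume "hermitian A"
      then obtain V where V: "unitary V" "A = V ** diag_idx (eig_desc A) ** adj V"
        using spectral_sorted unfolding diag_idx_def by blast
      have "(\<integral>\<^sup>+U. ?f (U ** A ** adj U) \<partial>H)
          = (\<integral>\<^sup>+U. ?f ((U ** V) ** diag_idx (eig_desc A) ** adj (U ** V)) \<partial>H)"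
        by (subst V(2)) (simp add: adj_mult matrix_mul_assoc)
      also have "\<dots> = (\<integral>\<^sup>+U. ?f (U ** diag_idx (eig_desc A) ** adj U) \<partial>H)"
        by (rule right_inv[OF V(1), where f = "\<lambda>U. ?f (U ** diag_idx (eig_desc A) ** adj U)"]) measurable
      finally show "(\<integral>\<^sup>+U. ?f (U ** A ** adj U) \<partial>H) = (\<integral>\<^sup>+U. ?f (U ** diag_idx (eig_desc A) ** adj U) \<partial>H)" .
    qed
    also have "\<dots> = (\<integral>\<^sup>+x. (\<integral>\<^sup>+U. ?f (U ** diag_idx x ** adj U) \<partial>H) \<partial>?R)"
      by (rule nn_integral_distr[symmetric]) measurable
    also have "\<dots> = (\<integral>\<^sup>+A. ?f A \<partial>mat_law H ?R)"
      by (rule R.nn_integral_mat_law[symmetric]) measurable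
    also have "\<dots> = emeasure (mat_law H ?R) X"
      by (rule nn_integral_indicator) (simp only: R.sets_mat_law X)
    finally show ?thesis .
  qed
  then show ?thesis by (intro measure_eqI) (simp_all only: P(2) R.sets_mat_law)
qed

end

context haar_eig
begin

text \<open>For fixed \<open>A\<close> and \<open>x\<close>, general position makes each count of
  the supremum almost surely the truncated sum of the two counts. The truncation does not matter
  because \<open>r i \<le> CARD('n)\<close>, and truncated subtraction is correct: if the samples
  alone reach \<open>r i\<close>, the new threshold is 0 and the event impossible.\<close>

lemma hsup_mat_law:
  assumes P: "prob_space P" "sets P = sets borel" "AE A in P. hermitian A"
    and I: "finite I" "\<And>i. i \<in> I \<Longrightarrow> r i \<le> CARD('n)"
  shows "emeasure (distr (P \<Otimes>\<^sub>M mat_law H R) borel (\<lambda>(A, B). hsup A B)) {A. \<forall>i\<in>I. cnt A (t i) < r i}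
    = (\<integral>\<^sup>+x. emeasure P {A. \<forall>i\<in>I. cnt A (t i) < r i - card {j\<in>{1..CARD('n)}. t i < x j}} \<partial>R)"
proof -
  interpret P: prob_space P by (rule P)
  interpret PR: pair_prob_space P R ..
  note P(2)[measurable_cong]
  note countable_finite[OF I(1)]
  note [measurable] = measurable_compose[OF _ measurable_cnt]
  let ?E = "{A :: 'n cmat. \<forall>i\<in>I. cnt A (t i) < r i}"
  let ?c = "\<lambda>x i. card {j\<in>{1..CARD('n)}. t i < x j}"
  have E[measurable]: "?E \<in> sets borel"
  proof -
    have "{A \<in> space borel. \<forall>i\<in>I. cnt (A :: 'n cmat) (t i) < r i} \<in> sets borel"
      using \<open>countable I\<close> by measurable
    then show ?thesis by simp
  qed
  have cm[measurable]: "(\<lambda>x. ?c x i) \<in> measurable (PiM {1..CARD('n)} (\<lambda>_. borel)) (count_space UNIV)" for i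
  proof -
    have eq: "?c x i = (\<Sum>j\<in>{1..CARD('n)}. if t i < x j then 1 else 0)" for x :: "nat \<Rightarrow> real"
      by (simp add: sum.If_cases Int_def)
    show ?thesis unfolding eq by measurable
  qed
  have "emeasure (distr (P \<Otimes>\<^sub>M mat_law H R) borel (\<lambda>(A, B). hsup A B)) ?E
    = (\<integral>\<^sup>+C. indicator ?E C \<partial>distr (P \<Otimes>\<^sub>M mat_law H R) borel (\<lambda>(A, B). hsup A B))"
    by simp
  also have "\<dots> = (\<integral>\<^sup>+p. indicator ?E (hsup (fst p) (snd p)) \<partial>(P \<Otimes>\<^sub>M mat_law H R))"
    unfolding case_prod_beta by (rule nn_integral_distr) measurable
  also have "\<dots> = (\<integral>\<^sup>+A. (\<integral>\<^sup>+B. indicator ?E (hsup A B) \<partial>mat_law H R) \<partial>P)"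
    by (rule law.nn_integral_pair) measurable
  also have "\<dots> = (\<integral>\<^sup>+A. (\<integral>\<^sup>+x. (\<integral>\<^sup>+U. indicator ?E (hsup A (U ** diag_idx x ** adj U)) \<partial>H) \<partial>R) \<partial>P)"
    by (intro nn_integral_cong nn_integral_mat_law) measurable
  also have "\<dots> = (\<integral>\<^sup>+A. (\<integral>\<^sup>+x. indicator {A. \<forall>i\<in>I. cnt A (t i) < r i - ?c x i} A \<partial>R) \<partial>P)"
    using P(3)
  proof (intro nn_integral_cong_AE, elim eventually_mono)
    fix A :: "'n cmat" assume A: "hermitian A"
    show "(\<integral>\<^sup>+x. (\<integral>\<^sup>+U. indicator ?E (hsup A (U ** diag_idx x ** adj U)) \<partial>H) \<partial>R)
      = (\<integral>\<^sup>+x. indicator {A. \<forall>i\<in>I. cnt A (t i) < r i - ?c x i} A \<partial>R)"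
    proof (rule nn_integral_cong)
      fix x :: "nat \<Rightarrow> real"
      have "AE U in H. \<forall>i\<in>I. cnt (hsup A (U ** diag_idx x ** adj U)) (t i) = min CARD('n) (cnt A (t i) + ?c x i)"
        unfolding diag_idx_def card_idx[symmetric, of "\<lambda>j. t _ < x j", where 'n='n]
        using I(1) by (intro AE_finite_allI AE_cnt_hsup A)
      then have "(\<integral>\<^sup>+U. indicator ?E (hsup A (U ** diag_idx x ** adj U)) \<partial>H)
          = (\<integral>\<^sup>+U. indicator {A. \<forall>i\<in>I. cnt A (t i) < r i - ?c x i} A \<partial>H)"
      proof (intro nn_integral_cong_AE, elim eventually_mono)
        fix U :: "'n cmat"
        assume eq: "\<forall>i\<in>I. cnt (hsup A (U ** diag_idx x ** adj U)) (t i) = min CARD('n) (cnt A (t i) + ?c x i)"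
        have "(\<forall>i\<in>I. cnt (hsup A (U ** diag_idx x ** adj U)) (t i) < r i) \<longleftrightarrow> (\<forall>i\<in>I. cnt A (t i) < r i - ?c x i)"
        proof (intro ball_cong refl)
          fix i assume i: "i \<in> I"
          have "min N (a + c) < r \<longleftrightarrow> a < r - c" if "r \<le> N" for N a c r :: nat using that by auto
          from this[OF I(2)[OF i]] show "cnt (hsup A (U ** diag_idx x ** adj U)) (t i) < r i \<longleftrightarrow> cnt A (t i) < r i - ?c x i"
            using eq i by simp
        qed
        then show "indicator ?E (hsup A (U ** diag_idx x ** adj U)) = (indicator {A. \<forall>i\<in>I. cnt A (t i) < r i - ?c x i} A :: ennreal)"
          by (simp add: indicator_def)
      qed
      then show "(\<integral>\<^sup>+U. indicator ?E (hsup A (U ** diag_idx x ** adj U)) \<partial>H)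
        = indicator {A. \<forall>i\<in>I. cnt A (t i) < r i - ?c x i} A" by simp
    qed
  qed
  also have "\<dots> = (\<integral>\<^sup>+x. (\<integral>\<^sup>+A. indicator {A. \<forall>i\<in>I. cnt A (t i) < r i - ?c x i} A \<partial>P) \<partial>R)"
  proof (rule PR.Fubini'[symmetric])
    have "{p \<in> space (P \<Otimes>\<^sub>M R). \<forall>i\<in>I. cnt (fst p) (t i) < r i - ?c (snd p) i} \<in> sets (P \<Otimes>\<^sub>M R)"
    proof (rule sets.sets_Collect_finite_All[OF _ I(1)])
      fix i
      have c: "(\<lambda>p. ?c (snd p) i) \<in> measurable (P \<Otimes>\<^sub>M R) (count_space UNIV)"
        by (rule measurable_compose[OF _ cm]) measurable
      have "(\<lambda>p. r i - ?c (snd p) i) \<in> borel_measurable (P \<Otimes>\<^sub>M R)"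
        by (rule measurable_compose[OF c]) simp
      moreover have c': "(\<lambda>p. cnt (fst p) (t i)) \<in> measurable (P \<Otimes>\<^sub>M R) (count_space UNIV)"
        by (rule measurable_compose[OF _ measurable_cnt]) measurable
      have "(\<lambda>p. cnt (fst p) (t i)) \<in> borel_measurable (P \<Otimes>\<^sub>M R)"
        by (rule measurable_compose[OF c']) simp
      ultimately show "{p \<in> space (P \<Otimes>\<^sub>M R). cnt (fst p) (t i) < r i - ?c (snd p) i} \<in> sets (P \<Otimes>\<^sub>M R)"
        by (intro borel_measurable_less)
    qed
    then have "(\<lambda>p. indicator {p \<in> space (P \<Otimes>\<^sub>M R). \<forall>i\<in>I. cnt (fst p) (t i) < r i - ?c (snd p) i} p :: ennreal) \<in> borel_measurable (P \<Otimes>\<^sub>M R)"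
      by (rule borel_measurable_indicator)
    moreover have "indicator {p \<in> space (P \<Otimes>\<^sub>M R). \<forall>i\<in>I. cnt (fst p) (t i) < r i - ?c (snd p) i} p
       = (indicator {A. \<forall>i\<in>I. cnt A (t i) < r i - ?c (snd p) i} (fst p) :: ennreal)" if "p \<in> space (P \<Otimes>\<^sub>M R)" for p
      using that by (simp add: indicator_def)
    ultimately show "(\<lambda>(A, x). indicator {A. \<forall>i\<in>I. cnt A (t i) < r i - ?c x i} A :: ennreal) \<in> borel_measurable (P \<Otimes>\<^sub>M R)"
      unfolding case_prod_beta by (simp cong: measurable_cong)
  qed
  also have "\<dots> = (\<integral>\<^sup>+x. emeasure P {A. \<forall>i\<in>I. cnt A (t i) < r i - ?c x i} \<partial>R)"
  proof (rule nn_integral_cong)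
    fix x :: "nat \<Rightarrow> real"
    have "{A \<in> space borel. \<forall>i\<in>I. cnt (A :: 'n cmat) (t i) < r i - ?c x i} \<in> sets borel"
      using \<open>countable I\<close> by measurable
    then show "(\<integral>\<^sup>+A. indicator {A. \<forall>i\<in>I. cnt A (t i) < r i - ?c x i} A \<partial>P)
      = emeasure P {A. \<forall>i\<in>I. cnt A (t i) < r i - ?c x i}" using P(2) by simp
  qed
  finally show ?thesis .
qed

text \<open>\<open>hsup\<close> commutes with simultaneous conjugation, and by independence the
  conjugation can then be removed from one argument at a time.\<close>

lemma conj_inv_hsup:
  assumes P: "prob_space P" "sets P = sets borel" "conj_inv P"
  shows "conj_inv (distr (P \<Otimes>\<^sub>M mat_law H R) borel (\<lambda>(A, B). hsup A B))"
proof (rule conj_invI)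
  interpret P: prob_space P by (rule P)
  interpret PR: pair_prob_space P "mat_law H R" ..
  note P(2)[measurable_cong]
  have nn: "(\<integral>\<^sup>+C. f C \<partial>distr (P \<Otimes>\<^sub>M mat_law H R) borel (\<lambda>(A, B). hsup A B))
    = (\<integral>\<^sup>+A. (\<integral>\<^sup>+B. f (hsup A B) \<partial>mat_law H R) \<partial>P)" if [measurable]: "f \<in> borel_measurable borel" for f
  proof -
    have "(\<integral>\<^sup>+C. f C \<partial>distr (P \<Otimes>\<^sub>M mat_law H R) borel (\<lambda>(A, B). hsup A B))
      = (\<integral>\<^sup>+p. f (hsup (fst p) (snd p)) \<partial>(P \<Otimes>\<^sub>M mat_law H R))"
      unfolding case_prod_beta by (rule nn_integral_distr) measurable
    also have "\<dots> = (\<integral>\<^sup>+A. (\<integral>\<^sup>+B. f (hsup A B) \<partial>mat_law H R) \<partial>P)"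
      by (rule law.nn_integral_pair) measurable
    finally show ?thesis .
  qed
  fix V :: "'n cmat" and f :: "'n cmat \<Rightarrow> ennreal"
  assume V: "unitary V" and f[measurable]: "f \<in> borel_measurable borel"
  have "(\<integral>\<^sup>+A. (\<integral>\<^sup>+B. f (V ** hsup A B ** adj V) \<partial>mat_law H R) \<partial>P)
      = (\<integral>\<^sup>+A. (\<integral>\<^sup>+B. f (hsup (V ** A ** adj V) (V ** B ** adj V)) \<partial>mat_law H R) \<partial>P)"
    by (simp only: hsup_conj[OF V])
  also have "\<dots> = (\<integral>\<^sup>+A. (\<integral>\<^sup>+B. f (hsup (V ** A ** adj V) B) \<partial>mat_law H R) \<partial>P)"
    by (intro nn_integral_cong nn_integral_conj_inv[OF conj_inv_mat_law _ V, where f = "\<lambda>B. f (hsup _ B)"])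
      measurable
  also have "\<dots> = (\<integral>\<^sup>+A. (\<integral>\<^sup>+B. f (hsup A B) \<partial>mat_law H R) \<partial>P)"
    by (rule nn_integral_conj_inv[OF P(3,2) V, where f = "\<lambda>A. \<integral>\<^sup>+B. f (hsup A B) \<partial>mat_law H R"]) measurable
  finally show "(\<integral>\<^sup>+C. f (V ** C ** adj V) \<partial>distr (P \<Otimes>\<^sub>M mat_law H R) borel (\<lambda>(A, B). hsup A B))
    = (\<integral>\<^sup>+C. f C \<partial>distr (P \<Otimes>\<^sub>M mat_law H R) borel (\<lambda>(A, B). hsup A B))"
    by (simp add: nn)
qed simp

end

section \<open>Order statistics\<close>

lemma measurable_card_gt:
  fixes f :: "'a \<Rightarrow> 'b \<Rightarrow> real"
  assumes J: "finite J" and [measurable]: "\<And>j. j \<in> J \<Longrightarrow> (\<lambda>z. f z j) \<in> borel_measurable M"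
  shows "(\<lambda>z. card {j\<in>J. s < f z j}) \<in> borel_measurable M"
proof -
  have eq: "card {j\<in>J. s < f z j} = (\<Sum>j\<in>J. if s < f z j then 1 else 0)" for z
    using J by (simp add: sum.If_cases Int_def)
  show ?thesis unfolding eq by measurable
qed

lemma sets_card_gt:
  fixes f :: "'a \<Rightarrow> 'b \<Rightarrow> real"
  assumes J: "finite J" and f: "\<And>j. j \<in> J \<Longrightarrow> (\<lambda>z. f z j) \<in> borel_measurable M" and I: "finite I"
  shows "{z \<in> space M. \<forall>i\<in>I. card {j\<in>J. t i < f z j} < r i} \<in> sets M"
  by (intro sets.sets_Collect_finite_All I borel_measurable_less measurable_card_gt J f) auto

lemma sets_cnt_lt: "finite I \<Longrightarrow> {A :: 'n::finite cmat. \<forall>i\<in>I. cnt A (t i) < r i} \<in> sets borel"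
proof -
  assume I: "finite I"
  have "{A \<in> space borel. \<forall>i\<in>I. cnt (A :: 'n cmat) (t i) < r i} \<in> sets borel"
    by (intro sets.sets_Collect_finite_All I borel_measurable_less measurable_compose[OF measurable_cnt]) auto
  then show ?thesis by simp
qed

lemma card_bij_Collect:
  assumes "bij_betw h K J"
  shows "card {n\<in>K. P (h n)} = card {j\<in>J. P j}"
proof -
  have "h ` {n\<in>K. P (h n)} = {j\<in>J. P j}" "inj_on h {n\<in>K. P (h n)}"
    using assms by (auto simp: bij_betw_def intro: inj_on_subset)
  then show ?thesis by (metis card_image)
qed

text \<open>The counterpart, for independent samples, of the events \<open>cnt A (t i) < r i\<close>
  for matrices. The index set is left free so that blocks of samples can be joined and
  renamed.\<close>

definition cprob :: "real measure \<Rightarrow> 'a set \<Rightarrow> nat set \<Rightarrow> (nat \<Rightarrow> real) \<Rightarrow> (nat \<Rightarrow> nat) \<Rightarrow> ennreal" where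
  "cprob \<kappa> J I t r = emeasure (PiM J (\<lambda>_. \<kappa>)) {x \<in> space (PiM J (\<lambda>_. \<kappa>)). \<forall>i\<in>I. card {j\<in>J. t i < x j} < r i}"

context
  fixes \<kappa> :: "real measure"
  assumes \<kappa>: "prob_space \<kappa>" and sets_\<kappa>: "sets \<kappa> = sets borel"
begin

interpretation \<kappa>: prob_space \<kappa> by (rule \<kappa>)
lemma product_sigma_finite_law: "product_sigma_finite (\<lambda>_. \<kappa>)"
  by unfold_locales

lemma sets_PiM_law: "sets (PiM J (\<lambda>_. \<kappa>)) = sets (PiM J (\<lambda>_. borel))"
  by (intro sets_PiM_cong) (auto simp: sets_\<kappa>)

lemma measurable_PiM_component: "j \<in> J \<Longrightarrow> (\<lambda>x. x j) \<in> borel_measurable (PiM J (\<lambda>_. \<kappa>))"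
  using measurable_component_singleton[of j J "\<lambda>_. \<kappa>"] by (simp cong: measurable_cong_sets add: sets_\<kappa>)

lemma prob_space_PiM_law: "prob_space (PiM J (\<lambda>_. \<kappa>))"
  by (intro prob_space_PiM \<kappa>)

lemma cprob_card_eq:
  fixes I :: "nat set" and J :: "'a set" and K :: "'b set"
  assumes "finite J" "finite K" "card J = card K" and I: "finite I"
  shows "cprob \<kappa> J I t r = cprob \<kappa> K I t r"
proof -
  obtain h where h: "bij_betw h K J" using finite_same_card_bij[OF assms(2,1)] assms(3) by metis
  then have h': "inj_on h K" "h \<in> K \<rightarrow> J" by (auto simp: bij_betw_def)
  have d: "distr (PiM J (\<lambda>_. \<kappa>)) (PiM K (\<lambda>_. \<kappa>)) (\<lambda>\<omega>. \<lambda>n\<in>K. \<omega> (h n)) = PiM K (\<lambda>_. \<kappa>)"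
    by (rule distr_PiM_reindex[OF \<kappa> h'])
  have m: "(\<lambda>\<omega>. \<lambda>n\<in>K. \<omega> (h n)) \<in> measurable (PiM J (\<lambda>_. \<kappa>)) (PiM K (\<lambda>_. \<kappa>))"
    using h'(2) by (intro measurable_restrict measurable_component_singleton) auto
  let ?X = "{x \<in> space (PiM K (\<lambda>_. \<kappa>)). \<forall>i\<in>I. card {j\<in>K. t i < x j} < r i}"
  have X: "?X \<in> sets (PiM K (\<lambda>_. \<kappa>))"
    by (intro sets_card_gt assms measurable_PiM_component)
  have "cprob \<kappa> K I t r = emeasure (distr (PiM J (\<lambda>_. \<kappa>)) (PiM K (\<lambda>_. \<kappa>)) (\<lambda>\<omega>. \<lambda>n\<in>K. \<omega> (h n))) ?X"
    unfolding cprob_def d ..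
  also have "\<dots> = emeasure (PiM J (\<lambda>_. \<kappa>)) ((\<lambda>\<omega>. \<lambda>n\<in>K. \<omega> (h n)) -` ?X \<inter> space (PiM J (\<lambda>_. \<kappa>)))"
    by (rule emeasure_distr[OF m X])
  also have "(\<lambda>\<omega>. \<lambda>n\<in>K. \<omega> (h n)) -` ?X \<inter> space (PiM J (\<lambda>_. \<kappa>))
      = {x \<in> space (PiM J (\<lambda>_. \<kappa>)). \<forall>i\<in>I. card {j\<in>J. t i < x j} < r i}"
  proof -
    have "card {j\<in>K. t i < (\<lambda>n\<in>K. \<omega> (h n)) j} = card {j\<in>J. t i < \<omega> j}" for i \<omega>
      using card_bij_Collect[OF h, of "\<lambda>j. t i < \<omega> j"] by (simp cong: conj_cong)
    then show ?thesis using measurable_space[OF m] by auto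
  qed
  finally show ?thesis by (simp add: cprob_def)
qed

text \<open>Counts over disjoint blocks add. Conditioning on the block \<open>K\<close> lowers the
  thresholds exactly as in \<open>hsup_mat_law\<close>, so taking a supremum with an independent
  matrix amounts to appending its block of samples.\<close>

lemma cprob_Un:
  fixes I :: "nat set" and J :: "'a set"
  assumes J: "finite J" "finite K" "J \<inter> K = {}" and I: "finite I"
  shows "cprob \<kappa> (J \<union> K) I t r = (\<integral>\<^sup>+x. cprob \<kappa> J I t (\<lambda>i. r i - card {j\<in>K. t i < x j}) \<partial>PiM K (\<lambda>_. \<kappa>))"
proof -
  interpret product_sigma_finite "\<lambda>_ :: 'a. \<kappa>" by (rule product_sigma_finite_law)
  have KJ: "K \<union> J = J \<union> K" "K \<inter> J = {}" using J by auto
  let ?X = "{x \<in> space (PiM (J \<union> K) (\<lambda>_. \<kappa>)). \<forall>i\<in>I. card {j\<in>J \<union> K. t i < x j} < r i}"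
  have X: "?X \<in> sets (PiM (J \<union> K) (\<lambda>_. \<kappa>))"
    using J by (intro sets_card_gt I measurable_PiM_component) auto
  have "cprob \<kappa> (J \<union> K) I t r = (\<integral>\<^sup>+x. indicator ?X x \<partial>PiM (K \<union> J) (\<lambda>_. \<kappa>))"
    unfolding cprob_def KJ(1) using X by simp
  also have "\<dots> = (\<integral>\<^sup>+x. (\<integral>\<^sup>+y. indicator ?X (merge K J (x, y)) \<partial>PiM J (\<lambda>_. \<kappa>)) \<partial>PiM K (\<lambda>_. \<kappa>))"
    using X J by (intro product_nn_integral_fold) (auto simp: KJ)
  also have "\<dots> = (\<integral>\<^sup>+x. cprob \<kappa> J I t (\<lambda>i. r i - card {j\<in>K. t i < x j}) \<partial>PiM K (\<lambda>_. \<kappa>))"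
  proof (rule nn_integral_cong)
    fix x assume x: "x \<in> space (PiM K (\<lambda>_. \<kappa>))"
    let ?Y = "{y \<in> space (PiM J (\<lambda>_. \<kappa>)). \<forall>i\<in>I. card {j\<in>J. t i < y j} < r i - card {j\<in>K. t i < x j}}"
    have Y: "?Y \<in> sets (PiM J (\<lambda>_. \<kappa>))"
      by (intro sets_card_gt I J measurable_PiM_component)
    have "(\<integral>\<^sup>+y. indicator ?X (merge K J (x, y)) \<partial>PiM J (\<lambda>_. \<kappa>)) = (\<integral>\<^sup>+y. indicator ?Y y \<partial>PiM J (\<lambda>_. \<kappa>))"
    proof (rule nn_integral_cong)
      fix y assume y: "y \<in> space (PiM J (\<lambda>_. \<kappa>))"
      have sp: "merge K J (x, y) \<in> space (PiM (J \<union> K) (\<lambda>_. \<kappa>))"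
        using x y by (auto simp: space_PiM PiE_def sets_eq_imp_space_eq[OF sets_\<kappa>] extensional_def merge_def)
      have "card {j\<in>J \<union> K. t i < merge K J (x, y) j} = card {j\<in>J. t i < y j} + card {j\<in>K. t i < x j}" for i
      proof -
        have "{j\<in>J \<union> K. t i < merge K J (x, y) j} = {j\<in>J. t i < y j} \<union> {j\<in>K. t i < x j}"
          using KJ by (auto simp: merge_def)
        moreover have "card ({j\<in>J. t i < y j} \<union> {j\<in>K. t i < x j}) = card {j\<in>J. t i < y j} + card {j\<in>K. t i < x j}"
          using J by (intro card_Un_disjoint) auto
        ultimately show ?thesis by simp
      qed
      then show "indicator ?X (merge K J (x, y)) = (indicator ?Y y :: ennreal)"
        using sp y by (auto simp: indicator_def less_diff_conv)
    qed
    then show "(\<integral>\<^sup>+y. indicator ?X (merge K J (x, y)) \<partial>PiM J (\<lambda>_. \<kappa>))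
       = cprob \<kappa> J I t (\<lambda>i. r i - card {j\<in>K. t i < x j})"
      unfolding cprob_def using Y by simp
  qed
  finally show ?thesis .
qed

text \<open>With all coordinates but \<open>i\<close> fixed, a tie between \<open>i\<close> and
  \<open>j\<close> confines coordinate \<open>i\<close> to a single point, which has measure
  zero.\<close>

lemma AE_inj_PiM:
  fixes J :: "'a set"
  assumes atomless: "\<And>a. emeasure \<kappa> {a} = 0" and J: "finite J"
  shows "AE x in PiM J (\<lambda>_. \<kappa>). inj_on x J"
proof -
  interpret product_sigma_finite "\<lambda>_ :: 'a. \<kappa>" by (rule product_sigma_finite_law)
  have "AE x in PiM J (\<lambda>_. \<kappa>). x i \<noteq> x j" if ij: "i \<in> J" "j \<in> J" "i \<noteq> j" for i j
  proof -
    define K where "K = J - {i}"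
    have K: "J = insert i K" "i \<notin> K" "finite K" "j \<in> K" using ij J by (auto simp: K_def)
    note [measurable] = measurable_PiM_component[OF ij(1)] measurable_PiM_component[OF ij(2)]
    let ?X = "{x \<in> space (PiM J (\<lambda>_. \<kappa>)). x i = x j}"
    have X: "?X \<in> sets (PiM J (\<lambda>_. \<kappa>))" by measurable
    have "emeasure (PiM J (\<lambda>_. \<kappa>)) ?X = (\<integral>\<^sup>+x. indicator ?X x \<partial>PiM (insert i K) (\<lambda>_. \<kappa>))"
      using X by (simp flip: K(1))
    also have "\<dots> = (\<integral>\<^sup>+x. (\<integral>\<^sup>+y. indicator ?X (x(i := y)) \<partial>\<kappa>) \<partial>PiM K (\<lambda>_. \<kappa>))"
      using X K by (intro product_nn_integral_insert) auto
    also have "\<dots> \<le> (\<integral>\<^sup>+x. (\<integral>\<^sup>+y. indicator {x j} y \<partial>\<kappa>) \<partial>PiM K (\<lambda>_. \<kappa>))"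
      using ij(3) by (intro nn_integral_mono) (auto simp: indicator_def)
    also have "\<dots> = 0" using atomless by (simp add: sets_\<kappa>)
    finally have "emeasure (PiM J (\<lambda>_. \<kappa>)) ?X = 0" by simp
    then show ?thesis using X by (intro AE_I[of _ _ ?X]) auto
  qed
  then have "AE x in PiM J (\<lambda>_. \<kappa>). \<forall>i\<in>J. \<forall>j\<in>J. i \<noteq> j \<longrightarrow> x i \<noteq> x j"
    using J by (intro AE_finite_allI) (auto intro: AE_I2)
  then show ?thesis by eventually_elim (auto simp: inj_on_def)
qed

end

text \<open>Ranks are counted from 1, positions in lists from 0.\<close>
definition top_list :: "nat \<Rightarrow> 'a set \<Rightarrow> ('a \<Rightarrow> real) \<Rightarrow> 'a list \<Rightarrow> bool" where
  "top_list N J x xs \<longleftrightarrow> (\<forall>i\<in>{1..<N}. x (xs ! i) \<le> x (xs ! (i - 1))) \<and> (\<forall>j\<in>J - set xs. x j \<le> x (xs ! (N - 1)))"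

lemma antitone_Suc:
  fixes f :: "nat \<Rightarrow> real"
  assumes "\<And>i. i \<in> {1..<N} \<Longrightarrow> f i \<le> f (i - 1)" "i \<le> j" "j < N"
  shows "f j \<le> f i"
  using assms(2,3)
proof (induction j rule: dec_induct)
  case (step n)
  then show ?case using assms(1)[of "Suc n"] by simp
qed simp

context
  fixes J :: "'a::linorder set" and x :: "'a \<Rightarrow> real" and N :: nat
  assumes J: "finite J" "N \<le> card J" "N \<ge> 1" and inj: "inj_on x J"
begin

lemma top_list_above:
  assumes xs: "length xs = N" "distinct xs" "set xs \<subseteq> J" "top_list N J x xs" and n: "n < N"
  shows "{j\<in>J. x (xs ! n) < x j} = set (take n xs)"
proof -
  have mono: "x (xs ! j) \<le> x (xs ! i)" if "i \<le> j" "j < N" for i j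
  proof (rule antitone_Suc[of N "\<lambda>i. x (xs ! i)", OF _ that])
    show "x (xs ! i) \<le> x (xs ! (i - 1))" if "i \<in> {1..<N}" for i
      using xs(4) that unfolding top_list_def by blast
  qed
  show ?thesis
  proof (intro set_eqI iffI)
    fix j assume j: "j \<in> {j\<in>J. x (xs ! n) < x j}"
    have "j \<in> set xs"
    proof (rule ccontr)
      assume "j \<notin> set xs"
      then have "x j \<le> x (xs ! (N - 1))" using xs(4) j by (auto simp: top_list_def)
      also have "\<dots> \<le> x (xs ! n)" using n by (intro mono) auto
      finally show False using j by simp
    qed
    then obtain i where i: "i < N" "j = xs ! i" using xs(1) by (auto simp: in_set_conv_nth)
    then have "i < n" using mono[of n i] j n by (cases "i < n") auto
    then show "j \<in> set (take n xs)" using i xs(1) by (auto simp: in_set_conv_nth)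
  next
    fix j assume "j \<in> set (take n xs)"
    then obtain i where i: "i < n" "j = xs ! i" using n xs(1) by (auto simp: in_set_conv_nth)
    have "x (xs ! n) \<le> x j" unfolding i(2) using i(1) n by (intro mono) auto
    moreover have "j \<noteq> xs ! n" using i n xs(1,2) by (simp add: nth_eq_iff_index_eq)
    moreover have "j \<in> J" "xs ! n \<in> J" using i n xs(1,3) by auto
    moreover from calculation have "x (xs ! n) \<noteq> x j" using inj_onD[OF inj] by metis
    ultimately show "j \<in> {j\<in>J. x (xs ! n) < x j}" by simp
  qed
qed

lemma top_list_rank:
  assumes xs: "length xs = N" "distinct xs" "set xs \<subseteq> J" "top_list N J x xs" and n: "n < N"
  shows "card {j\<in>J. x (xs ! n) < x j} = n"
  using assms by (simp add: top_list_above distinct_card)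

lemma rank_inj:
  assumes "i \<in> J" "j \<in> J" "card {k\<in>J. x i < x k} = card {k\<in>J. x j < x k}"
  shows "i = j"
proof -
  have "card {k\<in>J. x j < x k} < card {k\<in>J. x i < x k}" if "i \<in> J" "j \<in> J" "x i < x j" for i j
    using that J(1) by (intro psubset_card_mono) auto
  from this[of i j] this[of j i] show ?thesis using assms inj by (auto simp: inj_on_def) (metis linorder_neqE_linordered_idom)
qed

text \<open>Existence comes from sorting. For uniqueness, the entry at position \<open>n\<close> has
  exactly \<open>n\<close> samples above it, and in the absence of ties this rank identifies the
  sample.\<close>

lemma ex1_top_list: "\<exists>!xs. length xs = N \<and> distinct xs \<and> set xs \<subseteq> J \<and> top_list N J x xs"
proof (rule ex_ex1I)
  define ys where "ys = sort_key (\<lambda>j. - x j) (sorted_list_of_set J)"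
  have ys: "set ys = J" "distinct ys" "sorted (map (\<lambda>j. - x j) ys)" "length ys = card J"
    using J by (simp_all add: ys_def)
  have mono: "x (ys ! j) \<le> x (ys ! i)" if "i \<le> j" "j < card J" for i j
    using sorted_nth_mono[OF ys(3), of i j] that ys(4) by simp
  have "top_list N J x (take N ys)"
    unfolding top_list_def
  proof (intro conjI ballI)
    fix i assume "i \<in> {1..<N}"
    then show "x (take N ys ! i) \<le> x (take N ys ! (i - 1))" using J mono[of "i - 1" i] by auto
  next
    fix j assume j: "j \<in> J - set (take N ys)"
    then obtain i where i: "i < card J" "j = ys ! i" using ys by (auto simp: in_set_conv_nth)
    have "\<not> i < N" using i j ys(4) by (auto simp: in_set_conv_nth)
    then show "x j \<le> x (take N ys ! (N - 1))" using i J mono[of "N - 1" i] by auto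
  qed
  then show "\<exists>xs. length xs = N \<and> distinct xs \<and> set xs \<subseteq> J \<and> top_list N J x xs"
    using ys J by (intro exI[of _ "take N ys"]) (auto dest: in_set_takeD)
next
  fix xs ys
  assume xs: "length xs = N \<and> distinct xs \<and> set xs \<subseteq> J \<and> top_list N J x xs"
    and ys: "length ys = N \<and> distinct ys \<and> set ys \<subseteq> J \<and> top_list N J x ys"
  show "xs = ys"
  proof (rule nth_equalityI)
    fix n assume n: "n < length xs"
    show "xs ! n = ys ! n"
    proof (rule rank_inj)
      show "card {k\<in>J. x (xs ! n) < x k} = card {k\<in>J. x (ys ! n) < x k}"
        using xs ys n by (simp add: top_list_rank)
    qed (use xs ys n in \<open>auto dest: nth_mem\<close>)
  qed (use xs ys in simp)
qed

text \<open>The entry at position \<open>i - 1\<close> is the \<open>i\<close>-th largest sample: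
  exactly \<open>i - 1\<close> samples exceed it, so a level has fewer than \<open>i\<close> samples
  above it precisely when it is not below this entry.\<close>

lemma top_list_card_iff:
  assumes xs: "length xs = N" "distinct xs" "set xs \<subseteq> J" "top_list N J x xs" and i: "i \<in> {1..N}"
  shows "card {j\<in>J. p < x j} < i \<longleftrightarrow> x (xs ! (i - 1)) \<le> p"
proof
  have rank: "card {j\<in>J. x (xs ! (i - 1)) < x j} = i - 1" using i by (intro top_list_rank[OF xs]) auto
  have inJ: "xs ! (i - 1) \<in> J"
    using xs(1,3) i by (metis Suc_le_eq Suc_pred atLeastAtMost_iff nth_mem subsetD One_nat_def)
  assume lt: "card {j\<in>J. p < x j} < i"
  show "x (xs ! (i - 1)) \<le> p"
  proof (rule ccontr)
    assume "\<not> x (xs ! (i - 1)) \<le> p"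
    then have "insert (xs ! (i - 1)) {j\<in>J. x (xs ! (i - 1)) < x j} \<subseteq> {j\<in>J. p < x j}" using inJ by auto
    then have "card (insert (xs ! (i - 1)) {j\<in>J. x (xs ! (i - 1)) < x j}) \<le> card {j\<in>J. p < x j}"
      using J(1) by (intro card_mono) auto
    then show False using lt rank J(1) by simp
  qed
next
  have rank: "card {j\<in>J. x (xs ! (i - 1)) < x j} = i - 1" using i by (intro top_list_rank[OF xs]) auto
  assume "x (xs ! (i - 1)) \<le> p"
  then have "card {j\<in>J. p < x j} \<le> card {j\<in>J. x (xs ! (i - 1)) < x j}"
    using J(1) by (intro card_mono) auto
  then show "card {j\<in>J. p < x j} < i" using rank i by auto
qed

text \<open>Exactly one list ranks the top \<open>N\<close> samples, so at most one summand is
  nonzero. This splits the event according to which indices come out on top and in which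
  order.\<close>

lemma indicator_eq_sum_top_list:
  "indicator {x. \<forall>i\<in>{1..N}. card {j\<in>J. p i < x j} < i} x =
    (\<Sum>xs\<in>{xs. length xs = N \<and> distinct xs \<and> set xs \<subseteq> J}.
      of_bool (top_list N J x xs \<and> (\<forall>i\<in>{1..N}. x (xs ! (i - 1)) \<le> p i)) :: ennreal)"
proof -
  let ?T = "{xs. length xs = N \<and> distinct xs \<and> set xs \<subseteq> J}"
  obtain ys where ys: "ys \<in> ?T" "top_list N J x ys" and uniq: "\<And>xs. xs \<in> ?T \<Longrightarrow> top_list N J x xs \<Longrightarrow> xs = ys"
    using ex1_top_list by auto
  have fin: "finite ?T"
    by (rule finite_subset[OF _ finite_lists_length_eq[OF J(1), of N]]) auto
  have "(\<Sum>xs\<in>?T. of_bool (top_list N J x xs \<and> (\<forall>i\<in>{1..N}. x (xs ! (i - 1)) \<le> p i)) :: ennreal)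
    = (\<Sum>xs\<in>?T. if xs = ys then of_bool (\<forall>i\<in>{1..N}. x (ys ! (i - 1)) \<le> p i) else 0)"
  proof (rule sum.cong[OF refl])
    fix xs assume "xs \<in> ?T"
    then have "top_list N J x xs \<longleftrightarrow> xs = ys" using uniq ys(2) by blast
    then show "of_bool (top_list N J x xs \<and> (\<forall>i\<in>{1..N}. x (xs ! (i - 1)) \<le> p i))
        = (if xs = ys then of_bool (\<forall>i\<in>{1..N}. x (ys ! (i - 1)) \<le> p i) else 0 :: ennreal)"
      by (cases "xs = ys") simp_all
  qed
  also have "\<dots> = of_bool (\<forall>i\<in>{1..N}. x (ys ! (i - 1)) \<le> p i)"
    using ys(1) by (simp only: sum.delta[OF fin] if_True)
  also have "(\<forall>i\<in>{1..N}. x (ys ! (i - 1)) \<le> p i) \<longleftrightarrow> (\<forall>i\<in>{1..N}. card {j\<in>J. p i < x j} < i)"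
    using ys by (intro ball_cong refl top_list_card_iff[symmetric]) auto
  finally show ?thesis by (simp add: indicator_def)
qed

end

definition srt :: "nat \<Rightarrow> (nat \<Rightarrow> real) \<Rightarrow> bool" where
  "srt N v \<longleftrightarrow> (\<forall>i\<in>{1..<N}. v (Suc i) \<le> v i)"

lemma borel_measurable_of_bool:
  assumes "{x \<in> space M. P x} \<in> sets M"
  shows "(\<lambda>x. of_bool (P x) :: ennreal) \<in> borel_measurable M"
  using borel_measurable_indicator[OF assms, where 'b = ennreal]
  by (rule measurable_cong[THEN iffD1, rotated]) (auto simp: indicator_def)

lemma borel_measurable_emeasure_atMost:
  fixes \<kappa> :: "real measure"
  assumes "prob_space \<kappa>" "sets \<kappa> = sets borel"
  shows "(\<lambda>a. emeasure \<kappa> {..a}) \<in> borel_measurable borel"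
proof -
  interpret prob_space \<kappa> by (rule assms)
  have "(\<lambda>a. measure \<kappa> {..a}) \<in> borel_measurable borel"
    by (rule borel_measurable_mono) (auto simp: mono_def assms intro!: finite_measure_mono)
  then show ?thesis unfolding emeasure_eq_measure by measurable
qed

lemma sets_srt: "(\<And>i. i \<in> {1..N} \<Longrightarrow> (\<lambda>x. f x i) \<in> borel_measurable M) \<Longrightarrow> {x \<in> space M. srt N (f x)} \<in> sets M"
  unfolding srt_def by (intro sets.sets_Collect_finite_All borel_measurable_le) auto

text \<open>The integer factor counts the possible lists of indices of the top \<open>N\<close> samples, and the power
  is the probability that the remaining samples stay below the last of them.\<close>
lemma order_statistics:
  assumes \<kappa>: "prob_space \<kappa>" and s: "sets \<kappa> = sets borel" and atomless: "\<And>a. emeasure \<kappa> {a} = 0"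
    and J: "finite (J :: 'a::linorder set)" "N \<le> card J" "N \<ge> 1"
  shows "cprob \<kappa> J {1..N} p (\<lambda>i. i) = (\<integral>\<^sup>+v. of_nat (\<Prod>{card J - N + 1..card J}) *
    (of_bool (srt N v \<and> (\<forall>i\<in>{1..N}. v i \<le> p i)) * emeasure \<kappa> {..v N} ^ (card J - N)) \<partial>PiM {1..N} (\<lambda>_. \<kappa>))"
proof -
  interpret product_sigma_finite "\<lambda>_ :: 'a. \<kappa>" by (rule product_sigma_finite_law[OF \<kappa> s])
  note comp = measurable_PiM_component[OF \<kappa> s]
  let ?T = "{xs. length xs = N \<and> distinct xs \<and> set xs \<subseteq> J}"
  let ?f = "\<lambda>xs x. of_bool (top_list N J x xs \<and> (\<forall>i\<in>{1..N}. x (xs ! (i - 1)) \<le> p i)) :: ennreal"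
  define G where "G v = (of_bool (srt N v \<and> (\<forall>i\<in>{1..N}. v i \<le> p i)) * emeasure \<kappa> {..v N} ^ (card J - N) :: ennreal)" for v
  note cdf_meas = borel_measurable_emeasure_atMost[OF \<kappa> s]
  have G_meas: "G \<in> borel_measurable (PiM {1..N} (\<lambda>_. \<kappa>))"
    unfolding G_def using J(3)
    by (intro borel_measurable_times_ennreal borel_measurable_of_bool borel_measurable_power_ennreal sets.sets_Collect_conj sets_srt
        sets.sets_Collect_finite_All borel_measurable_le comp measurable_compose[OF comp cdf_meas]) auto
  have tm: "?f xs \<in> borel_measurable (PiM J (\<lambda>_. \<kappa>))" if "xs \<in> ?T" for xs
  proof -
    have "xs ! i \<in> J" if "i < N" for i using \<open>xs \<in> ?T\<close> that by auto
    then show ?thesis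
      unfolding top_list_def using J
      by (intro borel_measurable_of_bool sets.sets_Collect_conj sets.sets_Collect_finite_All borel_measurable_le comp)
        (auto intro: borel_measurable_const)
  qed
  \<comment> \<open>Each list contributes the same integral: the coordinates outside the list
    integrate to a power of the probability of lying below the last listed value, and the listed
    coordinates are renamed by their rank.\<close>
  have int: "(\<integral>\<^sup>+x. ?f xs x \<partial>PiM J (\<lambda>_. \<kappa>)) = (\<integral>\<^sup>+v. G v \<partial>PiM {1..N} (\<lambda>_. \<kappa>))" if xs: "xs \<in> ?T" for xs
  proof -
    define S where "S = set xs"
    define h where "h i = xs ! (i - 1)" for i
    have S: "finite S" "finite (J - S)" "S \<inter> (J - S) = {}" "S \<union> (J - S) = J" and cS: "card (J - S) = card J - N"
      using J xs by (auto simp: S_def card_Diff_subset distinct_card)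
    have hS: "h i \<in> S" if "i \<in> {1..N}" for i using that xs by (auto simp: h_def S_def)
    have hinj: "inj_on h {1..N}" using xs by (auto simp: inj_on_def h_def nth_eq_iff_index_eq)
    let ?R = "\<lambda>\<omega>. \<lambda>n\<in>{1..N}. \<omega> (h n)"
    have "(\<integral>\<^sup>+x. ?f xs x \<partial>PiM J (\<lambda>_. \<kappa>))
      = (\<integral>\<^sup>+x. (\<integral>\<^sup>+y. ?f xs (merge S (J - S) (x, y)) \<partial>PiM (J - S) (\<lambda>_. \<kappa>)) \<partial>PiM S (\<lambda>_. \<kappa>))"
      using product_nn_integral_fold[OF S(3,1,2), of "?f xs"] tm[OF xs] S(4) by simp
    also have "\<dots> = (\<integral>\<^sup>+x. G (?R x) \<partial>PiM S (\<lambda>_. \<kappa>))"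
    proof (rule nn_integral_cong)
      fix x :: "'a \<Rightarrow> real"
      let ?m = "\<lambda>y :: 'a \<Rightarrow> real. merge S (J - S) (x, y)"
      have mS: "?m y (xs ! i) = x (xs ! i)" if "i < N" for i and y :: "'a \<Rightarrow> real"
        using that xs by (simp add: merge_def S_def)
      have eq: "?f xs (?m y) = of_bool (srt N (?R x) \<and> (\<forall>i\<in>{1..N}. ?R x i \<le> p i)) *
          (\<Prod>j\<in>J - S. indicator {..x (xs ! (N - 1))} (y j))" for y :: "'a \<Rightarrow> real"
      proof -
        have "(\<forall>i\<in>{1..<N}. ?m y (xs ! i) \<le> ?m y (xs ! (i - 1))) \<longleftrightarrow> srt N (?R x)"
          unfolding srt_def by (intro ball_cong refl) (auto simp: mS h_def)
        moreover have "(\<forall>j\<in>J - set xs. ?m y j \<le> ?m y (xs ! (N - 1))) \<longleftrightarrow> (\<forall>j\<in>J - S. y j \<in> {..x (xs ! (N - 1))})"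
        proof -
          have "?m y (xs ! (N - 1)) = x (xs ! (N - 1))" using J(3) by (intro mS) simp
          moreover have "?m y j = y j" if "j \<in> J - S" for j using that by (simp add: merge_def)
          ultimately show ?thesis unfolding S_def[symmetric] by simp
        qed
        moreover have "(\<forall>i\<in>{1..N}. ?m y (xs ! (i - 1)) \<le> p i) \<longleftrightarrow> (\<forall>i\<in>{1..N}. ?R x i \<le> p i)"
          by (intro ball_cong refl) (auto simp: mS h_def)
        moreover have "(\<Prod>j\<in>J - S. indicator {..x (xs ! (N - 1))} (y j)) = (of_bool (\<forall>j\<in>J - S. y j \<in> {..x (xs ! (N - 1))}) :: ennreal)"
          using S(2) by (auto simp: indicator_def prod.neutral intro!: prod_zero)
        ultimately show ?thesis unfolding top_list_def by (simp add: conj_ac del: atMost_iff flip: of_bool_conj)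
      qed
      have "(\<integral>\<^sup>+y. ?f xs (?m y) \<partial>PiM (J - S) (\<lambda>_. \<kappa>)) = of_bool (srt N (?R x) \<and> (\<forall>i\<in>{1..N}. ?R x i \<le> p i)) *
         (\<integral>\<^sup>+y. (\<Prod>j\<in>J - S. indicator {..x (xs ! (N - 1))} (y j)) \<partial>PiM (J - S) (\<lambda>_. \<kappa>))"
        unfolding eq
        by (intro nn_integral_cmult borel_measurable_prod_ennreal measurable_compose[OF comp] borel_measurable_indicator) auto
      also have "(\<integral>\<^sup>+y. (\<Prod>j\<in>J - S. indicator {..x (xs ! (N - 1))} (y j)) \<partial>PiM (J - S) (\<lambda>_. \<kappa>)) = emeasure \<kappa> {..x (xs ! (N - 1))} ^ (card J - N)"
        using S(2) by (subst product_nn_integral_prod) (auto simp: s cS intro!: borel_measurable_indicator)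
      moreover have "?R x N = x (xs ! (N - 1))" using J(3) by (simp add: h_def)
      ultimately show "(\<integral>\<^sup>+y. ?f xs (?m y) \<partial>PiM (J - S) (\<lambda>_. \<kappa>)) = G (?R x)"
        by (simp only: G_def)
    qed
    also have "\<dots> = (\<integral>\<^sup>+v. G v \<partial>distr (PiM S (\<lambda>_. \<kappa>)) (PiM {1..N} (\<lambda>_. \<kappa>)) ?R)"
      using hS G_meas by (intro nn_integral_distr[symmetric] measurable_restrict measurable_component_singleton) auto
    also have "distr (PiM S (\<lambda>_. \<kappa>)) (PiM {1..N} (\<lambda>_. \<kappa>)) ?R = PiM {1..N} (\<lambda>_. \<kappa>)"
      using hinj hS by (intro distr_PiM_reindex \<kappa>) auto
    finally show ?thesis .
  qed
  let ?X = "{x \<in> space (PiM J (\<lambda>_. \<kappa>)). \<forall>i\<in>{1..N}. card {j\<in>J. p i < x j} < i}"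
  have X: "?X \<in> sets (PiM J (\<lambda>_. \<kappa>))" using J by (intro sets_card_gt comp) auto
  have "cprob \<kappa> J {1..N} p (\<lambda>i. i) = (\<integral>\<^sup>+x. indicator ?X x \<partial>PiM J (\<lambda>_. \<kappa>))"
    unfolding cprob_def using X by simp
  also have "\<dots> = (\<integral>\<^sup>+x. (\<Sum>xs\<in>?T. ?f xs x) \<partial>PiM J (\<lambda>_. \<kappa>))"
  proof (rule nn_integral_cong_AE)
    show "AE x in PiM J (\<lambda>_. \<kappa>). indicator ?X x = (\<Sum>xs\<in>?T. ?f xs x)"
      using AE_inj_PiM[OF \<kappa> s atomless J(1)] AE_space
    proof eventually_elim
    case (elim x)
    have "indicator ?X x = (indicator {x. \<forall>i\<in>{1..N}. card {j\<in>J. p i < x j} < i} x :: ennreal)"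
      using elim(2) by (simp add: indicator_def)
    then show ?case using indicator_eq_sum_top_list[OF J elim(1), of p] by simp
    qed
  qed
  also have "\<dots> = (\<Sum>xs\<in>?T. \<integral>\<^sup>+x. ?f xs x \<partial>PiM J (\<lambda>_. \<kappa>))"
    using tm by (intro nn_integral_sum) auto
  also have "\<dots> = of_nat (card ?T) * (\<integral>\<^sup>+v. G v \<partial>PiM {1..N} (\<lambda>_. \<kappa>))"
    using int by simp
  also have "card ?T = \<Prod>{card J - N + 1..card J}"
    using card_lists_distinct_length_eq[OF J(1,2)] by simp
  finally show ?thesis unfolding G_def[symmetric] using G_meas by (simp add: nn_integral_cmult)
qed

section \<open>Iterated suprema and their samples\<close>

definition law_iter :: "'n::finite cmat measure \<Rightarrow> nat \<Rightarrow> 'n cmat measure" where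
  "law_iter M k = distr (PiM {..<k} (\<lambda>_. M)) borel (\<lambda>Ms. hsup_iter Ms k)"

lemma hsup_iter_cong: "(\<And>i. i < k \<Longrightarrow> A i = B i) \<Longrightarrow> hsup_iter A k = hsup_iter B k"
  by (induction A k rule: hsup_iter.induct) auto

lemma measurable_hsup_iter:
  fixes M :: "'n::finite cmat measure"
  assumes "sets M = sets borel" "k \<le> n"
  shows "(\<lambda>Ms. hsup_iter Ms k) \<in> borel_measurable (PiM {..<n} (\<lambda>_. M))"
proof -
  have comp: "(\<lambda>Ms. Ms i) \<in> borel_measurable (PiM {..<n} (\<lambda>_. M))" if "i < n" for i
    using measurable_component_singleton[of i "{..<n}" "\<lambda>_. M"] that assms(1)
    by (simp cong: measurable_cong_sets)
  have "k \<le> n \<Longrightarrow> ?thesis"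
  proof (induction k rule: nat_less_induct)
    case (1 k)
    consider "k = 0" | "k = Suc 0" | j where "k = Suc (Suc j)"
      by (metis not0_implies_Suc)
    then show ?case
    proof cases
      case 3
      then show ?thesis using 1 comp[of "Suc j"] by (auto intro!: measurable_hsup)
    qed (use 1 comp[of 0] in auto)
  qed
  with assms(2) show ?thesis by blast
qed

lemma law_iter_1:
  assumes "prob_space M" "sets M = sets borel"
  shows "law_iter M (Suc 0) = M"
proof -
  have "law_iter M (Suc 0) = distr (PiM {..<Suc 0} (\<lambda>_. M)) M (\<lambda>Ms. Ms 0)"
    unfolding law_iter_def using assms(2) by (intro distr_cong) auto
  also have "\<dots> = M" using assms(1) by (intro distr_PiM_component) auto
  finally show ?thesis .
qed

lemma prob_law_iter:
  assumes "prob_space M" "sets M = sets borel"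
  shows "prob_space (law_iter M k)"
proof -
  interpret prob_space "PiM {..<k} (\<lambda>_. M)" by (intro prob_space_PiM assms)
  show ?thesis unfolding law_iter_def
    by (rule prob_space_distr) (rule measurable_hsup_iter[OF assms(2) order_refl])
qed

lemma sets_law_iter: "sets (law_iter M k) = sets borel"
  by (simp add: law_iter_def)

text \<open>The supremum of the first \<open>Suc k\<close> matrices does not involve coordinate
  \<open>Suc k\<close>, so that coordinate can be integrated separately.\<close>

lemma law_iter_Suc:
  fixes M :: "'n::finite cmat measure"
  assumes M: "prob_space M" "sets M = sets borel"
  shows "law_iter M (Suc (Suc k)) = distr (law_iter M (Suc k) \<Otimes>\<^sub>M M) borel (\<lambda>(A, B). hsup A B)"
proof (rule measure_eqI)
  interpret M: prob_space M by (rule M)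
  interpret product_sigma_finite "\<lambda>_ :: nat. M" by unfold_locales
  note M(2)[measurable_cong] sets_law_iter[measurable_cong]
  fix X assume "X \<in> sets (law_iter M (Suc (Suc k)))"
  then have X[measurable]: "X \<in> sets borel" by (simp add: sets_law_iter)
  let ?f = "indicator X :: 'n cmat \<Rightarrow> ennreal"
  have iter[measurable]: "(\<lambda>Ms. hsup_iter Ms k) \<in> borel_measurable (PiM {..<k} (\<lambda>_. M))" for k
    by (rule measurable_hsup_iter[OF M(2) order_refl])
  have ins: "insert (Suc k) {..<Suc k} = {..<Suc (Suc k)}" by auto
  have "emeasure (law_iter M (Suc (Suc k))) X = (\<integral>\<^sup>+C. ?f C \<partial>law_iter M (Suc (Suc k)))"
    by (simp add: sets_law_iter)
  also have "\<dots> = (\<integral>\<^sup>+Ms. ?f (hsup_iter Ms (Suc (Suc k))) \<partial>PiM {..<Suc (Suc k)} (\<lambda>_. M))"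
    unfolding law_iter_def by (rule nn_integral_distr) measurable
  also have "\<dots> = (\<integral>\<^sup>+x. (\<integral>\<^sup>+y. ?f (hsup_iter (x(Suc k := y)) (Suc (Suc k))) \<partial>M) \<partial>PiM {..<Suc k} (\<lambda>_. M))"
    unfolding ins[symmetric]
  proof (rule product_nn_integral_insert)
    show "(\<lambda>Ms. ?f (hsup_iter Ms (Suc (Suc k)))) \<in> borel_measurable (PiM (insert (Suc k) {..<Suc k}) (\<lambda>_. M))"
      unfolding ins by measurable
  qed auto
  also have "\<dots> = (\<integral>\<^sup>+x. (\<integral>\<^sup>+y. ?f (hsup (hsup_iter x (Suc k)) y) \<partial>M) \<partial>PiM {..<Suc k} (\<lambda>_. M))"
  proof -
    have "hsup_iter (x(Suc k := y)) (Suc k) = hsup_iter x (Suc k)" for x :: "nat \<Rightarrow> 'n cmat" and y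
      by (rule hsup_iter_cong) auto
    then show ?thesis by simp
  qed
  also have "\<dots> = (\<integral>\<^sup>+A. (\<integral>\<^sup>+B. ?f (hsup A B) \<partial>M) \<partial>law_iter M (Suc k))"
    unfolding law_iter_def by (rule nn_integral_distr[symmetric]) measurable
  also have "\<dots> = (\<integral>\<^sup>+p. ?f (hsup (fst p) (snd p)) \<partial>(law_iter M (Suc k) \<Otimes>\<^sub>M M))"
    by (rule M.nn_integral_pair[symmetric]) measurable
  also have "\<dots> = (\<integral>\<^sup>+C. ?f C \<partial>distr (law_iter M (Suc k) \<Otimes>\<^sub>M M) borel (\<lambda>(A, B). hsup A B))"
    unfolding case_prod_beta by (rule nn_integral_distr[symmetric]) measurable
  finally show "emeasure (law_iter M (Suc (Suc k))) X = emeasure (distr (law_iter M (Suc k) \<Otimes>\<^sub>M M) borel (\<lambda>(A, B). hsup A B)) X"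
    by simp
qed (simp add: sets_law_iter)

lemma (in haar_eig) emeasure_mat_law_cnt:
  assumes I: "finite I"
  shows "emeasure (mat_law H R) {A. \<forall>i\<in>I. cnt A (t i) < r i}
    = emeasure R {x \<in> space R. \<forall>i\<in>I. card {j\<in>{1..CARD('n)}. t i < x j} < r i}"
proof -
  let ?E = "{A :: 'n cmat. \<forall>i\<in>I. cnt A (t i) < r i}"
  let ?X = "{x \<in> space R. \<forall>i\<in>I. card {j\<in>{1..CARD('n)}. t i < x j} < r i}"
  have E[measurable]: "?E \<in> sets borel" by (rule sets_cnt_lt[OF I])
  have "(\<lambda>x. x j) \<in> borel_measurable R" if "j \<in> {1..CARD('n)}" for j
    using that by measurable
  then have X: "?X \<in> sets R" by (intro sets_card_gt I) auto
  have "emeasure (mat_law H R) ?E = (\<integral>\<^sup>+A. indicator ?E A \<partial>mat_law H R)" by simp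
  also have "\<dots> = (\<integral>\<^sup>+x. (\<integral>\<^sup>+U. indicator ?E (U ** diag_idx x ** adj U) \<partial>H) \<partial>R)"
    by (rule nn_integral_mat_law) measurable
  also have "\<dots> = (\<integral>\<^sup>+x. indicator ?X x \<partial>R)"
  proof (rule nn_integral_cong)
    fix x assume x: "x \<in> space R"
    have "(\<integral>\<^sup>+U. indicator ?E (U ** diag_idx x ** adj U) \<partial>H) = (\<integral>\<^sup>+U. indicator ?X x \<partial>H)"
      using AE_unitary
    proof (intro nn_integral_cong_AE, elim eventually_mono)
      fix U :: "'n cmat" assume "unitary U"
      then have "cnt (U ** diag_idx x ** adj U) s = card {j\<in>{1..CARD('n)}. s < x j}" for s
        unfolding diag_idx_def by (simp only: cnt_conj_diag card_idx[of "\<lambda>j. s < x j"])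
      then show "indicator ?E (U ** diag_idx x ** adj U) = (indicator ?X x :: ennreal)"
        using x by (simp add: indicator_def)
    qed
    then show "(\<integral>\<^sup>+U. indicator ?E (U ** diag_idx x ** adj U) \<partial>H) = indicator ?X x" by simp
  qed
  finally show ?thesis using X by simp
qed

context haar
begin

lemma haar_eig_PiM:
  assumes "prob_space \<kappa>" "sets \<kappa> = sets borel"
  shows "haar_eig H (PiM {1..CARD('n)} (\<lambda>_. \<kappa>))"
  by (intro haar_eig.intro haar_axioms haar_eig_axioms.intro prob_space_PiM_law sets_PiM_law assms)

text \<open>The three claims travel together: Hermitian values make \<open>hsup_mat_law\<close>
  applicable at the next step, invariance is handed on by \<open>conj_inv_hsup\<close>, and the
  count identity is kept for all thresholds \<open>r\<close> because every step lowers them.\<close>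

lemma law_iter_mat_law:
  fixes \<kappa> :: "real measure" and k :: nat
  defines "M \<equiv> mat_law H (PiM {1..CARD('n)} (\<lambda>_. \<kappa>))"
  assumes \<kappa>: "prob_space \<kappa>" "sets \<kappa> = sets borel" and k: "k \<ge> 1"
  shows "(AE A in law_iter M k. hermitian A) \<and> conj_inv (law_iter M k) \<and>
    (\<forall>I t r J. finite I \<longrightarrow> (\<forall>i\<in>I. r i \<le> CARD('n)) \<longrightarrow> finite (J :: nat set) \<longrightarrow> card J = k * CARD('n) \<longrightarrow>
      emeasure (law_iter M k) {A. \<forall>i\<in>I. cnt A (t i) < r i} = cprob \<kappa> J I t r)"
  using k
proof (induction k rule: dec_induct)
  interpret haar_eig H "PiM {1..CARD('n)} (\<lambda>_. \<kappa>)" by (rule haar_eig_PiM[OF \<kappa>])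
  case base
  have 1: "law_iter M 1 = M" unfolding M_def using law_iter_1[OF prob_mat_law sets_mat_law] by simp
  have cnt1: "emeasure (law_iter M 1) {A. \<forall>i\<in>I. cnt A (t i) < r i} = cprob \<kappa> J I t r"
    if "finite I" "finite (J :: nat set)" "card J = CARD('n)" for I t r J
    using that unfolding 1 unfolding M_def emeasure_mat_law_cnt[OF that(1)] cprob_def[symmetric]
    by (intro cprob_card_eq[OF \<kappa>]) auto
  have herm: "AE A in law_iter M 1. hermitian A" and inv: "conj_inv (law_iter M 1)"
    unfolding 1 unfolding M_def by (rule AE_mat_law_hermitian conj_inv_mat_law)+
  show ?case
  proof (intro conjI allI impI herm inv)
    fix I :: "nat set" and t r and J :: "nat set"
    assume "finite I" "finite J" "card J = 1 * CARD('n)"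
    then show "emeasure (law_iter M 1) {A. \<forall>i\<in>I. cnt A (t i) < r i} = cprob \<kappa> J I t r"
      by (intro cnt1) auto
  qed
next
  interpret haar_eig H "PiM {1..CARD('n)} (\<lambda>_. \<kappa>)" by (rule haar_eig_PiM[OF \<kappa>])
  case (step k)
  let ?N = "CARD('n)"
  have M: "prob_space M" "sets M = sets borel" unfolding M_def by (rule prob_mat_law sets_mat_law)+
  have Suc: "law_iter M (Suc k) = distr (law_iter M k \<Otimes>\<^sub>M M) borel (\<lambda>(A, B). hsup A B)"
    using law_iter_Suc[OF M, of "k - 1"] step.hyps by simp
  have IH: "emeasure (law_iter M k) {A. \<forall>i\<in>I. cnt A (t i) < r i} = cprob \<kappa> J I t r"
    if "finite I" "\<And>i. i \<in> I \<Longrightarrow> r i \<le> ?N" "finite (J :: nat set)" "card J = k * ?N" for I t r J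
    using step.IH that by blast
  have Suc': "law_iter M (Suc k) = distr (law_iter M k \<Otimes>\<^sub>M mat_law H (PiM {1..?N} (\<lambda>_. \<kappa>))) borel (\<lambda>(A, B). hsup A B)"
    unfolding M_def[symmetric] by (rule Suc)
  note P = prob_law_iter[OF M] sets_law_iter
  have "emeasure (law_iter M (Suc k)) {A. \<forall>i\<in>I. cnt A (t i) < r i} = cprob \<kappa> J I t r"
    if I: "finite I" "\<forall>i\<in>I. r i \<le> ?N" and J: "finite (J :: nat set)" "card J = Suc k * ?N" for I t r J
  proof -
    have "emeasure (law_iter M (Suc k)) {A. \<forall>i\<in>I. cnt A (t i) < r i}
      = (\<integral>\<^sup>+x. emeasure (law_iter M k) {A. \<forall>i\<in>I. cnt A (t i) < r i - card {j\<in>{1..?N}. t i < x j}} \<partial>PiM {1..?N} (\<lambda>_. \<kappa>))"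
      unfolding Suc' by (rule hsup_mat_law) (use P step.IH I in auto)
    \<comment> \<open>The samples of the first \<open>k\<close> factors are placed on indices beyond
      the block of the new factor, so that the two blocks join to
      \<open>1..Suc k * N\<close>.\<close>
    also have "\<dots> = (\<integral>\<^sup>+x. cprob \<kappa> {?N + 1..?N + k * ?N} I t (\<lambda>i. r i - card {j\<in>{1..?N}. t i < x j}) \<partial>PiM {1..?N} (\<lambda>_. \<kappa>))"
    proof (intro nn_integral_cong IH I(1))
      show "r i - card {j\<in>{1..?N}. t i < x j} \<le> ?N" if "i \<in> I" for i x
        using I(2) that by (meson diff_le_self order_trans)
    qed auto
    also have "\<dots> = cprob \<kappa> ({?N + 1..?N + k * ?N} \<union> {1..?N}) I t r"
      using I by (intro cprob_Un[OF \<kappa>, symmetric]) auto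
    also have "{?N + 1..?N + k * ?N} \<union> {1..?N} = {1..Suc k * ?N}" by auto
    also have "cprob \<kappa> {1..Suc k * ?N} I t r = cprob \<kappa> J I t r"
      using I J by (intro cprob_card_eq[OF \<kappa>]) auto
    finally show ?thesis .
  qed
  moreover have "AE A in law_iter M (Suc k). hermitian A"
  proof -
    note sets_law_iter[measurable_cong]
    show ?thesis unfolding Suc' case_prod_beta
      by (subst AE_distr_iff) (measurable, auto simp: hermitian_hsup)
  qed
  moreover have "conj_inv (law_iter M (Suc k))"
    unfolding Suc' using P step.IH by (intro conj_inv_hsup) auto
  ultimately show ?case by blast
qed

text \<open>The two sides differ only in the index set of the diagonal; renaming independent
  identically distributed coordinates along \<open>idx\<close> preserves their law.\<close>

lemma law_M_eq:
  assumes \<kappa>: "prob_space (root_law \<mu> k)"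
  shows "law_M H \<mu> k = mat_law H (PiM {1..CARD('n)} (\<lambda>_. root_law \<mu> k))"
proof (rule measure_eqI)
  let ?\<kappa> = "root_law \<mu> k"
  have s: "sets ?\<kappa> = sets borel" by (simp add: root_law_def)
  interpret haar_eig H "PiM {1..CARD('n)} (\<lambda>_. ?\<kappa>)" by (rule haar_eig_PiM[OF \<kappa> s])
  interpret U: prob_space "PiM (UNIV :: 'n set) (\<lambda>_. ?\<kappa>)" by (intro prob_space_PiM \<kappa>)
  show "sets (law_M H \<mu> k) = sets (mat_law H (PiM {1..CARD('n)} (\<lambda>_. ?\<kappa>)))"
    unfolding sets_mat_law by (simp add: law_M_def)
  fix X assume "X \<in> sets (law_M H \<mu> k)"
  then have X[measurable]: "X \<in> sets borel" by (simp add: law_M_def)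
  let ?f = "indicator X :: 'n cmat \<Rightarrow> ennreal"
  have sU[measurable_cong]: "sets (PiM (UNIV :: 'n set) (\<lambda>_. ?\<kappa>)) = sets (PiM UNIV (\<lambda>_. borel))"
    by (rule sets_PiM_law[OF \<kappa> s])
  have D[measurable]: "diag_mat \<in> borel_measurable (PiM (UNIV :: 'n set) (\<lambda>_. borel))"
    by (intro measurable_diag_mat) measurable
  let ?r = "\<lambda>\<omega>. \<lambda>n\<in>UNIV. \<omega> (idx (n :: 'n))"
  have re: "distr (PiM {1..CARD('n)} (\<lambda>_. ?\<kappa>)) (PiM (UNIV :: 'n set) (\<lambda>_. ?\<kappa>)) ?r = PiM UNIV (\<lambda>_. ?\<kappa>)"
    using bij_idx[where 'n='n] idx_in by (intro distr_PiM_reindex \<kappa>) (auto simp: bij_betw_def)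
  have rm: "?r \<in> measurable (PiM {1..CARD('n)} (\<lambda>_. ?\<kappa>)) (PiM (UNIV :: 'n set) (\<lambda>_. ?\<kappa>))"
    using idx_in by (intro measurable_restrict measurable_component_singleton) auto
  have "emeasure (law_M H \<mu> k) X = (\<integral>\<^sup>+A. ?f A \<partial>law_M H \<mu> k)" by (simp add: law_M_def)
  also have "\<dots> = (\<integral>\<^sup>+p. ?f (snd p ** diag_mat (fst p) ** adj (snd p)) \<partial>(PiM UNIV (\<lambda>_. ?\<kappa>) \<Otimes>\<^sub>M H))"
    unfolding law_M_def case_prod_beta by (rule nn_integral_distr) measurable
  also have "\<dots> = (\<integral>\<^sup>+x. (\<integral>\<^sup>+U. ?f (U ** diag_mat x ** adj U) \<partial>H) \<partial>PiM UNIV (\<lambda>_. ?\<kappa>))"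
    by (rule nn_integral_pair) measurable
  also have "\<dots> = (\<integral>\<^sup>+x. (\<integral>\<^sup>+U. ?f (U ** diag_mat x ** adj U) \<partial>H) \<partial>distr (PiM {1..CARD('n)} (\<lambda>_. ?\<kappa>)) (PiM UNIV (\<lambda>_. ?\<kappa>)) ?r)"
    unfolding re ..
  also have "\<dots> = (\<integral>\<^sup>+x. (\<integral>\<^sup>+U. ?f (U ** diag_mat (?r x) ** adj U) \<partial>H) \<partial>PiM {1..CARD('n)} (\<lambda>_. ?\<kappa>))"
    by (rule nn_integral_distr[OF rm]) measurable
  also have "\<dots> = (\<integral>\<^sup>+A. ?f A \<partial>mat_law H (PiM {1..CARD('n)} (\<lambda>_. ?\<kappa>)))"
    by (subst nn_integral_mat_law) (auto simp: diag_idx_def restrict_UNIV)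
  also have "\<dots> = emeasure (mat_law H (PiM {1..CARD('n)} (\<lambda>_. ?\<kappa>))) X"
    by (rule nn_integral_indicator) (simp only: sets_mat_law X)
  finally show "emeasure (law_M H \<mu> k) X = emeasure (mat_law H (PiM {1..CARD('n)} (\<lambda>_. ?\<kappa>))) X" .
qed

end

lemma law_sup_eq_law_iter: "law_sup H \<mu> k = law_iter (law_M H \<mu> k) k"
  by (simp add: law_sup_def law_iter_def)

text \<open>A joint distribution function determines the law: lower orthants are stable under
  intersection, generate the product measurable structure, and countably many of them exhaust the
  space.\<close>

lemma measure_eqI_orthants:
  fixes P Q :: "('a \<Rightarrow> real) measure"
  assumes J: "finite J" and P: "prob_space P" "sets P = sets (PiM J (\<lambda>_. borel))" and Q: "sets Q = sets (PiM J (\<lambda>_. borel))"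
    and eq: "\<And>t. emeasure P {x \<in> space (PiM J (\<lambda>_. borel)). \<forall>j\<in>J. x j \<le> t j}
      = emeasure Q {x \<in> space (PiM J (\<lambda>_. borel)). \<forall>j\<in>J. x j \<le> t j}"
  shows "P = Q"
proof -
  interpret P: prob_space P by (rule P(1))
  let ?\<Omega> = "PiE J (\<lambda>_. UNIV :: real set)"
  let ?E = "{{f \<in> ?\<Omega>. \<forall>i\<in>j. f i \<in> A i} | A j. j \<in> {J} \<and> A \<in> Pi j (\<lambda>_. range atMost)}"
  have E_eq: "?E = range (\<lambda>t. {x \<in> ?\<Omega>. \<forall>j\<in>J. x j \<le> t j})" (is "_ = range ?o")
  proof (intro set_eqI iffI)
    fix X assume "X \<in> ?E"
    then obtain A where A: "X = {f \<in> ?\<Omega>. \<forall>i\<in>J. f i \<in> A i}" "A \<in> Pi J (\<lambda>_. range atMost)" by auto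
    then have "\<forall>i\<in>J. \<exists>a. A i = {..a}" by auto
    then obtain t where "\<forall>i\<in>J. A i = {..t i}" by metis
    then have "X = ?o t" unfolding A(1) by auto
    then show "X \<in> range ?o" by blast
  next
    fix X assume "X \<in> range ?o"
    then obtain t where "X = ?o t" by blast
    then show "X \<in> ?E" by (intro CollectI exI[of _ "\<lambda>i. {..t i}"] exI[of _ J]) auto
  qed
  have "sets (PiM J (\<lambda>_. borel :: real measure)) = sets (PiM J (\<lambda>_. sigma UNIV (range atMost)))"
    by (simp add: borel_eq_atMost)
  also have "\<dots> = sets (sigma ?\<Omega> ?E)"
  proof (rule sets_PiM_sigma)
    show "\<exists>S\<subseteq>range atMost. countable S \<and> (UNIV :: real set) = \<Union>S" if "i \<in> J" for i
    proof (intro exI conjI)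
      show "(UNIV :: real set) = \<Union>(range (\<lambda>n. {..real n}))"
        by (auto simp: real_arch_simple)
    qed auto
  qed (use J in auto)
  also have "\<dots> = sigma_sets ?\<Omega> ?E" by (rule sets_measure_of) auto
  finally have sets: "sets (PiM J (\<lambda>_. borel :: real measure)) = sigma_sets ?\<Omega> (range ?o)" unfolding E_eq .
  show ?thesis
  proof (rule measure_eqI_generator_eq[where A = "\<lambda>n. ?o (\<lambda>_. real n)"])
    show "Int_stable (range ?o)"
    proof (rule Int_stableI)
      fix X Y assume "X \<in> range ?o" "Y \<in> range ?o"
      then obtain s t where "X = ?o s" "Y = ?o t" by blast
      then have "X \<inter> Y = ?o (\<lambda>i. min (s i) (t i))" by auto
      then show "X \<inter> Y \<in> range ?o" by (rule image_eqI[where x = "\<lambda>i. min (s i) (t i)"]) simp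
    qed
    show "emeasure P X = emeasure Q X" if "X \<in> range ?o" for X
      using that eq by (auto simp: space_PiM)
    show "sets P = sigma_sets ?\<Omega> (range ?o)" "sets Q = sigma_sets ?\<Omega> (range ?o)"
      using P(2) Q sets by auto
    show "(\<Union>n. ?o (\<lambda>_. real n)) = ?\<Omega>"
    proof (intro equalityI subsetI)
      fix x assume x: "x \<in> ?\<Omega>"
      obtain n where n: "Max (insert 0 (x ` J)) \<le> real n" using real_arch_simple by blast
      have "x j \<le> real n" if "j \<in> J" for j
      proof -
        have "x j \<le> Max (insert 0 (x ` J))" using J that by (intro Max_ge) auto
        then show ?thesis using n by simp
      qed
      then show "x \<in> (\<Union>n. ?o (\<lambda>_. real n))" using x by blast
    qed auto
    show "emeasure P (?o (\<lambda>_. real n)) \<noteq> \<infinity>" for n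
      by (simp add: P.emeasure_finite)
  qed auto
qed

text \<open>The left-continuous inverse of the distribution function. The value 0 off the open unit
  interval avoids infima of empty or unbounded sets; such arguments have probability zero
  below.\<close>

definition quant :: "real measure \<Rightarrow> real \<Rightarrow> real" where
  "quant \<mu> u = (if 0 < u \<and> u < 1 then Inf {x. u \<le> cdf \<mu> x} else 0)"

lemma quant_le_iff:
  assumes "real_distribution \<mu>" "0 < u" "u < 1"
  shows "quant \<mu> u \<le> x \<longleftrightarrow> u \<le> cdf \<mu> x"
proof -
  interpret cdf_distribution \<mu> unfolding cdf_distribution_def by (rule assms)
  show ?thesis using pseudoinverse[of u x] assms by (simp add: quant_def)
qed

lemma less_quant_iff:
  assumes "real_distribution \<mu>" "0 < u" "u < 1"
  shows "x < quant \<mu> u \<longleftrightarrow> cdf \<mu> x < u"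
  using quant_le_iff[OF assms, of x] by linarith

lemma measurable_quant:
  assumes "real_distribution \<mu>"
  shows "quant \<mu> \<in> borel_measurable borel"
  unfolding borel_measurable_iff_le
proof
  fix a
  have "{u \<in> space borel. quant \<mu> u \<le> a} = {0<..<1} \<inter> {..cdf \<mu> a} \<union> (if 0 \<le> a then - {0<..<1} else {})"
  proof (intro set_eqI)
    fix u
    show "u \<in> {u \<in> space borel. quant \<mu> u \<le> a} \<longleftrightarrow> u \<in> {0<..<1} \<inter> {..cdf \<mu> a} \<union> (if 0 \<le> a then - {0<..<1} else {})"
    proof (cases "0 < u \<and> u < 1")
      case True
      then show ?thesis using quant_le_iff[OF assms, of u a] by auto
    next
      case False
      then have "quant \<mu> u = 0" by (auto simp: quant_def)
      then show ?thesis using False by auto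
    qed
  qed
  then show "{u \<in> space borel. quant \<mu> u \<le> a} \<in> sets borel" by simp
qed

section \<open>Samples transported to the unit interval\<close>

definition unif :: "real measure" where
  "unif = density lborel (indicator {0<..<1})"

text \<open>The law of the \<open>k\<close>-th power of a uniform variable, with distribution
  function \<open>p powr (1 / k)\<close>.\<close>

definition kap :: "nat \<Rightarrow> real measure" where
  "kap k = density unif (\<lambda>x. ennreal (1 / real k * x powr (1 / real k - 1)))"

lemma sets_unif [simp, measurable_cong]: "sets unif = sets borel"
  by (simp add: unif_def)

lemma space_unif [simp]: "space unif = UNIV"
  by (simp add: unif_def)

lemma sets_kap [simp, measurable_cong]: "sets (kap k) = sets borel"
  by (simp add: kap_def)

lemma prob_unif: "prob_space unif"
  by (rule prob_spaceI) (simp add: unif_def emeasure_density)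

lemma AE_unif: "AE x in unif. 0 < x \<and> x < 1"
  unfolding unif_def by (subst AE_density) (auto simp: indicator_def)

lemma AE_kap: "AE x in kap k. 0 < x \<and> x < 1"
  unfolding kap_def by (subst AE_density) (use AE_unif in auto)

lemma emeasure_kap_atMost:
  assumes k: "k \<ge> 1" and p: "0 \<le> p" "p \<le> 1"
  shows "emeasure (kap k) {..p} = ennreal (p powr (1 / real k))"
proof -
  let ?f = "\<lambda>x. 1 / real k * x powr (1 / real k - 1)"
  have "emeasure (kap k) {..p} = (\<integral>\<^sup>+x. ennreal (?f x) * indicator {..p} x * indicator {0<..<1} x \<partial>lborel)"
    unfolding kap_def unif_def
    by (subst emeasure_density) (auto simp: nn_integral_density mult_ac)
  also have "\<dots> = (\<integral>\<^sup>+x. ennreal (if x \<in> {0..p} then ?f x else 0) \<partial>lborel)"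
    using AE_lborel_singleton[of 0] AE_lborel_singleton[of 1]
    by (intro nn_integral_cong_AE, eventually_elim) (use p in \<open>auto simp: indicator_def\<close>)
  also have "\<dots> = ennreal (1 / real k * (p powr (1 / real k - 1 + 1) / (1 / real k - 1 + 1)))"
  proof (rule nn_integral_has_integral_lborel)
    have "((\<lambda>x. x powr (1 / real k - 1)) has_integral (p powr (1 / real k - 1 + 1) / (1 / real k - 1 + 1))) {0..p}"
      using k p by (intro has_integral_powr_from_0) auto
    from has_integral_mult_right[OF this, of "1 / real k"]
    show "((\<lambda>x. if x \<in> {0..p} then ?f x else 0) has_integral (1 / real k * (p powr (1 / real k - 1 + 1) / (1 / real k - 1 + 1)))) UNIV"
      by (simp only: has_integral_restrict_UNIV)
  qed auto
  finally show ?thesis using k by simp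
qed

lemma prob_kap:
  assumes "k \<ge> 1" shows "prob_space (kap k)"
proof (rule prob_spaceI)
  have "emeasure (kap k) (space (kap k)) = emeasure (kap k) {..1}"
    using AE_kap[of k] by (intro emeasure_eq_AE) (auto elim: eventually_mono simp: kap_def)
  then show "emeasure (kap k) (space (kap k)) = 1" using emeasure_kap_atMost[OF assms, of 1] by simp
qed

lemma kap_atomless: "emeasure (kap k) {a} = 0"
proof -
  have "AE x in kap k. x \<noteq> a"
    unfolding kap_def unif_def using AE_lborel_singleton[of a]
    by (simp add: AE_density) (elim eventually_mono, simp)
  then show ?thesis by (subst (asm) AE_iff_measurable[of "{a}"]) (auto simp: kap_def)
qed

lemma
  assumes \<mu>: "real_distribution \<mu>" and k: "k \<ge> 1"
  shows real_distribution_root_law: "real_distribution (root_law \<mu> k)"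
    and cdf_root_law: "cdf (root_law \<mu> k) x = cdf \<mu> x powr (1 / real k)"
proof -
  interpret real_distribution \<mu> by (rule \<mu>)
  let ?F = "\<lambda>x. cdf \<mu> x powr (1 / real k)"
  have mono: "?F x \<le> ?F y" if "x \<le> y" for x y
    using that by (intro powr_mono2 cdf_nondecreasing cdf_nonneg) auto
  have lim: "((\<lambda>x. cdf \<mu> x powr (1 / real k)) \<longlongrightarrow> l powr (1 / real k)) F" if "(cdf \<mu> \<longlongrightarrow> l) F" for l F
    using that k by (intro tendsto_powr'[OF that tendsto_const]) (auto simp: cdf_nonneg)
  have cont: "continuous (at_right a) ?F" for a
    using cdf_is_right_cont[of a] unfolding continuous_within by (rule lim)
  have bot: "(?F \<longlongrightarrow> 0) at_bot" using lim[OF cdf_lim_at_bot] by simp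
  have top: "(?F \<longlongrightarrow> 1) at_top" using lim[OF cdf_lim_at_top_prob] by simp
  show "real_distribution (root_law \<mu> k)"
    unfolding root_law_def by (rule real_distribution_interval_measure[OF mono cont bot top])
  show "cdf (root_law \<mu> k) x = ?F x"
    unfolding root_law_def by (subst cdf_interval_measure[OF mono cont bot]) auto
qed

text \<open>On the open unit interval the quantile is at most \<open>x\<close> exactly when its
  argument is at most \<open>cdf \<mu> x\<close>, so the image law has distribution function
  \<open>cdf \<mu> x powr (1 / k)\<close>, the one defining \<open>root_law\<close>.\<close>

lemma root_law_eq_distr:
  assumes \<mu>: "real_distribution \<mu>" and k: "k \<ge> 1"
  shows "root_law \<mu> k = distr (kap k) borel (quant \<mu>)"
proof (rule cdf_unique[OF real_distribution_root_law[OF \<mu> k]])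
  interpret real_distribution \<mu> by (rule \<mu>)
  interpret K: prob_space "kap k" by (rule prob_kap[OF k])
  have q[measurable]: "quant \<mu> \<in> borel_measurable (kap k)" using measurable_quant[OF \<mu>] by simp
  show "real_distribution (distr (kap k) borel (quant \<mu>))"
    by (intro K.real_distribution_distr q)
  show "cdf (root_law \<mu> k) = cdf (distr (kap k) borel (quant \<mu>))"
  proof
    fix x
    have "cdf (distr (kap k) borel (quant \<mu>)) x = measure (kap k) (quant \<mu> -` {..x} \<inter> space (kap k))"
      unfolding cdf_def by (rule measure_distr) auto
    also have "\<dots> = measure (kap k) {..cdf \<mu> x}"
      unfolding measure_def
    proof (intro arg_cong[where f = enn2real] emeasure_eq_AE)
      show "AE u in kap k. u \<in> quant \<mu> -` {..x} \<inter> space (kap k) \<longleftrightarrow> u \<in> {..cdf \<mu> x}"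
        using AE_kap[of k] by eventually_elim (auto simp: quant_le_iff[OF \<mu>] kap_def)
    qed (use measurable_sets[OF q, of "{..x}"] in auto)
    also have "\<dots> = cdf \<mu> x powr (1 / real k)"
      unfolding measure_def by (simp add: emeasure_kap_atMost[OF k cdf_nonneg cdf_bounded_prob])
    finally show "cdf (root_law \<mu> k) x = cdf (distr (kap k) borel (quant \<mu>)) x"
      by (simp add: cdf_root_law[OF \<mu> k])
  qed
qed

text \<open>A sample exceeds \<open>t\<close> strictly exactly when its uniform preimage exceeds
  \<open>cdf \<mu> t\<close>. Counts above real levels thus become counts for an atomless law even
  if \<mu> has atoms, where ties between samples do occur.\<close>

lemma cprob_root_law:
  fixes J :: "'a set"
  assumes \<mu>: "real_distribution \<mu>" and k: "k \<ge> 1" and J: "finite J" and I: "finite I"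
  shows "cprob (root_law \<mu> k) J I t r = cprob (kap k) J I (\<lambda>i. cdf \<mu> (t i)) r"
proof -
  let ?R = "root_law \<mu> k"
  interpret R: real_distribution ?R by (rule real_distribution_root_law[OF \<mu> k])
  have R: "prob_space ?R" "sets ?R = sets borel" by (auto intro: R.prob_space_axioms)
  have q: "quant \<mu> \<in> measurable (kap k) ?R" using measurable_quant[OF \<mu>] R(2) by (simp cong: measurable_cong_sets)
  have "distr (kap k) ?R (quant \<mu>) = ?R"
    unfolding root_law_eq_distr[OF \<mu> k] by (intro distr_cong) auto
  then have eq: "PiM J (\<lambda>_. ?R) = distr (PiM J (\<lambda>_. kap k)) (PiM J (\<lambda>_. ?R)) (compose J (quant \<mu>))"
    using distr_PiM_finite_prob_space'[OF J prob_kap[OF k] R(1), where f = "\<lambda>x. quant \<mu> x"] q by simp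
  have m: "compose J (quant \<mu>) \<in> measurable (PiM J (\<lambda>_. kap k)) (PiM J (\<lambda>_. ?R))"
    unfolding compose_def
    by (intro measurable_restrict measurable_compose[OF measurable_component_singleton[of _ J "\<lambda>_. kap k"] q]) auto
  let ?X = "{x \<in> space (PiM J (\<lambda>_. ?R)). \<forall>i\<in>I. card {j\<in>J. t i < x j} < r i}"
  let ?Y = "{x \<in> space (PiM J (\<lambda>_. kap k)). \<forall>i\<in>I. card {j\<in>J. cdf \<mu> (t i) < x j} < r i}"
  have X: "?X \<in> sets (PiM J (\<lambda>_. ?R))" by (intro sets_card_gt J I measurable_PiM_component R)
  have Y: "?Y \<in> sets (PiM J (\<lambda>_. kap k))" by (intro sets_card_gt J I measurable_PiM_component prob_kap k sets_kap)
  have "cprob ?R J I t r = emeasure (distr (PiM J (\<lambda>_. kap k)) (PiM J (\<lambda>_. ?R)) (compose J (quant \<mu>))) ?X"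
    unfolding cprob_def eq[symmetric] ..
  also have "\<dots> = emeasure (PiM J (\<lambda>_. kap k)) (compose J (quant \<mu>) -` ?X \<inter> space (PiM J (\<lambda>_. kap k)))"
    by (rule emeasure_distr[OF m X])
  also have "\<dots> = emeasure (PiM J (\<lambda>_. kap k)) ?Y"
  proof (rule emeasure_eq_AE)
    have "AE x in PiM J (\<lambda>_. kap k). \<forall>j\<in>J. 0 < x j \<and> x j < 1"
      using J by (intro AE_finite_allI AE_PiM_component[OF prob_kap[OF k] _ AE_kap])
    then show "AE x in PiM J (\<lambda>_. kap k). x \<in> compose J (quant \<mu>) -` ?X \<inter> space (PiM J (\<lambda>_. kap k)) \<longleftrightarrow> x \<in> ?Y"
      using AE_space
    proof eventually_elim
      case (elim x)
      have "{j\<in>J. t i < compose J (quant \<mu>) x j} = {j\<in>J. cdf \<mu> (t i) < x j}" for i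
        using elim(1) by (auto simp: compose_def less_quant_iff[OF \<mu>])
      then show ?case using elim(2) measurable_space[OF m elim(2)] by simp
    qed
  qed (use measurable_sets[OF m X] Y in auto)
  finally show ?thesis by (simp add: cprob_def)
qed

section \<open>Ranked eigenvalues at finite k\<close>

lemma PiM_density:
  fixes J :: "'a set"
  assumes J: "finite J" and M: "prob_space M" and f[measurable]: "f \<in> borel_measurable M" and D: "prob_space (density M f)"
  shows "PiM J (\<lambda>_. density M f) = density (PiM J (\<lambda>_. M)) (\<lambda>x. \<Prod>j\<in>J. f (x j))"
proof -
  interpret M: prob_space M by (rule M)
  interpret D: prob_space "density M f" by (rule D)
  interpret PM: product_sigma_finite "\<lambda>_ :: 'a. M" by unfold_locales
  interpret PD: product_sigma_finite "\<lambda>_ :: 'a. density M f" by unfold_locales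
  have prod_meas[measurable]: "(\<lambda>x. \<Prod>j\<in>J. f (x j)) \<in> borel_measurable (PiM J (\<lambda>_. M))"
    by (intro borel_measurable_prod_ennreal measurable_compose[OF measurable_component_singleton[of _ J "\<lambda>_. M"] f])
  have "density (PiM J (\<lambda>_. M)) (\<lambda>x. \<Prod>j\<in>J. f (x j)) = PiM J (\<lambda>_. density M f)"
  proof (rule PD.PiM_eqI[OF J])
    show "sets (density (PiM J (\<lambda>_. M)) (\<lambda>x. \<Prod>j\<in>J. f (x j))) = sets (PiM J (\<lambda>_. density M f))"
      by (simp cong: sets_PiM_cong)
    fix A assume "\<And>i. i \<in> J \<Longrightarrow> A i \<in> sets (density M f)"
    then have A: "\<And>i. i \<in> J \<Longrightarrow> A i \<in> sets M" by simp
    have "emeasure (density (PiM J (\<lambda>_. M)) (\<lambda>x. \<Prod>j\<in>J. f (x j))) (PiE J A)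
      = (\<integral>\<^sup>+x. (\<Prod>j\<in>J. f (x j)) * indicator (PiE J A) x \<partial>PiM J (\<lambda>_. M))"
      using A J by (intro emeasure_density prod_meas sets_PiM_I_finite) auto
    also have "\<dots> = (\<integral>\<^sup>+x. (\<Prod>j\<in>J. f (x j) * indicator (A j) (x j)) \<partial>PiM J (\<lambda>_. M))"
    proof (rule nn_integral_cong)
      fix x assume "x \<in> space (PiM J (\<lambda>_. M))"
      then have "indicator (PiE J A) x = (\<Prod>j\<in>J. indicator (A j) (x j) :: ennreal)"
        using J by (auto simp: indicator_def space_PiM PiE_def Pi_def prod.neutral intro!: prod_zero[symmetric])
      then show "(\<Prod>j\<in>J. f (x j)) * indicator (PiE J A) x = (\<Prod>j\<in>J. f (x j) * indicator (A j) (x j))"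
        by (simp add: prod.distrib)
    qed
    also have "\<dots> = (\<Prod>j\<in>J. \<integral>\<^sup>+y. f y * indicator (A j) y \<partial>M)"
      using A by (intro PM.product_nn_integral_prod J) auto
    also have "\<dots> = (\<Prod>j\<in>J. emeasure (density M f) (A j))"
      using A by (intro prod.cong refl) (simp add: emeasure_density)
    finally show "emeasure (density (PiM J (\<lambda>_. M)) (\<lambda>x. \<Prod>j\<in>J. f (x j))) (PiE J A) = (\<Prod>j\<in>J. emeasure (density M f) (A j))" .
  qed
  then show ?thesis ..
qed

text \<open>The product counts the ordered choices of the top \<open>N\<close> among
  \<open>k * N\<close> samples; the denominator collects the factor \<open>1 / k\<close> in each of
  the \<open>N\<close> densities of \<open>kap k\<close>.\<close>

definition cst :: "nat \<Rightarrow> nat \<Rightarrow> real" where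
  "cst N k = real (\<Prod>{k * N - N + 1..k * N}) / real k ^ N"

definition dens :: "nat \<Rightarrow> nat \<Rightarrow> (nat \<Rightarrow> real) \<Rightarrow> ennreal" where
  "dens N k v = of_bool (srt N v) * ennreal (cst N k * (\<Prod>i\<in>{1..N}. (v N / v i) powr (1 - 1 / real k)))"

definition lim_dens :: "nat \<Rightarrow> (nat \<Rightarrow> real) \<Rightarrow> ennreal" where
  "lim_dens N v = of_bool (srt N v) * ennreal (real N ^ N * (\<Prod>i\<in>{1..N}. v N / v i))"

definition quants :: "real measure \<Rightarrow> nat \<Rightarrow> (nat \<Rightarrow> real) \<Rightarrow> nat \<Rightarrow> real" where
  "quants \<mu> N v = (\<lambda>i\<in>{1..N}. quant \<mu> (v i))"

text \<open>The density lives on the uniform side, where it is independent of \<mu>, which enters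
  only through the quantile transformation. One convergence statement for densities therefore serves
  all \<mu>.\<close>

definition ELaw :: "real measure \<Rightarrow> nat \<Rightarrow> ((nat \<Rightarrow> real) \<Rightarrow> ennreal) \<Rightarrow> (nat \<Rightarrow> real) measure" where
  "ELaw \<mu> N d = distr (density (PiM {1..N} (\<lambda>_. unif)) d) (PiM {1..N} (\<lambda>_. borel)) (quants \<mu> N)"

lemmas unif_component = measurable_PiM_component[OF prob_unif sets_unif]

lemma measurable_dens:
  assumes "N \<ge> 1"
  shows "dens N k \<in> borel_measurable (PiM {1..N} (\<lambda>_. unif))" "lim_dens N \<in> borel_measurable (PiM {1..N} (\<lambda>_. unif))"
proof -
  have [measurable]: "(\<lambda>v. v i) \<in> borel_measurable (PiM {1..N} (\<lambda>_. unif))" if "i \<in> {1..N}" for i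
    using that by (rule unif_component)
  have [measurable]: "(\<lambda>v. v N) \<in> borel_measurable (PiM {1..N} (\<lambda>_. unif))"
    using assms by (intro unif_component) simp
  have [measurable]: "(\<lambda>v. of_bool (srt N v) :: ennreal) \<in> borel_measurable (PiM {1..N} (\<lambda>_. unif))"
    by (intro borel_measurable_of_bool sets_srt unif_component)
  show "dens N k \<in> borel_measurable (PiM {1..N} (\<lambda>_. unif))"
    unfolding dens_def by measurable
  show "lim_dens N \<in> borel_measurable (PiM {1..N} (\<lambda>_. unif))"
    unfolding lim_dens_def by measurable
qed

lemma measurable_quants:
  assumes "real_distribution \<mu>"
  shows "quants \<mu> N \<in> measurable (PiM {1..N} (\<lambda>_. unif)) (PiM {1..N} (\<lambda>_. borel))"
  unfolding quants_def
  by (intro measurable_restrict measurable_compose[OF unif_component measurable_quant[OF assms]])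

lemma AE_unif_PiM: "AE v in PiM {1..N::nat} (\<lambda>_. unif). \<forall>i\<in>{1..N}. 0 < v i \<and> v i < 1"
  by (intro AE_finite_allI AE_PiM_component[OF prob_unif _ AE_unif]) auto

lemma nn_integral_ELaw:
  assumes \<mu>: "real_distribution \<mu>" and d: "d \<in> borel_measurable (PiM {1..N} (\<lambda>_. unif))"
    and \<psi>: "\<psi> \<in> borel_measurable (PiM {1..N} (\<lambda>_. borel))"
  shows "(\<integral>\<^sup>+x. \<psi> x \<partial>ELaw \<mu> N d) = (\<integral>\<^sup>+v. d v * \<psi> (quants \<mu> N v) \<partial>PiM {1..N} (\<lambda>_. unif))"
proof -
  note q = measurable_quants[OF \<mu>, of N]
  have "(\<integral>\<^sup>+x. \<psi> x \<partial>ELaw \<mu> N d) = (\<integral>\<^sup>+v. \<psi> (quants \<mu> N v) \<partial>density (PiM {1..N} (\<lambda>_. unif)) d)"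
    unfolding ELaw_def using q \<psi> by (intro nn_integral_distr) (auto cong: measurable_cong_sets)
  also have "\<dots> = (\<integral>\<^sup>+v. d v * \<psi> (quants \<mu> N v) \<partial>PiM {1..N} (\<lambda>_. unif))"
    by (intro nn_integral_density d measurable_compose[OF q \<psi>])
  finally show ?thesis .
qed

lemma sets_ELaw [simp, measurable_cong]: "sets (ELaw \<mu> N d) = sets (PiM {1..N} (\<lambda>_. borel))"
  by (simp add: ELaw_def)

lemma sets_orthant:
  assumes "finite J"
  shows "{x \<in> space (PiM J (\<lambda>_. borel)). \<forall>j\<in>J. x j \<le> (t j :: real)} \<in> sets (PiM J (\<lambda>_. borel))"
  using assms by (intro sets.sets_Collect_finite_All borel_measurable_le measurable_component_singleton) auto

lemma cprob_root_law_eq_ELaw: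
  fixes J :: "nat set"
  assumes \<mu>: "real_distribution \<mu>" and k: "k \<ge> 1" and N: "N \<ge> 1" and J: "finite J" "card J = k * N"
  shows "cprob (root_law \<mu> k) J {1..N} t (\<lambda>i. i) = emeasure (ELaw \<mu> N (dens N k)) {x \<in> space (PiM {1..N} (\<lambda>_. borel)). \<forall>i\<in>{1..N}. x i \<le> t i}"
proof -
  interpret real_distribution \<mu> by (rule \<mu>)
  let ?F = "cdf \<mu>" and ?m = "k * N"
  let ?kd = "\<lambda>x. ennreal (1 / real k * x powr (1 / real k - 1))"
  let ?O = "{x \<in> space (PiM {1..N} (\<lambda>_. borel)). \<forall>i\<in>{1..N}. x i \<le> t i}"
  have mN: "N \<le> ?m" using k by simp
  define G where "G v = of_nat (\<Prod>{?m - N + 1..?m}) * (of_bool (srt N v \<and> (\<forall>i\<in>{1..N}. v i \<le> ?F (t i))) * emeasure (kap k) {..v N} ^ (?m - N))" for v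
  note cdf_meas = borel_measurable_emeasure_atMost[OF prob_kap[OF k] sets_kap]
  have G_meas: "G \<in> borel_measurable (PiM {1..N} (\<lambda>_. unif))"
    unfolding G_def using N
    by (intro borel_measurable_times_ennreal borel_measurable_of_bool borel_measurable_power_ennreal sets.sets_Collect_conj sets_srt
        sets.sets_Collect_finite_All borel_measurable_le unif_component measurable_compose[OF unif_component cdf_meas]) auto
  have kd: "?kd \<in> borel_measurable unif" by measurable
  have "cprob (root_law \<mu> k) J {1..N} t (\<lambda>i. i) = cprob (kap k) J {1..N} (\<lambda>i. ?F (t i)) (\<lambda>i. i)"
    by (rule cprob_root_law[OF \<mu> k J(1)]) simp
  also have "\<dots> = (\<integral>\<^sup>+v. G v \<partial>PiM {1..N} (\<lambda>_. kap k))"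
    unfolding G_def J(2)[symmetric] using J mN
    by (intro order_statistics prob_kap k sets_kap kap_atomless J(1) N) auto
  also have "PiM {1..N} (\<lambda>_. kap k) = density (PiM {1..N} (\<lambda>_. unif)) (\<lambda>v. \<Prod>i\<in>{1..N}. ?kd (v i))"
    unfolding kap_def using prob_kap[OF k] by (intro PiM_density prob_unif kd) (auto simp: kap_def)
  also have "(\<integral>\<^sup>+v. G v \<partial>\<dots>) = (\<integral>\<^sup>+v. (\<Prod>i\<in>{1..N}. ?kd (v i)) * G v \<partial>PiM {1..N} (\<lambda>_. unif))"
    by (intro nn_integral_density G_meas borel_measurable_prod_ennreal measurable_compose[OF unif_component]) measurable
  also have "\<dots> = (\<integral>\<^sup>+v. dens N k v * indicator ?O (quants \<mu> N v) \<partial>PiM {1..N} (\<lambda>_. unif))"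
  proof (rule nn_integral_cong_AE)
    show "AE v in PiM {1..N} (\<lambda>_. unif). (\<Prod>i\<in>{1..N}. ?kd (v i)) * G v = dens N k v * indicator ?O (quants \<mu> N v)"
      using AE_unif_PiM
    proof eventually_elim
      case (elim v)
      have vN: "0 < v N" "v N < 1" using elim N by auto
      have O: "indicator ?O (quants \<mu> N v) = (of_bool (\<forall>i\<in>{1..N}. v i \<le> ?F (t i)) :: ennreal)"
        using elim by (auto simp: indicator_def quants_def space_PiM quant_le_iff[OF \<mu>])
      have real: "(\<Prod>i\<in>{1..N}. 1 / real k * v i powr (1 / real k - 1)) * (real (\<Prod>{?m - N + 1..?m}) * (v N powr (1 / real k)) ^ (?m - N))
        = cst N k * (\<Prod>i\<in>{1..N}. (v N / v i) powr (1 - 1 / real k))"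
      proof -
        have "(\<Prod>i\<in>{1..N}. (v N / v i) powr (1 - 1 / real k)) = (\<Prod>i\<in>{1..N}. v N powr (1 - 1 / real k) * v i powr (1 / real k - 1))"
        proof (intro prod.cong refl)
          fix i assume "i \<in> {1..N}"
          then have "0 < v i" using elim by auto
          then show "(v N / v i) powr (1 - 1 / real k) = v N powr (1 - 1 / real k) * v i powr (1 / real k - 1)"
            using vN powr_minus[of "v i" "1 - 1 / real k"] powr_divide[of "v N" "v i" "1 - 1 / real k"]
            by (simp add: divide_inverse[of "v N powr _"])
        qed
        \<comment> \<open>The \<open>k * N - N\<close> samples below the last ranked one contribute
          the exponent \<open>(k * N - N) / k = N * (1 - 1 / k)\<close>, that is, one factor
          \<open>v N powr (1 - 1 / k)\<close> for each of the \<open>N\<close> ranked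
          variables.\<close>
        moreover have "(v N powr (1 / real k)) ^ (?m - N) = (v N powr (1 - 1 / real k)) ^ N"
        proof -
          have "(v N powr (1 / real k)) ^ (?m - N) = v N powr (1 / real k * real (?m - N))"
            using vN by (simp add: powr_powr powr_realpow[symmetric])
          also have "1 / real k * real (?m - N) = (1 - 1 / real k) * real N"
            using k mN by (simp add: of_nat_diff field_simps)
          also have "v N powr \<dots> = (v N powr (1 - 1 / real k)) ^ N"
            using vN by (simp add: powr_powr powr_realpow[symmetric])
          finally show ?thesis .
        qed
        moreover have "(\<Prod>i\<in>{1..N}. 1 / real k * v i powr (1 / real k - 1)) = (1 / real k) ^ N * (\<Prod>i\<in>{1..N}. v i powr (1 / real k - 1))"
          unfolding prod.distrib by simp
        moreover have "(\<Prod>i\<in>{1..N}. v N powr (1 - 1 / real k) * v i powr (1 / real k - 1))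
            = (v N powr (1 - 1 / real k)) ^ N * (\<Prod>i\<in>{1..N}. v i powr (1 / real k - 1))"
          unfolding prod.distrib by simp
        ultimately show ?thesis
          by (simp only: cst_def power_one_over) (simp only: divide_inverse mult_ac mult_1_left)
      qed
      have K: "emeasure (kap k) {..v N} = ennreal (v N powr (1 / real k))"
        using vN by (intro emeasure_kap_atMost k) auto
      have "(\<Prod>i\<in>{1..N}. ?kd (v i)) * (of_nat (\<Prod>{?m - N + 1..?m}) * emeasure (kap k) {..v N} ^ (?m - N))
        = ennreal ((\<Prod>i\<in>{1..N}. 1 / real k * v i powr (1 / real k - 1)) * (real (\<Prod>{?m - N + 1..?m}) * (v N powr (1 / real k)) ^ (?m - N)))"
        unfolding K ennreal_of_nat_eq_real_of_nat
        by (simp add: prod_ennreal ennreal_power ennreal_mult prod_nonneg del: of_nat_prod)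
      then have "(\<Prod>i\<in>{1..N}. ?kd (v i)) * (of_nat (\<Prod>{?m - N + 1..?m}) * emeasure (kap k) {..v N} ^ (?m - N))
        = ennreal (cst N k * (\<Prod>i\<in>{1..N}. (v N / v i) powr (1 - 1 / real k)))"
        unfolding real .
      then show ?case unfolding G_def dens_def O
        by (cases "srt N v"; cases "\<forall>i\<in>{1..N}. v i \<le> ?F (t i)") simp_all
    qed
  qed
  also have "\<dots> = (\<integral>\<^sup>+x. indicator ?O x \<partial>ELaw \<mu> N (dens N k))"
    by (intro nn_integral_ELaw[symmetric] \<mu> measurable_dens N borel_measurable_indicator sets_orthant) simp
  also have "\<dots> = emeasure (ELaw \<mu> N (dens N k)) ?O"
    by (intro nn_integral_indicator) (use sets_orthant in simp)
  finally show ?thesis .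
qed

text \<open>A Hermitian matrix has a full eigenbasis, so at a level below all eigenvalues the count
  is \<open>CARD('n)\<close>; this supplies the witness level required by
  \<open>eig_desc_gt_iff\<close>.\<close>

lemma eig_desc_le_iff:
  assumes C: "hermitian (C :: 'n::finite cmat)" and i: "i \<in> {1..CARD('n)}"
  shows "eig_desc C i \<le> t \<longleftrightarrow> cnt C t < i"
proof -
  obtain V x where V: "unitary V" and x: "C = V ** diag_mat x ** adj V" using spectral[OF C] by blast
  define s where "s = Min (range x) - 1"
  have "s < x j" for j
  proof -
    have "Min (range x) \<le> x j" by (intro Min_le) auto
    then show ?thesis unfolding s_def by linarith
  qed
  then have "cnt C s = CARD('n)" unfolding x cnt_conj_diag[OF V] by simp
  then have "i \<le> cnt C s" using i by simp
  from eig_desc_gt_iff[OF i this, of t] show ?thesis by linarith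
qed

lemma emeasure_eig_desc_orthant:
  fixes P :: "'n::finite cmat measure"
  assumes P: "sets P = sets borel" "AE A in P. hermitian A"
  shows "emeasure (distr P (PiM {1..CARD('n)} (\<lambda>_. borel)) eig_desc) {x \<in> space (PiM {1..CARD('n)} (\<lambda>_. borel)). \<forall>i\<in>{1..CARD('n)}. x i \<le> t i}
    = emeasure P {A. \<forall>i\<in>{1..CARD('n)}. cnt A (t i) < i}"
proof -
  let ?O = "{x \<in> space (PiM {1..CARD('n)} (\<lambda>_. borel)). \<forall>i\<in>{1..CARD('n)}. x i \<le> t i}"
  have m: "eig_desc \<in> measurable P (PiM {1..CARD('n)} (\<lambda>_. borel))"
    using measurable_eig_desc P(1) by (simp cong: measurable_cong_sets)
  have O: "?O \<in> sets (PiM {1..CARD('n)} (\<lambda>_. borel))" by (rule sets_orthant) simp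
  have "emeasure (distr P (PiM {1..CARD('n)} (\<lambda>_. borel)) eig_desc) ?O = emeasure P (eig_desc -` ?O \<inter> space P)"
    by (rule emeasure_distr[OF m O])
  also have "\<dots> = emeasure P {A. \<forall>i\<in>{1..CARD('n)}. cnt A (t i) < i}"
  proof (rule emeasure_eq_AE)
    show "AE A in P. A \<in> eig_desc -` ?O \<inter> space P \<longleftrightarrow> A \<in> {A. \<forall>i\<in>{1..CARD('n)}. cnt A (t i) < i}"
      using P(2) AE_space
    proof eventually_elim
      case (elim A)
      then show ?case using measurable_space[OF m elim(2)] by (simp add: eig_desc_le_iff)
    qed
  qed (use measurable_sets[OF m O] P(1) in \<open>auto intro: sets_cnt_lt\<close>)
  finally show ?thesis .
qed

context haar
begin

lemma law_sup_props:
  assumes \<mu>: "real_distribution \<mu>" and k: "k \<ge> 1"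
  shows "prob_space (law_sup H \<mu> k)" "sets (law_sup H \<mu> k) = sets borel"
    "AE A in law_sup H \<mu> k. hermitian A" "conj_inv (law_sup H \<mu> k)"
    "\<And>I t r J. finite I \<Longrightarrow> (\<And>i. i \<in> I \<Longrightarrow> r i \<le> CARD('n)) \<Longrightarrow> finite (J :: nat set) \<Longrightarrow> card J = k * CARD('n) \<Longrightarrow>
      emeasure (law_sup H \<mu> k) {A. \<forall>i\<in>I. cnt A (t i) < r i} = cprob (root_law \<mu> k) J I t r"
proof -
  interpret RL: real_distribution "root_law \<mu> k" by (rule real_distribution_root_law[OF \<mu> k])
  have R: "prob_space (root_law \<mu> k)" "sets (root_law \<mu> k) = sets borel" by (auto intro: RL.prob_space_axioms)
  interpret haar_eig H "PiM {1..CARD('n)} (\<lambda>_. root_law \<mu> k)" by (rule haar_eig_PiM[OF R])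
  note eq = law_sup_eq_law_iter law_M_eq[OF R(1)]
  show "prob_space (law_sup H \<mu> k)" unfolding eq by (rule prob_law_iter[OF prob_mat_law sets_mat_law])
  show "sets (law_sup H \<mu> k) = sets borel" unfolding eq by (rule sets_law_iter)
  note * = law_iter_mat_law[OF R k, folded eq]
  show "AE A in law_sup H \<mu> k. hermitian A" "conj_inv (law_sup H \<mu> k)" using * by blast+
  show "emeasure (law_sup H \<mu> k) {A. \<forall>i\<in>I. cnt A (t i) < r i} = cprob (root_law \<mu> k) J I t r"
    if "finite I" "\<And>i. i \<in> I \<Longrightarrow> r i \<le> CARD('n)" "finite (J :: nat set)" "card J = k * CARD('n)" for I t r J
    using * that by blast
qed

text \<open>An invariant law is recovered from its ranked eigenvalues by
  \<open>conj_inv_eq_mat_law\<close>, and the events in \<open>eq\<close> are the lower orthants of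
  these eigenvalues.\<close>

lemma conj_inv_law_unique:
  fixes P Q :: "'n cmat measure"
  assumes P: "prob_space P" "sets P = sets borel" "AE A in P. hermitian A" "conj_inv P"
    and Q: "prob_space Q" "sets Q = sets borel" "AE A in Q. hermitian A" "conj_inv Q"
    and eq: "\<And>t. emeasure P {A. \<forall>i\<in>{1..CARD('n)}. cnt A (t i) < i} = emeasure Q {A. \<forall>i\<in>{1..CARD('n)}. cnt A (t i) < i}"
  shows "P = Q"
proof -
  interpret P: prob_space P by (rule P)
  have m: "eig_desc \<in> measurable P (PiM {1..CARD('n)} (\<lambda>_. borel))"
    using measurable_eig_desc[where 'n='n] P(2) by (simp cong: measurable_cong_sets)
  have "distr P (PiM {1..CARD('n)} (\<lambda>_. borel)) eig_desc = distr Q (PiM {1..CARD('n)} (\<lambda>_. borel)) eig_desc"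
    by (intro measure_eqI_orthants P.prob_space_distr m)
      (auto simp only: emeasure_eig_desc_orthant P Q eq sets_distr finite_atLeastAtMost)
  then show ?thesis
    using conj_inv_eq_mat_law[OF P] conj_inv_eq_mat_law[OF Q] by simp
qed

lemma law_sup_eig_desc:
  assumes \<mu>: "real_distribution \<mu>" and k: "k \<ge> 1"
  shows "distr (law_sup H \<mu> k) (PiM {1..CARD('n)} (\<lambda>_. borel)) eig_desc = ELaw \<mu> CARD('n) (dens CARD('n) k)"
proof -
  note props = law_sup_props[OF \<mu> k]
  interpret P: prob_space "law_sup H \<mu> k" by (rule props)
  have m: "eig_desc \<in> measurable (law_sup H \<mu> k) (PiM {1..CARD('n)} (\<lambda>_. borel))"
    using measurable_eig_desc[where 'n='n] props(2) by (simp cong: measurable_cong_sets)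
  show ?thesis
  proof (rule measure_eqI_orthants)
    fix t
    have "emeasure (law_sup H \<mu> k) {A. \<forall>i\<in>{1..CARD('n)}. cnt A (t i) < i} = cprob (root_law \<mu> k) {..<k * CARD('n)} {1..CARD('n)} t (\<lambda>i. i)"
      by (intro props(5)) auto
    also have "\<dots> = emeasure (ELaw \<mu> CARD('n) (dens CARD('n) k)) {x \<in> space (PiM {1..CARD('n)} (\<lambda>_. borel)). \<forall>i\<in>{1..CARD('n)}. x i \<le> t i}"
      by (intro cprob_root_law_eq_ELaw \<mu> k) auto
    finally show "emeasure (distr (law_sup H \<mu> k) (PiM {1..CARD('n)} (\<lambda>_. borel)) eig_desc) {x \<in> space (PiM {1..CARD('n)} (\<lambda>_. borel)). \<forall>j\<in>{1..CARD('n)}. x j \<le> t j}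
      = emeasure (ELaw \<mu> CARD('n) (dens CARD('n) k)) {x \<in> space (PiM {1..CARD('n)} (\<lambda>_. borel)). \<forall>j\<in>{1..CARD('n)}. x j \<le> t j}"
      unfolding emeasure_eig_desc_orthant[OF props(2,3)] .
  qed (rule finite_atLeastAtMost P.prob_space_distr[OF m] sets_distr sets_ELaw)+
qed

lemma law_sup_eq_mat_law:
  assumes \<mu>: "real_distribution \<mu>" and k: "k \<ge> 1"
  shows "law_sup H \<mu> k = mat_law H (ELaw \<mu> CARD('n) (dens CARD('n) k))"
    and "prob_space (ELaw \<mu> CARD('n) (dens CARD('n) k))"
proof -
  note props = law_sup_props[OF \<mu> k]
  interpret P: prob_space "law_sup H \<mu> k" by (rule props)
  have m: "eig_desc \<in> measurable (law_sup H \<mu> k) (PiM {1..CARD('n)} (\<lambda>_. borel))"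
    using measurable_eig_desc[where 'n='n] props(2) by (simp cong: measurable_cong_sets)
  show "law_sup H \<mu> k = mat_law H (ELaw \<mu> CARD('n) (dens CARD('n) k))"
    using conj_inv_eq_mat_law[OF props(1-4)] unfolding law_sup_eig_desc[OF \<mu> k] .
  show "prob_space (ELaw \<mu> CARD('n) (dens CARD('n) k))"
    unfolding law_sup_eig_desc[OF \<mu> k, symmetric] by (rule P.prob_space_distr[OF m])
qed

end

text \<open>Each of the \<open>N\<close> factors in the numerator lies between
  \<open>k * N - N\<close> and \<open>k * N\<close>; divided by \<open>k\<close>, both bounds tend
  to \<open>N\<close>.\<close>

lemma cst_bounds:
  assumes "N \<ge> 1" "k \<ge> 1"
  shows "cst N k \<le> real N ^ N" "(real N - real N / real k) ^ N \<le> cst N k"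
proof -
  have card: "card {k * N - N + 1..k * N} = N" using assms by simp
  have le: "N \<le> k * N" using assms by simp
  have "real (\<Prod>{k * N - N + 1..k * N}) = (\<Prod>j\<in>{k * N - N + 1..k * N}. real j)" by simp
  also have "\<dots> \<le> (\<Prod>j\<in>{k * N - N + 1..k * N}. real (k * N))"
    by (intro prod_mono) (auto simp del: of_nat_mult)
  also have "\<dots> = (real k * real N) ^ N" by (simp only: prod_constant card of_nat_mult)
  finally show "cst N k \<le> real N ^ N"
    using assms by (simp add: cst_def divide_le_eq power_mult_distrib mult.commute)
  have "(real k * real N - real N) ^ N = (\<Prod>j\<in>{k * N - N + 1..k * N}. real (k * N - N))"
    using le by (simp only: prod_constant card of_nat_diff of_nat_mult)
  also have "\<dots> \<le> (\<Prod>j\<in>{k * N - N + 1..k * N}. real j)" by (intro prod_mono) auto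
  finally have *: "(real k * real N - real N) ^ N \<le> real (\<Prod>{k * N - N + 1..k * N})" by simp
  have "real N - real N / real k = (real k * real N - real N) / real k" using assms by (simp add: field_simps)
  then show "(real N - real N / real k) ^ N \<le> cst N k"
    using * assms by (simp add: cst_def power_divide divide_right_mono)
qed

lemma cst_tendsto:
  assumes "N \<ge> 1"
  shows "(\<lambda>n. cst N (Suc n)) \<longlonglongrightarrow> real N ^ N"
proof (rule tendsto_sandwich)
  have l: "(\<lambda>n. real N * (1 / real (Suc n))) \<longlonglongrightarrow> real N * 0"
    by (intro tendsto_mult tendsto_const LIMSEQ_Suc[OF lim_1_over_n])
  have "(\<lambda>n. (real N - real N * (1 / real (Suc n))) ^ N) \<longlonglongrightarrow> (real N - real N * 0) ^ N"
    by (intro tendsto_power tendsto_diff tendsto_const l)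
  then show "(\<lambda>n. (real N - real N / real (Suc n)) ^ N) \<longlonglongrightarrow> real N ^ N" by simp
  show "\<forall>\<^sub>F n in sequentially. (real N - real N / real (Suc n)) ^ N \<le> cst N (Suc n)"
    by (intro always_eventually allI cst_bounds assms) simp
  show "\<forall>\<^sub>F n in sequentially. cst N (Suc n) \<le> real N ^ N"
    by (intro always_eventually allI cst_bounds assms) simp
qed simp

lemma srt_antimono:
  assumes "srt N v" "i \<in> {1..N}" "j \<in> {1..N}" "i \<le> j"
  shows "v j \<le> v i"
  using assms(4,3,2)
proof (induction j rule: dec_induct)
  case (step n)
  then have "v (Suc n) \<le> v n" using assms(1) by (auto simp: srt_def)
  then show ?case using step by auto
qed simp

text \<open>On sorted vectors every ratio \<open>v N / v i\<close> is at most one and its exponent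
  is nonnegative. The resulting bound is uniform in \<open>k\<close> and dominates the limit
  passage.\<close>

lemma dens_le:
  assumes N: "N \<ge> 1" and k: "k \<ge> 1" and v: "\<forall>i\<in>{1..N}. 0 < v i \<and> v i < 1"
  shows "dens N k v \<le> ennreal (real N ^ N)"
proof (cases "srt N v")
  case True
  have "(v N / v i) powr (1 - 1 / real k) \<le> 1" if "i \<in> {1..N}" for i
  proof -
    have "0 < v N" "0 < v i" "v N \<le> v i" using srt_antimono[OF True that, of N] that v N by auto
    then show ?thesis using k powr_le1[of "1 - 1 / real k" "v N / v i"] by simp
  qed
  then have "(\<Prod>i\<in>{1..N}. (v N / v i) powr (1 - 1 / real k)) \<le> 1" by (intro prod_le_1) auto
  moreover have "0 \<le> cst N k" by (simp add: cst_def prod_nonneg)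
  ultimately have "cst N k * (\<Prod>i\<in>{1..N}. (v N / v i) powr (1 - 1 / real k)) \<le> cst N k * 1"
    by (intro mult_left_mono)
  then show ?thesis using cst_bounds(1)[OF N k] unfolding dens_def
    by (simp add: True ennreal_leI)
qed (simp add: dens_def)

lemma dens_tendsto:
  assumes N: "N \<ge> 1" and v: "\<forall>i\<in>{1..N}. 0 < v i \<and> v i < 1"
  shows "(\<lambda>n. dens N (Suc n) v) \<longlonglongrightarrow> lim_dens N v"
proof (cases "srt N v")
  case True
  have "(\<lambda>n. (v N / v i) powr (1 - 1 / real (Suc n))) \<longlonglongrightarrow> (v N / v i) powr (1 - 0)" if "i \<in> {1..N}" for i
    using bspec[OF v, of N] bspec[OF v that] N
    by (intro tendsto_powr tendsto_diff tendsto_const LIMSEQ_Suc[OF lim_1_over_n]) auto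
  moreover have "(v N / v i) powr (1 - 0) = v N / v i" if "i \<in> {1..N}" for i
    using bspec[OF v, of N] bspec[OF v that] N by auto
  ultimately have "(\<lambda>n. \<Prod>i\<in>{1..N}. (v N / v i) powr (1 - 1 / real (Suc n))) \<longlonglongrightarrow> (\<Prod>i\<in>{1..N}. v N / v i)"
    by (intro tendsto_prod) auto
  then show ?thesis
    unfolding dens_def lim_dens_def using True
    by (simp only: of_bool_eq mult_1_left) (intro tendsto_ennrealI tendsto_mult cst_tendsto N)
qed (simp add: dens_def lim_dens_def)

lemma lim_dens_le:
  assumes "N \<ge> 1" "\<forall>i\<in>{1..N}. 0 < v i \<and> v i < 1"
  shows "lim_dens N v \<le> ennreal (real N ^ N)"
  by (rule tendsto_upperbound[OF dens_tendsto[OF assms]]) (auto intro!: always_eventually dens_le assms)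

text \<open>The test functions may vary with \<open>n\<close>, as required for suprema of two laws:
  the law of the first argument changes while the density of the second one converges.\<close>

lemma nn_integral_dens_tendsto:
  assumes N: "N \<ge> 1" and h: "\<And>n. h n \<in> borel_measurable (PiM {1..N} (\<lambda>_. unif))" "h' \<in> borel_measurable (PiM {1..N} (\<lambda>_. unif))"
    and le: "\<And>n v. h n v \<le> ennreal B" and lim: "\<And>v. (\<lambda>n. h n v) \<longlonglongrightarrow> h' v"
  shows "(\<lambda>n. \<integral>\<^sup>+v. dens N (Suc n) v * h n v \<partial>PiM {1..N} (\<lambda>_. unif)) \<longlonglongrightarrow> (\<integral>\<^sup>+v. lim_dens N v * h' v \<partial>PiM {1..N} (\<lambda>_. unif))"
proof (rule nn_integral_dominated_convergence[where w = "\<lambda>_. ennreal (real N ^ N) * ennreal B"])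
  note [measurable] = measurable_dens[OF N] h
  interpret prob_space "PiM {1..N} (\<lambda>_. unif)" by (intro prob_space_PiM prob_unif)
  show "(\<lambda>v. dens N (Suc n) v * h n v) \<in> borel_measurable (PiM {1..N} (\<lambda>_. unif))" for n by measurable
  show "(\<lambda>v. lim_dens N v * h' v) \<in> borel_measurable (PiM {1..N} (\<lambda>_. unif))" by measurable
  show "AE v in PiM {1..N} (\<lambda>_. unif). dens N (Suc n) v * h n v \<le> ennreal (real N ^ N) * ennreal B" for n
    using AE_unif_PiM by eventually_elim (intro mult_mono dens_le N le, auto)
  show "(\<integral>\<^sup>+v. ennreal (real N ^ N) * ennreal B \<partial>PiM {1..N} (\<lambda>_. unif)) < \<infinity>"
    using emeasure_space_1 by (simp add: ennreal_mult_less_top)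
  show "AE v in PiM {1..N} (\<lambda>_. unif). (\<lambda>n. dens N (Suc n) v * h n v) \<longlonglongrightarrow> lim_dens N v * h' v"
    using AE_unif_PiM
  proof eventually_elim
    case (elim v)
    have "h' v \<le> ennreal B" by (rule tendsto_upperbound[OF lim]) (auto simp: le)
    then have "h' v \<noteq> \<infinity>" by (auto simp: top_unique)
    moreover have "lim_dens N v \<noteq> \<infinity>" using lim_dens_le[OF N elim] by (auto simp: top_unique)
    ultimately show ?case by (intro tendsto_mult_ennreal dens_tendsto[OF N elim] lim) auto
  qed
qed measurable

section \<open>The limit law\<close>

context haar
begin

definition Lam :: "real measure \<Rightarrow> 'n cmat measure" where
  "Lam \<mu> = mat_law H (ELaw \<mu> CARD('n) (lim_dens CARD('n)))"

lemma N_pos: "CARD('n) \<ge> 1"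
  by (simp add: Suc_le_eq)

text \<open>For finite \<open>k\<close> the density has mass one because it describes ranked
  eigenvalues of a random matrix. Dominated convergence hands this on to the limit without
  evaluating the integral of \<open>lim_dens\<close>.\<close>

lemma prob_ELaw_lim:
  assumes \<mu>: "real_distribution \<mu>"
  shows "prob_space (ELaw \<mu> CARD('n) (lim_dens CARD('n)))"
proof (rule prob_spaceI)
  have total: "emeasure (ELaw \<mu> CARD('n) d) (space (ELaw \<mu> CARD('n) d)) = (\<integral>\<^sup>+v. d v * 1 \<partial>PiM {1..CARD('n)} (\<lambda>_. unif))"
    if "d \<in> borel_measurable (PiM {1..CARD('n)} (\<lambda>_. unif))" for d
    using nn_integral_ELaw[OF \<mu> that, of "\<lambda>_. 1"] by simp
  have "(\<integral>\<^sup>+v. dens CARD('n) (Suc n) v * 1 \<partial>PiM {1..CARD('n)} (\<lambda>_. unif)) = 1" for n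
    using prob_space.emeasure_space_1[OF law_sup_eq_mat_law(2)[OF \<mu>, of "Suc n"]] total[OF measurable_dens(1)[OF N_pos, of "Suc n"]]
    by simp
  moreover have "(\<lambda>n. \<integral>\<^sup>+v. dens CARD('n) (Suc n) v * 1 \<partial>PiM {1..CARD('n)} (\<lambda>_. unif)) \<longlonglongrightarrow> (\<integral>\<^sup>+v. lim_dens CARD('n) v * 1 \<partial>PiM {1..CARD('n)} (\<lambda>_. unif))"
    by (rule nn_integral_dens_tendsto[OF N_pos, where B = 1]) auto
  ultimately have "(\<lambda>n :: nat. 1) \<longlonglongrightarrow> (\<integral>\<^sup>+v. lim_dens CARD('n) v * 1 \<partial>PiM {1..CARD('n)} (\<lambda>_. unif))" by simp
  then have "(\<integral>\<^sup>+v. lim_dens CARD('n) v * 1 \<partial>PiM {1..CARD('n)} (\<lambda>_. unif)) = 1" by (simp only: LIMSEQ_const_iff)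
  then show "emeasure (ELaw \<mu> CARD('n) (lim_dens CARD('n))) (space (ELaw \<mu> CARD('n) (lim_dens CARD('n)))) = 1"
    using total[OF measurable_dens(2)[OF N_pos]] by simp
qed

lemma haar_eig_ELaw:
  assumes "prob_space (ELaw \<mu> CARD('n) d)"
  shows "haar_eig H (ELaw \<mu> CARD('n) d)"
  by (intro haar_eig.intro haar_axioms haar_eig_axioms.intro assms sets_ELaw)

lemmas haar_eig_lim = haar_eig_ELaw[OF prob_ELaw_lim]
lemmas haar_eig_dens = haar_eig_ELaw[OF law_sup_eq_mat_law(2)]

lemma Lam_props:
  assumes \<mu>: "real_distribution \<mu>"
  shows "prob_space (Lam \<mu>)" "sets (Lam \<mu>) = sets borel" "AE A in Lam \<mu>. hermitian A" "conj_inv (Lam \<mu>)"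
proof -
  interpret haar_eig H "ELaw \<mu> CARD('n) (lim_dens CARD('n))" by (rule haar_eig_lim[OF \<mu>])
  show "prob_space (Lam \<mu>)" "sets (Lam \<mu>) = sets borel" "AE A in Lam \<mu>. hermitian A" "conj_inv (Lam \<mu>)"
    unfolding Lam_def by (rule prob_mat_law sets_mat_law AE_mat_law_hermitian conj_inv_mat_law)+
qed

lemma nn_integral_law_sup_tendsto:
  assumes \<mu>: "real_distribution \<mu>" and G[measurable]: "G \<in> borel_measurable borel" and B: "\<And>A. G A \<le> ennreal B"
  shows "(\<lambda>n. \<integral>\<^sup>+A. G A \<partial>law_sup H \<mu> (Suc n)) \<longlonglongrightarrow> (\<integral>\<^sup>+A. G A \<partial>Lam \<mu>)"
proof -
  define \<psi> where "\<psi> x = (\<integral>\<^sup>+U. G (U ** diag_idx x ** adj U) \<partial>H)" for x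
  have \<psi>[measurable]: "\<psi> \<in> borel_measurable (PiM {1..CARD('n)} (\<lambda>_. borel))"
    unfolding \<psi>_def by measurable
  have "\<psi> x \<le> (\<integral>\<^sup>+U. ennreal B \<partial>H)" for x unfolding \<psi>_def by (intro nn_integral_mono B)
  then have le: "\<psi> x \<le> ennreal B" for x by simp
  have eq: "(\<integral>\<^sup>+A. G A \<partial>mat_law H (ELaw \<mu> CARD('n) d)) = (\<integral>\<^sup>+v. d v * \<psi> (quants \<mu> CARD('n) v) \<partial>PiM {1..CARD('n)} (\<lambda>_. unif))"
    if "prob_space (ELaw \<mu> CARD('n) d)" "d \<in> borel_measurable (PiM {1..CARD('n)} (\<lambda>_. unif))" for d
  proof -
    interpret haar_eig H "ELaw \<mu> CARD('n) d" by (rule haar_eig_ELaw[OF that(1)])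
    show ?thesis
      unfolding nn_integral_mat_law[OF G] \<psi>_def[symmetric] by (rule nn_integral_ELaw[OF \<mu> that(2) \<psi>])
  qed
  have "(\<lambda>n. \<integral>\<^sup>+v. dens CARD('n) (Suc n) v * \<psi> (quants \<mu> CARD('n) v) \<partial>PiM {1..CARD('n)} (\<lambda>_. unif))
    \<longlonglongrightarrow> (\<integral>\<^sup>+v. lim_dens CARD('n) v * \<psi> (quants \<mu> CARD('n) v) \<partial>PiM {1..CARD('n)} (\<lambda>_. unif))"
    by (intro nn_integral_dens_tendsto[where B = B] N_pos measurable_compose[OF measurable_quants[OF \<mu>] \<psi>] le tendsto_const)
  moreover have "(\<integral>\<^sup>+A. G A \<partial>law_sup H \<mu> (Suc n)) = (\<integral>\<^sup>+v. dens CARD('n) (Suc n) v * \<psi> (quants \<mu> CARD('n) v) \<partial>PiM {1..CARD('n)} (\<lambda>_. unif))" for n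
  proof -
    have k: "Suc n \<ge> 1" by simp
    show ?thesis
      unfolding law_sup_eq_mat_law(1)[OF \<mu> k] by (rule eq[OF law_sup_eq_mat_law(2)[OF \<mu> k] measurable_dens(1)[OF N_pos]])
  qed
  moreover have "(\<integral>\<^sup>+A. G A \<partial>Lam \<mu>) = (\<integral>\<^sup>+v. lim_dens CARD('n) v * \<psi> (quants \<mu> CARD('n) v) \<partial>PiM {1..CARD('n)} (\<lambda>_. unif))"
    unfolding Lam_def by (rule eq[OF prob_ELaw_lim[OF \<mu>] measurable_dens(2)[OF N_pos]])
  ultimately show ?thesis by simp
qed

lemma emeasure_law_sup_tendsto:
  assumes \<mu>: "real_distribution \<mu>" and X: "X \<in> sets borel"
  shows "(\<lambda>n. emeasure (law_sup H \<mu> (Suc n)) X) \<longlonglongrightarrow> emeasure (Lam \<mu>) X"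
proof -
  have "(\<lambda>n. \<integral>\<^sup>+A. indicator X A \<partial>law_sup H \<mu> (Suc n)) \<longlonglongrightarrow> (\<integral>\<^sup>+A. indicator X A \<partial>Lam \<mu>)"
    using X by (intro nn_integral_law_sup_tendsto[where B = 1] \<mu>) (auto simp: indicator_def)
  then show ?thesis using X law_sup_props(2)[OF \<mu>] Lam_props(2)[OF \<mu>] by simp
qed

lemma weak_conv_law_sup:
  assumes \<mu>: "real_distribution \<mu>"
  shows "weak_conv_herm (\<lambda>k. law_sup H \<mu> (Suc k)) (Lam \<mu>)"
  unfolding weak_conv_herm_def
proof (intro allI impI)
  fix f :: "'n cmat \<Rightarrow> real"
  assume f: "continuous_on herm_set f \<and> bounded (f ` herm_set)"
  \<comment> \<open>The test function is controlled only on \<open>herm_set\<close>; extending it by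
    zero gives a bounded Borel function on all matrices.\<close>
  define F where "F A = indicator herm_set A *\<^sub>R f A" for A
  have herm: "herm_set \<in> sets (borel :: 'n cmat measure)"
    using measurable_hermitian[where 'n='n] by (simp add: herm_set_def pred_def)
  have F[measurable]: "F \<in> borel_measurable borel"
    unfolding F_def using f herm by (intro borel_measurable_continuous_on_indicator) auto
  obtain B where B: "\<And>A. A \<in> herm_set \<Longrightarrow> norm (f A) \<le> B" "B > 0"
    using f unfolding bounded_pos by (metis imageI)
  have FB: "\<bar>F A\<bar> \<le> B" for A using B by (cases "A \<in> herm_set") (auto simp: F_def)
  \<comment> \<open>Adding the bound \<open>B\<close> makes the integrand nonnegative, and on a
    probability space the shift can be subtracted again afterwards.\<close>
  have eq: "set_lebesgue_integral M herm_set f = enn2real (\<integral>\<^sup>+A. ennreal (F A + B) \<partial>M) - B"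
    if M: "prob_space M" "sets M = sets borel" for M
  proof -
    interpret M: prob_space M by (rule M)
    note M(2)[measurable_cong]
    have int: "integrable M F"
      by (rule M.integrable_const_bound[where B = B]) (use FB in auto)
    have "enn2real (\<integral>\<^sup>+A. ennreal (F A + B) \<partial>M) = (\<integral>A. F A + B \<partial>M)"
    proof (rule integral_eq_nn_integral[symmetric])
      show "AE A in M. 0 \<le> F A + B" using FB by (intro AE_I2) (metis abs_le_iff add.commute minus_le_iff diff_ge_0_iff_ge diff_minus_eq_add)
    qed measurable
    also have "\<dots> = (\<integral>A. F A \<partial>M) + B" using int by (simp add: M.prob_space)
    finally show ?thesis by (simp add: set_lebesgue_integral_def F_def)
  qed
  have "(\<lambda>n. \<integral>\<^sup>+A. ennreal (F A + B) \<partial>law_sup H \<mu> (Suc n)) \<longlonglongrightarrow> (\<integral>\<^sup>+A. ennreal (F A + B) \<partial>Lam \<mu>)"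
  proof (rule nn_integral_law_sup_tendsto[OF \<mu>, where B = "2 * B"])
    show "ennreal (F A + B) \<le> ennreal (2 * B)" for A using FB[of A] by (intro ennreal_leI) linarith
  qed measurable
  moreover have "(\<integral>\<^sup>+A. ennreal (F A + B) \<partial>Lam \<mu>) \<noteq> \<top>"
  proof -
    interpret M: prob_space "Lam \<mu>" by (rule Lam_props[OF \<mu>])
    have "(\<integral>\<^sup>+A. ennreal (F A + B) \<partial>Lam \<mu>) \<le> (\<integral>\<^sup>+A. ennreal (2 * B) \<partial>Lam \<mu>)"
    proof (rule nn_integral_mono)
      show "ennreal (F A + B) \<le> ennreal (2 * B)" for A using FB[of A] by (intro ennreal_leI) linarith
    qed
    also have "\<dots> = ennreal (2 * B)" by (simp add: M.emeasure_space_1)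
    finally show ?thesis by (auto simp: top_unique)
  qed
  ultimately have "(\<lambda>n. enn2real (\<integral>\<^sup>+A. ennreal (F A + B) \<partial>law_sup H \<mu> (Suc n)) - B) \<longlonglongrightarrow> enn2real (\<integral>\<^sup>+A. ennreal (F A + B) \<partial>Lam \<mu>) - B"
    by (intro tendsto_diff tendsto_const tendsto_enn2real) (auto simp: less_top)
  then show "(\<lambda>k. set_lebesgue_integral (law_sup H \<mu> (Suc k)) herm_set f) \<longlonglongrightarrow> set_lebesgue_integral (Lam \<mu>) herm_set f"
    using law_sup_props(1,2)[OF \<mu>] Lam_props(1,2)[OF \<mu>] by (simp add: eq)
qed

end

text \<open>A sorted diagonal is its own list of ranked eigenvalues after any unitary conjugation.
  Equality as functions also needs the indices outside \<open>1..N\<close>, where both sides are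
  \<open>undefined\<close>.\<close>

lemma (in haar_eig) distr_eig_desc_mat_law:
  assumes srt: "AE x in R. srt CARD('n) x"
  shows "distr (mat_law H R) (PiM {1..CARD('n)} (\<lambda>_. borel)) eig_desc = R"
proof (rule measure_eqI)
  fix X assume "X \<in> sets (distr (mat_law H R) (PiM {1..CARD('n)} (\<lambda>_. borel)) eig_desc)"
  then have X[measurable]: "X \<in> sets (PiM {1..CARD('n)} (\<lambda>_. borel))" by simp
  have m[measurable]: "eig_desc \<in> measurable (mat_law H R) (PiM {1..CARD('n)} (\<lambda>_. borel))"
    using measurable_eig_desc[where 'n='n] sets_mat_law by (simp only: measurable_cong_sets[OF sets_mat_law refl])
  have "emeasure (distr (mat_law H R) (PiM {1..CARD('n)} (\<lambda>_. borel)) eig_desc) X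
    = (\<integral>\<^sup>+x. indicator X x \<partial>distr (mat_law H R) (PiM {1..CARD('n)} (\<lambda>_. borel)) eig_desc)"
    using X by simp
  also have "\<dots> = (\<integral>\<^sup>+A. indicator X (eig_desc A) \<partial>mat_law H R)"
    using X by (intro nn_integral_distr m) auto
  also have "\<dots> = (\<integral>\<^sup>+x. (\<integral>\<^sup>+U. indicator X (eig_desc (U ** diag_idx x ** adj U)) \<partial>H) \<partial>R)"
    by (rule nn_integral_mat_law) measurable
  also have "\<dots> = (\<integral>\<^sup>+x. indicator X x \<partial>R)"
  proof (rule nn_integral_cong_AE)
    show "AE x in R. (\<integral>\<^sup>+U. indicator X (eig_desc (U ** diag_idx x ** adj U)) \<partial>H) = indicator X x"
      using srt AE_space
    proof eventually_elim
      case (elim x)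
      then have ext: "x \<in> extensional {1..CARD('n)}"
        using sets_eq_imp_space_eq[OF sets_R] by (simp add: space_PiM PiE_def)
      have "(\<integral>\<^sup>+U. indicator X (eig_desc (U ** diag_idx x ** adj U)) \<partial>H) = (\<integral>\<^sup>+U. indicator X x \<partial>H)"
        using AE_unitary
      proof (intro nn_integral_cong_AE, elim eventually_mono)
        fix U :: "'n cmat" assume U: "unitary U"
        have "eig_desc (U ** diag_idx x ** adj U) = x"
        proof
          fix j
          show "eig_desc (U ** diag_idx x ** adj U) j = x j"
          proof (cases "j \<in> {1..CARD('n)}")
            case True
            then show ?thesis
              unfolding diag_idx_def using srt_antimono[OF elim(1)] by (intro eig_desc_conj_sorted U) auto
          next
            case False
            then have "eig_desc (U ** diag_idx x ** adj U) j = undefined" unfolding eig_desc_def by (simp only: restrict_apply if_False)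
            then show ?thesis using extensional_arb[OF ext False] by (simp only:)
          qed
        qed
        then show "indicator X (eig_desc (U ** diag_idx x ** adj U)) = (indicator X x :: ennreal)" by simp
      qed
      then show ?case by simp
    qed
  qed
  also have "\<dots> = emeasure R X" using X sets_R by simp
  finally show "emeasure (distr (mat_law H R) (PiM {1..CARD('n)} (\<lambda>_. borel)) eig_desc) X = emeasure R X" .
qed (simp only: sets_distr sets_R)

section \<open>Ranked eigenvalues under the limit law\<close>

lemma quant_mono:
  assumes \<mu>: "real_distribution \<mu>" and u: "0 < u" "u \<le> w" "w < 1"
  shows "quant \<mu> u \<le> quant \<mu> w"
proof -
  have "w \<le> cdf \<mu> (quant \<mu> w)" using quant_le_iff[OF \<mu>, of w "quant \<mu> w"] u by simp
  then show ?thesis using quant_le_iff[OF \<mu>, of u "quant \<mu> w"] u by simp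
qed

text \<open>The density vanishes on unsorted vectors, and the quantile function is monotone, so it
  keeps sorted vectors sorted.\<close>

lemma AE_srt_ELaw:
  assumes \<mu>: "real_distribution \<mu>" and N: "N \<ge> 1"
  shows "AE x in ELaw \<mu> N (lim_dens N). srt N x"
proof -
  note q = measurable_quants[OF \<mu>, of N]
  have S: "{x \<in> space (PiM {1..N} (\<lambda>_. borel)). srt N x} \<in> sets (PiM {1..N} (\<lambda>_. borel))"
    by (intro sets_srt measurable_component_singleton)
  have "AE v in PiM {1..N} (\<lambda>_. unif). 0 < lim_dens N v \<longrightarrow> srt N (quants \<mu> N v)"
    using AE_unif_PiM
  proof eventually_elim
    case (elim v)
    show ?case
    proof
      assume "0 < lim_dens N v"
      then have "srt N v" by (cases "srt N v") (auto simp: lim_dens_def)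
      then show "srt N (quants \<mu> N v)"
        using elim unfolding srt_def quants_def by (auto intro!: quant_mono[OF \<mu>])
    qed
  qed
  then have "AE v in density (PiM {1..N} (\<lambda>_. unif)) (lim_dens N). srt N (quants \<mu> N v)"
    by (subst AE_density) (use measurable_dens(2)[OF N] in auto)
  then show ?thesis
    unfolding ELaw_def using q S by (subst AE_distr_iff) (auto cong: measurable_cong_sets)
qed

lemma kap_1: "kap 1 = unif"
proof -
  have "kap 1 = density unif (\<lambda>_. 1)"
    unfolding kap_def
  proof (rule density_cong)
    show "AE x in unif. ennreal (1 / real 1 * x powr (1 / real 1 - 1)) = 1"
      using AE_unif by eventually_elim simp
  qed auto
  then show ?thesis by (simp add: density_1)
qed

lemma distr_unif_quant:
  assumes \<mu>: "real_distribution \<mu>"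
  shows "distr unif borel (quant \<mu>) = \<mu>"
proof -
  interpret real_distribution \<mu> by (rule \<mu>)
  have "root_law \<mu> 1 = \<mu>"
    by (rule cdf_unique) (use cdf_nonneg in \<open>auto simp: \<mu> real_distribution_root_law cdf_root_law fun_eq_iff\<close>)
  then show ?thesis using root_law_eq_distr[OF \<mu>, of 1] by (simp only: kap_1)
qed

text \<open>Without atoms \<open>cdf \<mu>\<close> inverts the quantile function on the open unit
  interval, so \<open>lim_dens\<close> is the stated density composed with the quantile map. That
  map carries the uniform product measure to the product of copies of \<mu>, hence a density
  composed with it to the density itself.\<close>

lemma ELaw_atomless:
  assumes \<mu>: "real_distribution \<mu>" and atomless: "\<And>x. measure \<mu> {x} = 0" and N: "N \<ge> 1"
  shows "ELaw \<mu> N (lim_dens N) = density (PiM {1..N} (\<lambda>_. \<mu>)) (eig_density N \<mu>)"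
proof -
  interpret real_distribution \<mu> by (rule \<mu>)
  let ?U = "PiM {1..N} (\<lambda>_. unif)" and ?M = "PiM {1..N} (\<lambda>_. \<mu>)"
  have s: "sets ?M = sets (PiM {1..N} (\<lambda>_. borel))" by (intro sets_PiM_cong) auto
  have q: "quant \<mu> \<in> measurable unif \<mu>" using measurable_quant[OF \<mu>] by (simp cong: measurable_cong_sets)
  have "distr unif \<mu> (quant \<mu>) = distr unif borel (quant \<mu>)" by (rule distr_cong) auto
  then have "distr unif \<mu> (quant \<mu>) = \<mu>" using distr_unif_quant[OF \<mu>] by simp
  then have "distr ?U ?M (compose {1..N} (quant \<mu>)) = ?M"
    using distr_PiM_finite_prob_space'[OF _ prob_unif prob_space_axioms, of "{1..N}" "quant \<mu>"] q by simp
  then have M: "distr ?U ?M (quants \<mu> N) = ?M" by (simp add: compose_def[abs_def] quants_def[abs_def])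
  have qs: "quants \<mu> N \<in> measurable ?U ?M"
    using measurable_quants[OF \<mu>, of N] by (simp add: measurable_cong_sets[OF refl s])
  have cdf_quant: "cdf \<mu> (quant \<mu> u) = u" if u: "0 < u" "u < 1" for u
  proof (rule antisym)
    show "u \<le> cdf \<mu> (quant \<mu> u)" using quant_le_iff[OF \<mu> u, of "quant \<mu> u"] by simp
    \<comment> \<open>Strictly to the left of the quantile the distribution function stays below
      \<open>u\<close>; without an atom, continuity extends this bound to the quantile
      itself.\<close>
    have "isCont (cdf \<mu>) (quant \<mu> u)" by (simp add: isCont_cdf atomless)
    then have "(cdf \<mu> \<longlongrightarrow> cdf \<mu> (quant \<mu> u)) (at_left (quant \<mu> u))"
      by (simp add: isCont_def filterlim_at_split)
    moreover have "\<forall>\<^sub>F x in at_left (quant \<mu> u). cdf \<mu> x \<le> u"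
    proof (rule eventually_at_leftI)
      fix x assume "x \<in> {quant \<mu> u - 1<..<quant \<mu> u}"
      then have "cdf \<mu> x < u" by (subst less_quant_iff[OF \<mu> u, symmetric]) simp
      then show "cdf \<mu> x \<le> u" by simp
    qed simp
    ultimately show "cdf \<mu> (quant \<mu> u) \<le> u" by (intro tendsto_upperbound) auto
  qed
  have comp: "(\<lambda>x. x i) \<in> borel_measurable ?M" if "i \<in> {1..N}" for i
    using that by (intro measurable_PiM_component prob_space_axioms) auto
  have dens_meas: "eig_density N \<mu> \<in> borel_measurable ?M"
  proof -
    have F: "cdf \<mu> \<in> borel_measurable borel"
      by (rule borel_measurable_mono) (simp add: mono_def cdf_nondecreasing)
    have Fi: "(\<lambda>x. cdf \<mu> (x i)) \<in> borel_measurable ?M" if "i \<in> {1..N}" for i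
      by (rule measurable_compose[OF comp[OF that] F])
    have "(\<lambda>t. ennreal (real N ^ N * (\<Prod>i\<in>{1..N}. cdf \<mu> (t N) / cdf \<mu> (t i)))) \<in> borel_measurable ?M"
      using Fi N by (intro measurable_compose[OF _ measurable_ennreal] borel_measurable_times borel_measurable_prod
          borel_measurable_divide borel_measurable_const) auto
    moreover have "{t \<in> space ?M. (\<forall>i\<in>{1..N}. cdf \<mu> (t i) \<noteq> 0) \<and> (\<forall>i\<in>{1..<N}. t i \<ge> t (Suc i))} \<in> sets ?M"
      using Fi comp by (intro sets.sets_Collect_conj sets.sets_Collect_finite_All borel_measurable_le borel_measurable_neq) auto
    ultimately show ?thesis
      unfolding eig_density_def by (intro measurable_If borel_measurable_const) auto
  qed
  have "density ?M (eig_density N \<mu>) = distr (density ?U (\<lambda>v. eig_density N \<mu> (quants \<mu> N v))) ?M (quants \<mu> N)"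
    using density_distr[OF dens_meas qs] unfolding M .
  also have "density ?U (\<lambda>v. eig_density N \<mu> (quants \<mu> N v)) = density ?U (lim_dens N)"
  proof (rule density_cong)
    show "(\<lambda>v. eig_density N \<mu> (quants \<mu> N v)) \<in> borel_measurable ?U" by (rule measurable_compose[OF qs dens_meas])
    show "lim_dens N \<in> borel_measurable ?U" by (rule measurable_dens(2)[OF N])
    show "AE v in ?U. eig_density N \<mu> (quants \<mu> N v) = lim_dens N v"
      using AE_unif_PiM
    proof eventually_elim
      case (elim v)
      have F: "cdf \<mu> (quants \<mu> N v i) = v i" if "i \<in> {1..N}" for i
        using elim that by (simp add: quants_def cdf_quant)
      have iff: "quants \<mu> N v (Suc i) \<le> quants \<mu> N v i \<longleftrightarrow> v (Suc i) \<le> v i" if "i \<in> {1..<N}" for i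
      proof
        assume "quants \<mu> N v (Suc i) \<le> quants \<mu> N v i"
        then have "cdf \<mu> (quants \<mu> N v (Suc i)) \<le> cdf \<mu> (quants \<mu> N v i)" by (rule cdf_nondecreasing)
        then show "v (Suc i) \<le> v i" using that by (simp add: F)
      next
        assume "v (Suc i) \<le> v i"
        then show "quants \<mu> N v (Suc i) \<le> quants \<mu> N v i"
          using that elim by (auto simp: quants_def intro!: quant_mono[OF \<mu>])
      qed
      have "\<forall>i\<in>{1..N}. cdf \<mu> (quants \<mu> N v i) \<noteq> 0" using elim by (auto simp: F)
      moreover have "(\<forall>i\<in>{1..<N}. quants \<mu> N v i \<ge> quants \<mu> N v (Suc i)) \<longleftrightarrow> srt N v"
        unfolding srt_def by (intro ball_cong refl iff)
      moreover have "(\<Prod>i\<in>{1..N}. cdf \<mu> (quants \<mu> N v N) / cdf \<mu> (quants \<mu> N v i)) = (\<Prod>i\<in>{1..N}. v N / v i)"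
        using N by (intro prod.cong refl) (simp add: F)
      ultimately show ?case unfolding eig_density_def lim_dens_def by (simp only: if_True simp_thms) simp
    qed
  qed
  also have "distr (density ?U (lim_dens N)) ?M (quants \<mu> N) = ELaw \<mu> N (lim_dens N)"
    unfolding ELaw_def using s by (intro distr_cong) auto
  finally show ?thesis ..
qed

text \<open>Both integrals are the probability, under the product of \<open>P\<close> and
  \<open>Q\<close>, that for every \<open>i\<close> the count of the matrix and that of the samples
  add up to less than \<open>r i\<close>; they condition on different factors.\<close>

lemma pair_orthant:
  fixes P :: "'n::finite cmat measure" and t :: "nat \<Rightarrow> real"
  assumes P: "prob_space P" "sets P = sets borel" and Q: "prob_space Q" and J: "finite J" "\<And>j. j \<in> J \<Longrightarrow> (\<lambda>\<omega>. \<omega> j) \<in> borel_measurable Q"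
    and I: "finite I"
  shows "(\<integral>\<^sup>+A. emeasure Q {\<omega> \<in> space Q. \<forall>i\<in>I. card {j\<in>J. t i < \<omega> j} < r i - cnt A (t i)} \<partial>P)
      = (\<integral>\<^sup>+\<omega>. emeasure P {A. \<forall>i\<in>I. cnt A (t i) < r i - card {j\<in>J. t i < \<omega> j}} \<partial>Q)"
    and "(\<lambda>\<omega>. emeasure P {A. \<forall>i\<in>I. cnt A (t i) < r i - card {j\<in>J. t i < \<omega> j}}) \<in> borel_measurable Q"
proof -
  interpret p: prob_space P by (rule P)
  interpret q: prob_space Q by (rule Q)
  interpret pair_sigma_finite P Q ..
  note P(2)[measurable_cong]
  let ?S = "{p \<in> space (P \<Otimes>\<^sub>M Q). \<forall>i\<in>I. cnt (fst p) (t i) + card {j\<in>J. t i < snd p j} < r i}"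
  have spP: "space P = UNIV" using sets_eq_imp_space_eq[OF P(2)] by simp
  have S: "?S \<in> sets (P \<Otimes>\<^sub>M Q)"
  proof (intro sets.sets_Collect_finite_All I borel_measurable_less borel_measurable_const borel_measurable_add)
    fix i
    have "(\<lambda>p. cnt (fst p) (t i)) \<in> measurable (P \<Otimes>\<^sub>M Q) (count_space UNIV)"
      by (rule measurable_compose[OF _ measurable_cnt]) measurable
    then show "(\<lambda>p. cnt (fst p) (t i)) \<in> borel_measurable (P \<Otimes>\<^sub>M Q)"
      by (rule measurable_compose) simp
    show "(\<lambda>p. card {j\<in>J. t i < snd p j}) \<in> borel_measurable (P \<Otimes>\<^sub>M Q)"
      by (intro measurable_card_gt J measurable_compose[OF measurable_snd])
  qed
  have 1: "Pair A -` ?S = {\<omega> \<in> space Q. \<forall>i\<in>I. card {j\<in>J. t i < \<omega> j} < r i - cnt A (t i)}" for A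
    by (auto simp: space_pair_measure spP less_diff_conv add.commute)
  have 2: "(\<lambda>A. (A, \<omega>)) -` ?S = {A. \<forall>i\<in>I. cnt A (t i) < r i - card {j\<in>J. t i < \<omega> j}}" if "\<omega> \<in> space Q" for \<omega>
    using that by (auto simp: space_pair_measure spP less_diff_conv)
  have "(\<integral>\<^sup>+A. emeasure Q (Pair A -` ?S) \<partial>P) = (\<integral>\<^sup>+\<omega>. emeasure P ((\<lambda>A. (A, \<omega>)) -` ?S) \<partial>Q)"
    using q.emeasure_pair_measure_alt[OF S] emeasure_pair_measure_alt2[OF S] by simp
  then show "(\<integral>\<^sup>+A. emeasure Q {\<omega> \<in> space Q. \<forall>i\<in>I. card {j\<in>J. t i < \<omega> j} < r i - cnt A (t i)} \<partial>P)
      = (\<integral>\<^sup>+\<omega>. emeasure P {A. \<forall>i\<in>I. cnt A (t i) < r i - card {j\<in>J. t i < \<omega> j}} \<partial>Q)"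
    unfolding 1 by (rule trans) (intro nn_integral_cong, simp only: 2)
  show "(\<lambda>\<omega>. emeasure P {A. \<forall>i\<in>I. cnt A (t i) < r i - card {j\<in>J. t i < \<omega> j}}) \<in> borel_measurable Q"
    using measurable_emeasure_Pair2[OF S] by (rule measurable_cong[THEN iffD1, rotated]) (simp only: 2)
qed

section \<open>Maxima of samples and products of distribution functions\<close>

lemma emeasure_PiM_orthant:
  fixes J :: "'a set" and \<kappa> :: "real measure"
  assumes J: "finite J" and \<kappa>: "prob_space \<kappa>" "sets \<kappa> = sets borel"
  shows "emeasure (PiM J (\<lambda>_. \<kappa>)) {x \<in> space (PiM J (\<lambda>_. borel)). \<forall>j\<in>J. x j \<le> t j} = (\<Prod>j\<in>J. emeasure \<kappa> {..t j})"
proof -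
  interpret product_sigma_finite "\<lambda>_ :: 'a. \<kappa>" by (rule product_sigma_finite_law[OF \<kappa>])
  have "{x \<in> space (PiM J (\<lambda>_. borel)). \<forall>j\<in>J. x j \<le> t j} = PiE J (\<lambda>j. {..t j})"
    by (auto simp: space_PiM PiE_def Pi_def)
  then show ?thesis using J by (simp add: emeasure_PiM \<kappa>(2))
qed

lemma emeasure_root_law_atMost:
  assumes \<mu>: "real_distribution \<mu>" and k: "k \<ge> 1"
  shows "emeasure (root_law \<mu> k) {..x} = ennreal (cdf \<mu> x powr (1 / real k))"
proof -
  interpret real_distribution "root_law \<mu> k" by (rule real_distribution_root_law[OF \<mu> k])
  show ?thesis using cdf_root_law[OF \<mu> k, of x] by (simp add: emeasure_eq_measure cdf_def)
qed

lemma emeasure_root_law_greaterThan: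
  assumes \<mu>: "real_distribution \<mu>" and k: "k \<ge> 1"
  shows "emeasure (root_law \<mu> k) {x<..} = ennreal (1 - cdf \<mu> x powr (1 / real k))"
proof -
  interpret real_distribution "root_law \<mu> k" by (rule real_distribution_root_law[OF \<mu> k])
  have "{x<..} = space (root_law \<mu> k) - {..x}" by auto
  then have "prob {x<..} = 1 - prob {..x}" using prob_compl[of "{..x}"] by simp
  then show ?thesis using cdf_root_law[OF \<mu> k, of x] by (simp add: emeasure_eq_measure cdf_def)
qed

text \<open>Since \<open>F\<^sub>\<rho>\<^bsup>1/k\<^esup> = F\<^sub>\<mu>\<^bsup>1/k\<^esup> F\<^sub>\<nu>\<^bsup>1/k\<^esup>\<close>, the samples for \<open>\<rho>\<close> are maxima of samples for \<open>\<mu>\<close> and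
  \<open>\<nu>\<close>. Above a level \<open>s\<close>, counting maxima and counting both kinds of samples differ only if both
  members of some pair exceed \<open>s\<close>, which has probability of order \<open>1/k\<close>.\<close>
context
  fixes \<mu> \<nu> \<rho> :: "real measure" and k :: nat and J :: "nat set"
  assumes \<mu>: "real_distribution \<mu>" and \<nu>: "real_distribution \<nu>" and \<rho>: "real_distribution \<rho>"
    and cdf: "\<And>x. cdf \<rho> x = cdf \<mu> x * cdf \<nu> x" and k: "k \<ge> 1" and J: "finite J"
begin

private lemma prob_root: "prob_space (root_law \<mu> k)" "prob_space (root_law \<nu> k)" "prob_space (root_law \<rho> k)"
  using real_distribution_root_law[OF _ k] \<mu> \<nu> \<rho> unfolding real_distribution_def by blast+

private lemma sets_root: "sets (root_law \<tau> k) = sets borel" for \<tau>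
  by (simp add: root_law_def)

private abbreviation "PX \<equiv> PiM J (\<lambda>_. root_law \<mu> k)"
private abbreviation "PY \<equiv> PiM J (\<lambda>_. root_law \<nu> k)"

private lemma comp_fst: "j \<in> J \<Longrightarrow> (\<lambda>p. fst p j) \<in> borel_measurable (PX \<Otimes>\<^sub>M PY)"
  by (rule measurable_compose[OF measurable_fst measurable_PiM_component[OF prob_root(1) sets_root]])

private lemma comp_snd: "j \<in> J \<Longrightarrow> (\<lambda>p. snd p j) \<in> borel_measurable (PX \<Otimes>\<^sub>M PY)"
  by (rule measurable_compose[OF measurable_snd measurable_PiM_component[OF prob_root(2) sets_root]])

lemma distr_max_root_law:
  "distr (PX \<Otimes>\<^sub>M PY) (PiM J (\<lambda>_. borel)) (\<lambda>p. \<lambda>j\<in>J. max (fst p j) (snd p j)) = PiM J (\<lambda>_. root_law \<rho> k)"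
proof -
  interpret PX: prob_space PX by (intro prob_space_PiM prob_root)
  interpret PY: prob_space PY by (intro prob_space_PiM prob_root)
  have m: "(\<lambda>p. \<lambda>j\<in>J. max (fst p j) (snd p j)) \<in> measurable (PX \<Otimes>\<^sub>M PY) (PiM J (\<lambda>_. borel))"
    by (intro measurable_restrict borel_measurable_max comp_fst comp_snd)
  have "PiM J (\<lambda>_. root_law \<rho> k) = distr (PX \<Otimes>\<^sub>M PY) (PiM J (\<lambda>_. borel)) (\<lambda>p. \<lambda>j\<in>J. max (fst p j) (snd p j))"
  proof (rule measure_eqI_orthants[OF J])
    show "prob_space (PiM J (\<lambda>_. root_law \<rho> k))" by (intro prob_space_PiM prob_root)
    show "sets (PiM J (\<lambda>_. root_law \<rho> k)) = sets (PiM J (\<lambda>_. borel))" by (rule sets_PiM_law[OF prob_root(3) sets_root])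
    fix t :: "nat \<Rightarrow> real"
    let ?O = "{x \<in> space (PiM J (\<lambda>_. borel)). \<forall>j\<in>J. x j \<le> t j}"
    have O: "?O \<in> sets (PiM J (\<lambda>_. borel))" by (rule sets_orthant[OF J])
    have "emeasure (distr (PX \<Otimes>\<^sub>M PY) (PiM J (\<lambda>_. borel)) (\<lambda>p. \<lambda>j\<in>J. max (fst p j) (snd p j))) ?O
      = emeasure (PX \<Otimes>\<^sub>M PY) ((\<lambda>p. \<lambda>j\<in>J. max (fst p j) (snd p j)) -` ?O \<inter> space (PX \<Otimes>\<^sub>M PY))"
      by (rule emeasure_distr[OF m O])
    also have "(\<lambda>p. \<lambda>j\<in>J. max (fst p j) (snd p j)) -` ?O \<inter> space (PX \<Otimes>\<^sub>M PY) = ?O \<times> ?O"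
      using sets_eq_imp_space_eq[OF sets_PiM_law[OF prob_root(1) sets_root, of J]]
        sets_eq_imp_space_eq[OF sets_PiM_law[OF prob_root(2) sets_root, of J]]
      by (auto simp: space_pair_measure space_PiM)
    also have "emeasure (PX \<Otimes>\<^sub>M PY) (?O \<times> ?O) = emeasure PX ?O * emeasure PY ?O"
      using O by (intro PY.emeasure_pair_measure_Times) (simp_all add: sets_PiM_law[OF prob_root(1) sets_root] sets_PiM_law[OF prob_root(2) sets_root])
    also have "\<dots> = (\<Prod>j\<in>J. emeasure (root_law \<mu> k) {..t j} * emeasure (root_law \<nu> k) {..t j})"
      by (simp only: emeasure_PiM_orthant[OF J prob_root(1) sets_root] emeasure_PiM_orthant[OF J prob_root(2) sets_root] prod.distrib)
    also have "\<dots> = (\<Prod>j\<in>J. emeasure (root_law \<rho> k) {..t j})"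
    proof (intro prod.cong refl)
      fix j
      interpret m: real_distribution \<mu> by (rule \<mu>)
      interpret n: real_distribution \<nu> by (rule \<nu>)
      show "emeasure (root_law \<mu> k) {..t j} * emeasure (root_law \<nu> k) {..t j} = emeasure (root_law \<rho> k) {..t j}"
        unfolding emeasure_root_law_atMost[OF \<mu> k] emeasure_root_law_atMost[OF \<nu> k] emeasure_root_law_atMost[OF \<rho> k] cdf
        by (simp add: powr_mult m.cdf_nonneg n.cdf_nonneg ennreal_mult)
    qed
    also have "\<dots> = emeasure (PiM J (\<lambda>_. root_law \<rho> k)) ?O"
      by (rule emeasure_PiM_orthant[OF J prob_root(3) sets_root, symmetric])
    finally show "emeasure (PiM J (\<lambda>_. root_law \<rho> k)) ?O
      = emeasure (distr (PX \<Otimes>\<^sub>M PY) (PiM J (\<lambda>_. borel)) (\<lambda>p. \<lambda>j\<in>J. max (fst p j) (snd p j))) ?O" ..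
  qed simp
  then show ?thesis ..
qed

text \<open>In \<open>E1\<close> both members of every pair are counted, in \<open>E2\<close> only
  the larger one. By \<open>hsup_law_sup\<close> the first event describes the supremum of two
  independent matrices, while the second describes the samples for \<rho>.\<close>

private definition "E1 t I = {p \<in> space (PX \<Otimes>\<^sub>M PY). \<forall>i\<in>I. card {j\<in>J. t i < fst p j} + card {j\<in>J. t i < snd p j} < i}"
  for t :: "nat \<Rightarrow> real" and I :: "nat set"
private definition "E2 t I = {p \<in> space (PX \<Otimes>\<^sub>M PY). \<forall>i\<in>I. card {j\<in>J. t i < max (fst p j) (snd p j)} < i}"
  for t :: "nat \<Rightarrow> real" and I :: "nat set"

private lemma sets_E1: "finite I \<Longrightarrow> E1 t I \<in> sets (PX \<Otimes>\<^sub>M PY)"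
  unfolding E1_def
  by (intro sets.sets_Collect_finite_All borel_measurable_less borel_measurable_add measurable_card_gt J comp_fst comp_snd) auto

private lemma sets_E2: "finite I \<Longrightarrow> E2 t I \<in> sets (PX \<Otimes>\<^sub>M PY)"
  unfolding E2_def by (intro sets_card_gt J borel_measurable_max comp_fst comp_snd)

private lemma emeasure_E1:
  assumes I: "finite I"
  shows "emeasure (PX \<Otimes>\<^sub>M PY) (E1 t I) = (\<integral>\<^sup>+y. cprob (root_law \<mu> k) J I t (\<lambda>i. i - card {j\<in>J. t i < y j}) \<partial>PY)"
proof -
  interpret PX: prob_space PX by (intro prob_space_PiM prob_root)
  interpret PY: prob_space PY by (intro prob_space_PiM prob_root)
  interpret pair_sigma_finite PX PY ..
  have "(\<lambda>x. (x, y)) -` E1 t I = {x \<in> space PX. \<forall>i\<in>I. card {j\<in>J. t i < x j} < i - card {j\<in>J. t i < y j}}"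
    if "y \<in> space PY" for y
    using that by (auto simp: E1_def space_pair_measure less_diff_conv)
  then show ?thesis
    unfolding cprob_def emeasure_pair_measure_alt2[OF sets_E1[OF I]] by (intro nn_integral_cong) simp
qed

private lemma emeasure_E2:
  assumes I: "finite I"
  shows "emeasure (PX \<Otimes>\<^sub>M PY) (E2 t I) = cprob (root_law \<rho> k) J I t (\<lambda>i. i)"
proof -
  let ?m = "\<lambda>p :: (nat \<Rightarrow> real) \<times> (nat \<Rightarrow> real). \<lambda>j\<in>J. max (fst p j) (snd p j)"
  let ?X = "{x \<in> space (PiM J (\<lambda>_. root_law \<rho> k)). \<forall>i\<in>I. card {j\<in>J. t i < x j} < i}"
  have m: "?m \<in> measurable (PX \<Otimes>\<^sub>M PY) (PiM J (\<lambda>_. borel))"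
    by (intro measurable_restrict borel_measurable_max comp_fst comp_snd)
  have "?X \<in> sets (PiM J (\<lambda>_. root_law \<rho> k))"
    by (intro sets_card_gt J I measurable_PiM_component prob_root sets_root)
  then have X: "?X \<in> sets (PiM J (\<lambda>_. borel))" by (simp only: sets_PiM_law[OF prob_root(3) sets_root])
  have sp: "space (PiM J (\<lambda>_. root_law \<rho> k)) = space (PiM J (\<lambda>_. borel))"
    by (rule sets_eq_imp_space_eq[OF sets_PiM_law[OF prob_root(3) sets_root]])
  have "cprob (root_law \<rho> k) J I t (\<lambda>i. i) = emeasure (distr (PX \<Otimes>\<^sub>M PY) (PiM J (\<lambda>_. borel)) ?m) ?X"
    unfolding cprob_def distr_max_root_law ..
  also have "\<dots> = emeasure (PX \<Otimes>\<^sub>M PY) (?m -` ?X \<inter> space (PX \<Otimes>\<^sub>M PY))" by (rule emeasure_distr[OF m X])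
  also have "?m -` ?X \<inter> space (PX \<Otimes>\<^sub>M PY) = E2 t I"
  proof -
    have "{j\<in>J. t i < ?m p j} = {j\<in>J. t i < max (fst p j) (snd p j)}" for i p by auto
    then show ?thesis using measurable_space[OF m] unfolding E2_def sp by auto
  qed
  finally show ?thesis ..
qed

text \<open>Counting both members can only increase the count, so \<open>E1\<close> is contained in
  \<open>E2\<close>. A point of the difference has some pair with both members above
  \<open>s\<close>, which lies below all levels \<open>t i\<close>; the error term is the union
  bound over these collisions.\<close>

lemma cprob_max_bounds:
  assumes I: "finite I" and s: "\<And>i. i \<in> I \<Longrightarrow> s \<le> t i"
  shows "(\<integral>\<^sup>+y. cprob (root_law \<mu> k) J I t (\<lambda>i. i - card {j\<in>J. t i < y j}) \<partial>PY) \<le> cprob (root_law \<rho> k) J I t (\<lambda>i. i)"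
    and "cprob (root_law \<rho> k) J I t (\<lambda>i. i) \<le> (\<integral>\<^sup>+y. cprob (root_law \<mu> k) J I t (\<lambda>i. i - card {j\<in>J. t i < y j}) \<partial>PY)
      + of_nat (card J) * (ennreal (1 - cdf \<mu> s powr (1 / real k)) * ennreal (1 - cdf \<nu> s powr (1 / real k)))"
proof -
  interpret PX: prob_space PX by (intro prob_space_PiM prob_root)
  interpret PY: prob_space PY by (intro prob_space_PiM prob_root)
  have "card {j\<in>J. u < max (x j) (y j)} \<le> card {j\<in>J. u < x j} + card {j\<in>J. u < y j}" for u and x y :: "nat \<Rightarrow> real"
  proof -
    have "{j\<in>J. u < max (x j) (y j)} = {j\<in>J. u < x j} \<union> {j\<in>J. u < y j}" by (auto simp: less_max_iff_disj)
    then show ?thesis by (simp add: card_Un_le)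
  qed
  then have "E1 t I \<subseteq> E2 t I" unfolding E1_def E2_def by (blast intro: le_less_trans)
  then show "(\<integral>\<^sup>+y. cprob (root_law \<mu> k) J I t (\<lambda>i. i - card {j\<in>J. t i < y j}) \<partial>PY) \<le> cprob (root_law \<rho> k) J I t (\<lambda>i. i)"
    unfolding emeasure_E1[OF I, symmetric] emeasure_E2[OF I, symmetric] by (intro emeasure_mono sets_E2 I)
  define D where "D j = {x \<in> space PX. s < x j} \<times> {y \<in> space PY. s < y j}" for j
  have sD: "{x \<in> space PX. s < x j} \<in> sets PX" "{y \<in> space PY. s < y j} \<in> sets PY" if "j \<in> J" for j
    by (rule borel_measurable_less[OF borel_measurable_const measurable_PiM_component[OF prob_root(1) sets_root that]])
      (rule borel_measurable_less[OF borel_measurable_const measurable_PiM_component[OF prob_root(2) sets_root that]])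
  have D: "D j \<in> sets (PX \<Otimes>\<^sub>M PY)" if "j \<in> J" for j unfolding D_def using sD[OF that] by blast
  have em: "emeasure (PiM J (\<lambda>_. root_law \<tau> k)) {x \<in> space (PiM J (\<lambda>_. root_law \<tau> k)). s < x j} = ennreal (1 - cdf \<tau> s powr (1 / real k))"
    if j: "j \<in> J" and \<tau>: "real_distribution \<tau>" for j \<tau>
  proof -
    have p: "prob_space (root_law \<tau> k)" using real_distribution_root_law[OF \<tau> k] by (simp add: real_distribution_def)
    have "emeasure (root_law \<tau> k) {s<..} = emeasure (distr (PiM J (\<lambda>_. root_law \<tau> k)) (root_law \<tau> k) (\<lambda>x. x j)) {s<..}"
      by (subst distr_PiM_component[OF p j]) simp
    also have "\<dots> = emeasure (PiM J (\<lambda>_. root_law \<tau> k)) ((\<lambda>x. x j) -` {s<..} \<inter> space (PiM J (\<lambda>_. root_law \<tau> k)))"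
      using j by (intro emeasure_distr measurable_component_singleton) (auto simp: sets_root)
    also have "(\<lambda>x. x j) -` {s<..} \<inter> space (PiM J (\<lambda>_. root_law \<tau> k)) = {x \<in> space (PiM J (\<lambda>_. root_law \<tau> k)). s < x j}" by auto
    finally show ?thesis by (simp add: emeasure_root_law_greaterThan[OF \<tau> k])
  qed
  have eD: "emeasure (PX \<Otimes>\<^sub>M PY) (D j) = ennreal (1 - cdf \<mu> s powr (1 / real k)) * ennreal (1 - cdf \<nu> s powr (1 / real k))"
    if "j \<in> J" for j
    unfolding D_def PY.emeasure_pair_measure_Times[OF sD[OF that]] em[OF that \<mu>] em[OF that \<nu>] ..
  have "E2 t I \<subseteq> E1 t I \<union> (\<Union>j\<in>J. D j)"
  proof
    fix p assume p: "p \<in> E2 t I"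
    show "p \<in> E1 t I \<union> (\<Union>j\<in>J. D j)"
    proof (cases "\<exists>j\<in>J. s < fst p j \<and> s < snd p j")
      case True
      then show ?thesis using p by (auto simp: E2_def D_def space_pair_measure)
    next
      case False
      have "card {j\<in>J. t i < max (fst p j) (snd p j)} = card {j\<in>J. t i < fst p j} + card {j\<in>J. t i < snd p j}" if "i \<in> I" for i
      proof -
        have "{j\<in>J. t i < max (fst p j) (snd p j)} = {j\<in>J. t i < fst p j} \<union> {j\<in>J. t i < snd p j}" by (auto simp: less_max_iff_disj)
        moreover have "{j\<in>J. t i < fst p j} \<inter> {j\<in>J. t i < snd p j} = {}"
          using False s[OF that] by fastforce
        ultimately show ?thesis using J by (simp add: card_Un_disjoint)
      qed
      then have "p \<in> E1 t I" using p by (simp add: E1_def E2_def)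
      then show ?thesis by blast
    qed
  qed
  then have "emeasure (PX \<Otimes>\<^sub>M PY) (E2 t I) \<le> emeasure (PX \<Otimes>\<^sub>M PY) (E1 t I \<union> (\<Union>j\<in>J. D j))"
    using J D sets_E1[OF I, of t] by (intro emeasure_mono sets.Un sets.finite_UN) auto
  also have "\<dots> \<le> emeasure (PX \<Otimes>\<^sub>M PY) (E1 t I) + emeasure (PX \<Otimes>\<^sub>M PY) (\<Union>j\<in>J. D j)"
    using J D sets_E1[OF I, of t] by (intro emeasure_subadditive sets.finite_UN) auto
  also have "emeasure (PX \<Otimes>\<^sub>M PY) (\<Union>j\<in>J. D j) \<le> (\<Sum>j\<in>J. emeasure (PX \<Otimes>\<^sub>M PY) (D j))"
    using J D by (intro emeasure_subadditive_finite) auto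
  also have "\<dots> = of_nat (card J) * (ennreal (1 - cdf \<mu> s powr (1 / real k)) * ennreal (1 - cdf \<nu> s powr (1 / real k)))"
    by (simp add: eD)
  finally show "cprob (root_law \<rho> k) J I t (\<lambda>i. i) \<le> (\<integral>\<^sup>+y. cprob (root_law \<mu> k) J I t (\<lambda>i. i - card {j\<in>J. t i < y j}) \<partial>PY)
      + of_nat (card J) * (ennreal (1 - cdf \<mu> s powr (1 / real k)) * ennreal (1 - cdf \<nu> s powr (1 / real k)))"
    unfolding emeasure_E1[OF I, symmetric] emeasure_E2[OF I, symmetric] by (simp add: add_left_mono)
qed

end

text \<open>At a level where the distribution function vanishes, almost surely all samples lie above
  it, at least \<open>i\<close> of them. This settles the case in which the logarithmic estimate for
  collisions breaks down.\<close>

lemma cprob_root_law_eq_0: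
  fixes J :: "nat set"
  assumes \<mu>: "real_distribution \<mu>" and k: "k \<ge> 1" and J: "finite J" and I: "finite I" and i: "i \<in> I" "i \<le> card J" and z: "cdf \<mu> (t i) = 0"
  shows "cprob (root_law \<mu> k) J I t (\<lambda>i. i) = 0"
proof -
  interpret R: real_distribution "root_law \<mu> k" by (rule real_distribution_root_law[OF \<mu> k])
  have R: "prob_space (root_law \<mu> k)" "sets (root_law \<mu> k) = sets borel" by (auto intro: R.prob_space_axioms)
  let ?X = "{x \<in> space (PiM J (\<lambda>_. root_law \<mu> k)). \<forall>i\<in>I. card {j\<in>J. t i < x j} < i}"
  have X: "?X \<in> sets (PiM J (\<lambda>_. root_law \<mu> k))" by (intro sets_card_gt J I measurable_PiM_component R)
  have "emeasure (root_law \<mu> k) {..t i} = 0" using emeasure_root_law_atMost[OF \<mu> k, of "t i"] z by simp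
  then have "AE u in root_law \<mu> k. t i < u"
    by (intro AE_I[of _ _ "{..t i}"]) auto
  then have "AE x in PiM J (\<lambda>_. root_law \<mu> k). \<forall>j\<in>J. t i < x j"
    using J by (intro AE_finite_allI AE_PiM_component[OF R(1)]) auto
  then have "AE x in PiM J (\<lambda>_. root_law \<mu> k). x \<notin> ?X"
  proof eventually_elim
    case (elim x)
    then have "{j\<in>J. t i < x j} = J" by auto
    then have "\<not> card {j\<in>J. t i < x j} < i" using i(2) by simp
    then show ?case using i(1) by blast
  qed
  then show ?thesis unfolding cprob_def using X by (simp add: AE_iff_measurable[OF X])
qed

context haar
begin

text \<open>Eigenvalues are exchanged for independent samples one argument at a time. Exchanging the
  order of integration conditions on the first matrix, where the counts of the second may be
  replaced by those of its samples; exchanging it back allows the same for the first.\<close>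

lemma hsup_law_sup:
  fixes J :: "nat set"
  assumes \<mu>: "real_distribution \<mu>" and \<nu>: "real_distribution \<nu>" and k: "k \<ge> 1" and J: "finite J" "card J = k * CARD('n)"
    and I: "finite I" "\<And>i. i \<in> I \<Longrightarrow> i \<le> CARD('n)"
  shows "emeasure (distr (law_sup H \<mu> k \<Otimes>\<^sub>M law_sup H \<nu> k) borel (\<lambda>(A, B). hsup A B)) {A. \<forall>i\<in>I. cnt A (t i) < i}
    = (\<integral>\<^sup>+y. cprob (root_law \<mu> k) J I t (\<lambda>i. i - card {j\<in>J. t i < y j}) \<partial>PiM J (\<lambda>_. root_law \<nu> k))"
proof -
  note P = law_sup_props[OF \<mu> k] and Q = law_sup_props[OF \<nu> k]
  let ?R = "ELaw \<nu> CARD('n) (dens CARD('n) k)" and ?P = "law_sup H \<mu> k"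
  interpret haar_eig H ?R by (rule haar_eig_dens[OF \<nu> k])
  interpret RN: real_distribution "root_law \<nu> k" by (rule real_distribution_root_law[OF \<nu> k])
  have RN: "prob_space (root_law \<nu> k)" "sets (root_law \<nu> k) = sets borel" by (auto intro: RN.prob_space_axioms)
  have le: "i - c \<le> CARD('n)" if "i \<in> I" for i c using I(2)[OF that] by simp
  have "emeasure (distr (?P \<Otimes>\<^sub>M law_sup H \<nu> k) borel (\<lambda>(A, B). hsup A B)) {A. \<forall>i\<in>I. cnt A (t i) < i}
    = (\<integral>\<^sup>+x. emeasure ?P {A. \<forall>i\<in>I. cnt A (t i) < i - card {j\<in>{1..CARD('n)}. t i < x j}} \<partial>?R)"
    unfolding law_sup_eq_mat_law(1)[OF \<nu> k] using P I by (intro hsup_mat_law) auto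
  also have "\<dots> = (\<integral>\<^sup>+A. emeasure ?R {x \<in> space ?R. \<forall>i\<in>I. card {j\<in>{1..CARD('n)}. t i < x j} < i - cnt A (t i)} \<partial>?P)"
    by (rule pair_orthant(1)[OF P(1,2) prob_R _ _ I(1), symmetric]) (auto intro: measurable_component_singleton simp: measurable_cong_sets[OF sets_R refl])
  also have "\<dots> = (\<integral>\<^sup>+A. emeasure (law_sup H \<nu> k) {B. \<forall>i\<in>I. cnt B (t i) < i - cnt A (t i)} \<partial>?P)"
    unfolding law_sup_eq_mat_law(1)[OF \<nu> k] emeasure_mat_law_cnt[OF I(1)] ..
  also have "\<dots> = (\<integral>\<^sup>+A. cprob (root_law \<nu> k) J I t (\<lambda>i. i - cnt A (t i)) \<partial>?P)"
    by (intro nn_integral_cong Q(5) I J le)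
  also have "\<dots> = (\<integral>\<^sup>+y. emeasure ?P {A. \<forall>i\<in>I. cnt A (t i) < i - card {j\<in>J. t i < y j}} \<partial>PiM J (\<lambda>_. root_law \<nu> k))"
    unfolding cprob_def
    by (intro pair_orthant(1) P(1,2) prob_space_PiM RN J(1) I(1) measurable_PiM_component)
  also have "\<dots> = (\<integral>\<^sup>+y. cprob (root_law \<mu> k) J I t (\<lambda>i. i - card {j\<in>J. t i < y j}) \<partial>PiM J (\<lambda>_. root_law \<nu> k))"
    by (intro nn_integral_cong P(5) I J le)
  finally show ?thesis .
qed

text \<open>The first law enters only through the probabilities \<open>h P x\<close>, which converge
  for each \<open>x\<close> by \<open>emeasure_law_sup_tendsto\<close>, and the second only through
  its density. Both limits are taken at once.\<close>

lemma hsup_law_sup_tendsto: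
  assumes \<mu>: "real_distribution \<mu>" and \<nu>: "real_distribution \<nu>" and I: "finite I" "\<And>i. i \<in> I \<Longrightarrow> i \<le> CARD('n)"
  shows "(\<lambda>n. emeasure (distr (law_sup H \<mu> (Suc n) \<Otimes>\<^sub>M law_sup H \<nu> (Suc n)) borel (\<lambda>(A, B). hsup A B)) {A. \<forall>i\<in>I. cnt A (t i) < i})
    \<longlonglongrightarrow> emeasure (distr (Lam \<mu> \<Otimes>\<^sub>M Lam \<nu>) borel (\<lambda>(A, B). hsup A B)) {A. \<forall>i\<in>I. cnt A (t i) < i}"
proof -
  define h where "h P x = emeasure P {A. \<forall>i\<in>I. cnt A (t i) < i - card {j\<in>{1..CARD('n)}. t i < x j}}" for P :: "'n cmat measure" and x :: "nat \<Rightarrow> real"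
  have eq: "emeasure (distr (P \<Otimes>\<^sub>M mat_law H (ELaw \<nu> CARD('n) d)) borel (\<lambda>(A, B). hsup A B)) {A. \<forall>i\<in>I. cnt A (t i) < i}
      = (\<integral>\<^sup>+v. d v * h P (quants \<nu> CARD('n) v) \<partial>PiM {1..CARD('n)} (\<lambda>_. unif))"
    and meas: "(\<lambda>v. h P (quants \<nu> CARD('n) v)) \<in> borel_measurable (PiM {1..CARD('n)} (\<lambda>_. unif))"
    if P: "prob_space P" "sets P = sets borel" "AE A in P. hermitian A"
      and d: "prob_space (ELaw \<nu> CARD('n) d)" "d \<in> borel_measurable (PiM {1..CARD('n)} (\<lambda>_. unif))" for P :: "'n cmat measure" and d
  proof -
    interpret haar_eig H "ELaw \<nu> CARD('n) d" by (rule haar_eig_ELaw[OF d(1)])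
    have "h P \<in> borel_measurable (ELaw \<nu> CARD('n) d)"
      unfolding h_def
      by (rule pair_orthant(2)[OF P(1,2) prob_R _ _ I(1)]) (auto intro: measurable_component_singleton simp: measurable_cong_sets[OF sets_R refl])
    then have hm: "h P \<in> borel_measurable (PiM {1..CARD('n)} (\<lambda>_. borel))" by (simp only: measurable_cong_sets[OF sets_R refl])
    show "(\<lambda>v. h P (quants \<nu> CARD('n) v)) \<in> borel_measurable (PiM {1..CARD('n)} (\<lambda>_. unif))"
      by (rule measurable_compose[OF measurable_quants[OF \<nu>] hm])
    have "emeasure (distr (P \<Otimes>\<^sub>M mat_law H (ELaw \<nu> CARD('n) d)) borel (\<lambda>(A, B). hsup A B)) {A. \<forall>i\<in>I. cnt A (t i) < i}
      = (\<integral>\<^sup>+x. h P x \<partial>ELaw \<nu> CARD('n) d)"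
      unfolding h_def using P I by (intro hsup_mat_law) auto
    also have "\<dots> = (\<integral>\<^sup>+v. d v * h P (quants \<nu> CARD('n) v) \<partial>PiM {1..CARD('n)} (\<lambda>_. unif))"
      by (rule nn_integral_ELaw[OF \<nu> d(2) hm])
    finally show "emeasure (distr (P \<Otimes>\<^sub>M mat_law H (ELaw \<nu> CARD('n) d)) borel (\<lambda>(A, B). hsup A B)) {A. \<forall>i\<in>I. cnt A (t i) < i}
      = (\<integral>\<^sup>+v. d v * h P (quants \<nu> CARD('n) v) \<partial>PiM {1..CARD('n)} (\<lambda>_. unif))" .
  qed
  have k: "Suc n \<ge> 1" for n by simp
  note P = law_sup_props(1-3)[OF \<mu> k] and L = Lam_props(1-3)[OF \<mu>]
  note dP = law_sup_eq_mat_law(2)[OF \<nu> k] measurable_dens(1)[OF N_pos]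
    and dL = prob_ELaw_lim[OF \<nu>] measurable_dens(2)[OF N_pos]
  show ?thesis
    unfolding Lam_def[of \<nu>] law_sup_eq_mat_law(1)[OF \<nu> k] eq[OF P dP] eq[OF L dL]
  proof (rule nn_integral_dens_tendsto[OF N_pos meas[OF P dP] meas[OF L dL], where B = 1])
    show "h (law_sup H \<mu> (Suc n)) x \<le> ennreal 1" for n x
      unfolding h_def using prob_space.emeasure_le_1[OF P(1)] by simp
    show "(\<lambda>n. h (law_sup H \<mu> (Suc n)) x) \<longlonglongrightarrow> h (Lam \<mu>) x" for x
      unfolding h_def by (intro emeasure_law_sup_tendsto \<mu> sets_cnt_lt I)
  qed
qed

text \<open>From \<open>1 + x \<le> exp x\<close> with \<open>x = ln a / k\<close> one gets
  \<open>1 - a powr (1 / k) \<le> - ln a / k\<close>. A single pair thus collides with probability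
  of order \<open>1 / k^2\<close>, and there are only \<open>k * m\<close> pairs.\<close>

lemma collision_tendsto_0:
  fixes a b :: real
  assumes a: "0 < a" "a \<le> 1" and b: "0 < b" "b \<le> 1"
  shows "(\<lambda>n. of_nat (Suc n * m) * (ennreal (1 - a powr (1 / real (Suc n))) * ennreal (1 - b powr (1 / real (Suc n))))) \<longlonglongrightarrow> 0"
proof -
  have bound: "0 \<le> 1 - a powr (1 / real (Suc n)) \<and> 1 - a powr (1 / real (Suc n)) \<le> - ln a / real (Suc n)"
    if "0 < a" "a \<le> 1" for a :: real and n
  proof
    show "0 \<le> 1 - a powr (1 / real (Suc n))" using powr_le1[of "1 / real (Suc n)" a] that by simp
    have "1 + ln a / real (Suc n) \<le> exp (ln a / real (Suc n))" by (rule exp_ge_add_one_self)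
    also have "\<dots> = a powr (1 / real (Suc n))" using that by (simp add: powr_def)
    finally show "1 - a powr (1 / real (Suc n)) \<le> - ln a / real (Suc n)" by simp
  qed
  have le: "of_nat (Suc n * m) * (ennreal (1 - a powr (1 / real (Suc n))) * ennreal (1 - b powr (1 / real (Suc n))))
    \<le> ennreal (real m * ln a * ln b * (1 / real (Suc n)))" for n
  proof -
    note A = bound[OF a, of n] and B = bound[OF b, of n]
    have "(1 - a powr (1 / real (Suc n))) * (1 - b powr (1 / real (Suc n))) \<le> (- ln a / real (Suc n)) * (- ln b / real (Suc n))"
      using A B by (intro mult_mono) auto
    then have "real (Suc n * m) * ((1 - a powr (1 / real (Suc n))) * (1 - b powr (1 / real (Suc n))))
      \<le> real (Suc n * m) * ((- ln a / real (Suc n)) * (- ln b / real (Suc n)))" by (intro mult_left_mono) auto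
    also have "\<dots> = real m * ln a * ln b * (1 / real (Suc n))"
    proof -
      have cancel: "c * m * (- x / c * (- y / c)) = m * x * y * (1 / c)" if "c \<noteq> 0" for c m x y :: real
        using that by simp
      show ?thesis unfolding of_nat_mult by (rule cancel) simp
    qed
    finally have "ennreal (real (Suc n * m) * ((1 - a powr (1 / real (Suc n))) * (1 - b powr (1 / real (Suc n)))))
      \<le> ennreal (real m * ln a * ln b * (1 / real (Suc n)))" by (rule ennreal_leI)
    moreover have "ennreal (real (Suc n * m) * ((1 - a powr (1 / real (Suc n))) * (1 - b powr (1 / real (Suc n)))))
      = of_nat (Suc n * m) * (ennreal (1 - a powr (1 / real (Suc n))) * ennreal (1 - b powr (1 / real (Suc n))))"
      using A B by (simp only: ennreal_mult ennreal_of_nat_eq_real_of_nat of_nat_0_le_iff mult_nonneg_nonneg)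
    ultimately show ?thesis by simp
  qed
  have "(\<lambda>n. real m * ln a * ln b * (1 / real (Suc n))) \<longlonglongrightarrow> real m * ln a * ln b * 0"
    by (intro tendsto_mult tendsto_const LIMSEQ_Suc[OF lim_1_over_n])
  then have lim: "(\<lambda>n. ennreal (real m * ln a * ln b * (1 / real (Suc n)))) \<longlonglongrightarrow> 0"
    using tendsto_ennrealI by fastforce
  show ?thesis
    by (rule tendsto_sandwich[OF always_eventually always_eventually tendsto_const lim]) (intro allI le zero_le)+
qed

lemma hsup_Lam:
  assumes \<mu>: "real_distribution \<mu>" and \<nu>: "real_distribution \<nu>" and \<rho>: "real_distribution \<rho>"
    and cdf: "\<And>x. cdf \<rho> x = cdf \<mu> x * cdf \<nu> x"
  shows "distr (Lam \<mu> \<Otimes>\<^sub>M Lam \<nu>) borel (\<lambda>(A, B). hsup A B) = Lam \<rho>"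
proof (rule conj_inv_law_unique)
  let ?D = "distr (Lam \<mu> \<Otimes>\<^sub>M Lam \<nu>) borel (\<lambda>(A, B). hsup A B)"
  note P = Lam_props[OF \<mu>] and Q = Lam_props[OF \<nu>]
  note P(2)[measurable_cong] Q(2)[measurable_cong]
  interpret p: prob_space "Lam \<mu>" by (rule P)
  interpret q: prob_space "Lam \<nu>" by (rule Q)
  interpret pair_prob_space "Lam \<mu>" "Lam \<nu>" ..
  show "prob_space ?D" unfolding case_prod_beta by (rule prob_space_distr) measurable
  show "sets ?D = sets borel" by simp
  show "AE A in ?D. hermitian A"
    unfolding case_prod_beta by (subst AE_distr_iff) (measurable, auto simp: hermitian_hsup)
  show "conj_inv ?D"
  proof -
    interpret haar_eig H "ELaw \<nu> CARD('n) (lim_dens CARD('n))" by (rule haar_eig_lim[OF \<nu>])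
    show ?thesis unfolding Lam_def[of \<nu>] by (rule conj_inv_hsup[OF P(1,2,4)])
  qed
  fix t :: "nat \<Rightarrow> real"
  let ?I = "{1..CARD('n)}"
  let ?E = "{A :: 'n cmat. \<forall>i\<in>?I. cnt A (t i) < i}"
  \<comment> \<open>Collisions above the lowest level include those above every other one, so a
    single error term serves all ranks.\<close>
  define s where "s = Min (t ` ?I)"
  have s: "s \<le> t i" if "i \<in> ?I" for i unfolding s_def using that by (intro Min_le) auto
  have "s \<in> t ` ?I" unfolding s_def using N_pos by (intro Min_in) auto
  then obtain i0 where i0: "i0 \<in> ?I" "s = t i0" by blast
  define J where "J n = {..<Suc n * CARD('n)}" for n
  have J: "finite (J n)" "card (J n) = Suc n * CARD('n)" for n by (simp_all add: J_def)
  have k: "Suc n \<ge> 1" for n by simp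
  define e1 where "e1 n = emeasure (distr (law_sup H \<mu> (Suc n) \<Otimes>\<^sub>M law_sup H \<nu> (Suc n)) borel (\<lambda>(A, B). hsup A B)) ?E" for n
  define e2 where "e2 n = cprob (root_law \<rho> (Suc n)) (J n) ?I t (\<lambda>i. i)" for n
  define \<delta> where "\<delta> n = of_nat (Suc n * CARD('n)) * (ennreal (1 - cdf \<mu> s powr (1 / real (Suc n))) * ennreal (1 - cdf \<nu> s powr (1 / real (Suc n))))" for n
  have e1_lim: "e1 \<longlonglongrightarrow> emeasure ?D ?E"
    unfolding e1_def by (rule hsup_law_sup_tendsto[OF \<mu> \<nu>]) auto
  have "emeasure (law_sup H \<rho> (Suc n)) ?E = e2 n" for n
    unfolding e2_def by (intro law_sup_props(5)[OF \<rho> k] J) auto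
  then have e2_lim: "e2 \<longlonglongrightarrow> emeasure (Lam \<rho>) ?E"
    using emeasure_law_sup_tendsto[OF \<rho> sets_cnt_lt[of ?I t "\<lambda>i. i"]] by simp
  have e1: "e1 n = (\<integral>\<^sup>+y. cprob (root_law \<mu> (Suc n)) (J n) ?I t (\<lambda>i. i - card {j\<in>J n. t i < y j}) \<partial>PiM (J n) (\<lambda>_. root_law \<nu> (Suc n)))" for n
    unfolding e1_def by (rule hsup_law_sup[OF \<mu> \<nu> k J]) auto
  have le12: "e1 n \<le> e2 n" for n
    unfolding e1 e2_def by (rule cprob_max_bounds(1)[OF \<mu> \<nu> \<rho> cdf k J(1) _ s]) auto
  have le21: "e2 n \<le> e1 n + \<delta> n" for n
    unfolding e1 e2_def \<delta>_def J(2)[symmetric] by (rule cprob_max_bounds(2)[OF \<mu> \<nu> \<rho> cdf k J(1) _ s]) auto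
  interpret m: real_distribution \<mu> by (rule \<mu>)
  interpret n: real_distribution \<nu> by (rule \<nu>)
  show "emeasure ?D ?E = emeasure (Lam \<rho>) ?E"
  \<comment> \<open>If the distribution function of \<rho> vanishes at the lowest level, both limits
    are 0. Otherwise neither factor of \<open>cdf \<rho> s\<close> vanishes, and the collision
    estimate makes the two sequences asymptotically equal.\<close>
  proof (cases "cdf \<rho> s = 0")
    case True
    have z2: "e2 n = 0" for n
      unfolding e2_def using i0 True by (intro cprob_root_law_eq_0[OF \<rho> k J(1), of _ i0]) (auto simp: J(2))
    have z1: "e1 n = 0" for n using le12[of n] z2[of n] by simp
    have "e1 = (\<lambda>_. 0)" "e2 = (\<lambda>_. 0)" using z1 z2 by blast+
    then have "e1 \<longlonglongrightarrow> 0" "e2 \<longlonglongrightarrow> 0" by (simp_all only: tendsto_const)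
    then have "emeasure ?D ?E = 0" "emeasure (Lam \<rho>) ?E = 0"
      using LIMSEQ_unique[OF e1_lim] LIMSEQ_unique[OF e2_lim] by blast+
    then show ?thesis by simp
  next
    case False
    then have "cdf \<mu> s > 0" "cdf \<nu> s > 0" using m.cdf_nonneg[of s] n.cdf_nonneg[of s] unfolding cdf by (auto simp: less_le)
    then have "\<delta> \<longlonglongrightarrow> 0"
      unfolding \<delta>_def by (intro collision_tendsto_0 m.cdf_bounded_prob n.cdf_bounded_prob)
    then have "(\<lambda>n. e1 n + \<delta> n) \<longlonglongrightarrow> emeasure ?D ?E + 0" by (intro tendsto_add e1_lim)
    then have "emeasure (Lam \<rho>) ?E \<le> emeasure ?D ?E"
      using tendsto_le[OF _ _ e2_lim, of "\<lambda>n. e1 n + \<delta> n"] le21 by (auto simp: always_eventually)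
    moreover have "emeasure ?D ?E \<le> emeasure (Lam \<rho>) ?E"
      using tendsto_le[OF _ e2_lim e1_lim] le12 by (auto simp: always_eventually)
    ultimately show ?thesis by (rule antisym[rotated])
  qed
qed (use Lam_props[OF \<rho>] in auto)

end

theorem theorem3p1:
  fixes H :: "'n::finite cmat measure"
  assumes "is_haar H"
  shows "\<exists>\<Lambda> :: real measure \<Rightarrow> 'n cmat measure.
    (\<forall>\<mu>. real_distribution \<mu> \<longrightarrow>
       prob_space (\<Lambda> \<mu>) \<and> sets (\<Lambda> \<mu>) = sets borel \<and> emeasure (\<Lambda> \<mu>) herm_set = 1 \<and>
       weak_conv_herm (\<lambda>k. law_sup H \<mu> (Suc k)) (\<Lambda> \<mu>) \<and>
       (\<forall>V. unitary V \<longrightarrow> distr (\<Lambda> \<mu>) borel (\<lambda>A. V ** A ** adj V) = \<Lambda> \<mu>) \<and>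
       ((\<forall>x. measure \<mu> {x} = 0) \<longrightarrow>
          distr (\<Lambda> \<mu>) (PiM {1..CARD('n)} (\<lambda>_. borel)) eig_desc =
          density (PiM {1..CARD('n)} (\<lambda>_. \<mu>)) (eig_density CARD('n) \<mu>))) \<and>
    (\<forall>\<mu> \<nu> \<rho>. real_distribution \<mu> \<and> real_distribution \<nu> \<and> real_distribution \<rho> \<and>
       (\<forall>x. cdf \<rho> x = cdf \<mu> x * cdf \<nu> x) \<longrightarrow>
       distr (\<Lambda> \<mu> \<Otimes>\<^sub>M \<Lambda> \<nu>) borel (\<lambda>(A, B). hsup A B) = \<Lambda> \<rho>)"
proof -
  interpret haar H by (rule haar.intro) (rule assms)
  show ?thesis
  proof (intro exI[of _ Lam] conjI allI impI)
    fix \<mu> :: "real measure" assume \<mu>: "real_distribution \<mu>"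
    note L = Lam_props[OF \<mu>]
    interpret L: prob_space "Lam \<mu>" by (rule L)
    show "prob_space (Lam \<mu>)" "sets (Lam \<mu>) = sets borel" by (rule L)+
    show "emeasure (Lam \<mu>) herm_set = 1"
    proof (rule L.emeasure_eq_1_AE)
      show "herm_set \<in> sets (Lam \<mu>)"
        using measurable_hermitian[where 'n='n] by (simp add: herm_set_def pred_def L(2))
      show "AE A in Lam \<mu>. A \<in> herm_set" using L(3) by (simp add: herm_set_def)
    qed
    show "weak_conv_herm (\<lambda>k. law_sup H \<mu> (Suc k)) (Lam \<mu>)" by (rule weak_conv_law_sup[OF \<mu>])
    show "distr (Lam \<mu>) borel (\<lambda>A. V ** A ** adj V) = Lam \<mu>" if "unitary V" for V
      using L(4) that by (simp add: conj_inv_def)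
    assume atomless: "\<forall>x. measure \<mu> {x} = 0"
    interpret haar_eig H "ELaw \<mu> CARD('n) (lim_dens CARD('n))" by (rule haar_eig_lim[OF \<mu>])
    show "distr (Lam \<mu>) (PiM {1..CARD('n)} (\<lambda>_. borel)) eig_desc = density (PiM {1..CARD('n)} (\<lambda>_. \<mu>)) (eig_density CARD('n) \<mu>)"
      unfolding Lam_def distr_eig_desc_mat_law[OF AE_srt_ELaw[OF \<mu> N_pos]]
      using atomless by (intro ELaw_atomless \<mu> N_pos) blast
  next
    fix \<mu> \<nu> \<rho> :: "real measure"
    assume "real_distribution \<mu> \<and> real_distribution \<nu> \<and> real_distribution \<rho> \<and> (\<forall>x. cdf \<rho> x = cdf \<mu> x * cdf \<nu> x)"
    then show "distr (Lam \<mu> \<Otimes>\<^sub>M Lam \<nu>) borel (\<lambda>(A, B). hsup A B) = Lam \<rho>"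
      by (intro hsup_Lam) auto
  qed
qed

end
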